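(* Let $d\ge 2$, $\rho\in(0,1)$, and let $\Pi(\mathrm{d}x)=\pi(x)\,\mathrm{d}x$ be a probability distribution on $\mathbb{R}^d$. Let $P$ be the MpCN kernel (with parameter $\rho$) with target $\Pi$. Then $P$ is geometrically ergodic in each of the following two cases. (Heavy-tailed class) $\pi$ is a strictly positive continuous function on $\mathbb{R}^d$ and, for some $\alpha>d$, $$\lim_{r\to\infty}\frac{\pi(rx)}{\pi(re)}=\|x\|^{-\alpha}\qquad (x\in\mathbb{R}^d\setminus\{0\}),$$ where the convergence is locally uniform in $x\in\mathbb{R}^d\setminus\{0\}$ and $e=(1,\ldots,1)/\sqrt d\in\mathbb{R}^d$. (Light-tailed class) $\pi$ is a strictly positive differentiable function on $\mathbb{R}^d$ such that, for every $x\in\mathbb{R}^d\setminus\{0\}$ and every $s>0$ with $s\ne 1$, $$\lim_{r\to\infty}\frac{\pi(rsx)}{\pi(rx)}=\begin{cases}0 & \text{if } s>1,\\ +\infty & \text{if } s<1,\end{cases}$$ and $\pi$ satisfies the curvature condition $$\limsup_{\|x\|\to\infty}\left\langle\frac{x}{\|x\|},\frac{\nabla\log\pi(x)}{\|\nabla\log\pi(x)\|}\right\rangle<0$$ (in particular $\nabla\log\pi(x)\neq 0$ for all sufficiently large $\|x\|$, so that the expression makes sense).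
   Context: $\langle\cdot,\cdot\rangle$ and $\|\cdot\|$ are the Euclidean inner product and norm; $I_d$ is the $d\times d$ identity matrix and $N_d(0,I_d)$ the standard normal law on $\mathbb{R}^d$. MpCN kernel. For $x\in\mathbb{R}^d$, let $Q(x,\cdot)$ be the law of $x^*=\rho^{1/2}x+(1-\rho)^{1/2}r^{-1/2}w$, where $r$ and $w$ are independent, $w\sim N_d(0,I_d)$, and $r$ has the Gamma law with density proportional to $t^{d/2-1}\exp(-\|x\|^2t/2)$ on $(0,\infty)$. Equivalently, $x^*=\rho^{1/2}x+(1-\rho)^{1/2}\|x\|\,w/\|\tilde w\|$ with $w,\tilde w\sim N_d(0,I_d)$ independent; this expression is also used at $x=0$, giving $x^*=0$. The kernel $Q$ is reversible with respect to $\|x\|^{-d}\mathrm{d}x$. The MpCN kernel with target $\Pi(\mathrm{d}x)=\pi(x)\mathrm{d}x$ is the Metropolis-Hastings kernel $$P(x,\mathrm{d}y)=Q(x,\mathrm{d}y)a(x,y)+\delta_x(\mathrm{d}y)\Big(1-\int Q(x,\mathrm{d}z)a(x,z)\Big),\qquad a(x,y)=\min\Big\{1,\frac{\pi(y)\|y\|^{d}}{\pi(x)\|x\|^{d}}\Big\}\quad(x\ne0),$$ and $P(0,\cdot)=\delta_0$. Geometric ergodicity. A $\Pi$-invariant transition kernel $P$ on $E$ is geometrically ergodic if there exist a measurable $V:E\to[1,\infty]$ with $V<\infty$ $\Pi$-a.s., constants $\gamma\in(0,1)$ and $c<\infty$, such that $\|P^n(x,\cdot)-\Pi\|_V\le c\gamma^nV(x)$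 for all $x\in E$ and $n\ge 1$, where $\|\nu\|_V=\sup_{|f|\le V}|\int f\,\mathrm{d}\nu|$. *)

theory Defs
  imports "HOL-Probability.Probability"
begin

definition std_normal_law :: "(real ^ 'n) measure" where
  "std_normal_law = density lborel (\<lambda>w. ennreal (\<Prod>i\<in>UNIV. std_normal_density (w $ i)))"

text \<open>Shape \<open>a\<close> and rate \<open>b\<close>: the normalised version of \<open>t powr (a - 1) * exp (- b * t)\<close>
  on the positive half-line.\<close>

definition gamma_law :: "real \<Rightarrow> real \<Rightarrow> real measure" where
  "gamma_law a b = density lborel
     (\<lambda>t. ennreal (if 0 < t then b powr a / Gamma a * t powr (a - 1) * exp (- b * t) else 0))"

lemma prob_space_std_normal_law: "prob_space (std_normal_law :: (real ^ 'n) measure)"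
proof
  interpret product_sigma_finite "\<lambda>_::real ^ 'n. lborel :: real measure" by standard
  let ?f = "\<lambda>w::real ^ 'n. ennreal (\<Prod>i\<in>UNIV. std_normal_density (w $ i))"
  have [measurable]: "(\<lambda>w::real ^ 'n. \<Prod>i\<in>UNIV. std_normal_density (w $ i)) \<in> borel_measurable borel"
    by measurable
  have one: "(\<integral>\<^sup>+ t. ennreal (std_normal_density t) \<partial>lborel) = 1"
    using prob_space.emeasure_space_1[OF prob_space_normal_density[of 1 0]]
    by (simp add: emeasure_density)
  let ?T = "\<lambda>f. \<Sum>b\<in>Basis. f b *\<^sub>R b :: real ^ 'n"
  have comp: "?T f $ i = f (axis i 1)" for f i
    using inner_sum_left_Basis[of "axis i 1 :: real ^ 'n" f] by (simp add: cart_eq_inner_axis)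
  have prod: "(\<Prod>i\<in>UNIV. std_normal_density (?T f $ i)) = (\<Prod>b\<in>Basis. std_normal_density (f b))" for f
  proof -
    have B: "(Basis :: (real ^ 'n) set) = range (\<lambda>i. axis i 1)" by (auto simp: Basis_vec_def)
    show ?thesis unfolding comp unfolding B
      by (subst prod.reindex) (auto simp: inj_on_def axis_eq_axis)
  qed
  have "emeasure (std_normal_law :: (real ^ 'n) measure) UNIV = integral\<^sup>N lborel ?f"
    by (simp add: std_normal_law_def emeasure_density)
  also have "\<dots> = (\<integral>\<^sup>+ f. ?f (?T f) \<partial>Pi\<^sub>M Basis (\<lambda>_. lborel))"
    by (subst lborel_eq) (simp add: nn_integral_distr)
  also have "\<dots> = (\<integral>\<^sup>+ f. (\<Prod>b\<in>(Basis :: (real ^ 'n) set). ennreal (std_normal_density (f b))) \<partial>Pi\<^sub>M Basis (\<lambda>_. lborel))"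
    unfolding prod by (simp add: prod_ennreal)
  also have "\<dots> = (\<Prod>b\<in>(Basis :: (real ^ 'n) set). \<integral>\<^sup>+ t. ennreal (std_normal_density t) \<partial>lborel)"
    by (rule product_nn_integral_prod) auto
  finally show "emeasure (std_normal_law :: (real ^ 'n) measure) (space std_normal_law) = 1"
    by (simp add: one std_normal_law_def)
qed

lemma prob_space_gamma_law:
  assumes "0 < a" "0 < b"
  shows "prob_space (gamma_law a b)"
proof
  let ?g = "\<lambda>t. indicator {0..} t * t powr (a - 1) / exp t"
  have "emeasure (gamma_law a b) (space (gamma_law a b)) =
      (\<integral>\<^sup>+ t. ennreal (if 0 < t then b powr a / Gamma a * t powr (a - 1) * exp (- b * t) else 0) \<partial>lborel)"
    by (simp add: gamma_law_def emeasure_density)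
  also have "\<dots> = (\<integral>\<^sup>+ t. ennreal (b / Gamma a) * ennreal (?g (0 + b * t)) \<partial>lborel)"
    using assms
    by (intro nn_integral_cong)
       (auto simp: ennreal_mult[symmetric] powr_mult exp_minus field_simps powr_diff
          zero_le_mult_iff indicator_def Gamma_real_pos)
  also have "\<dots> = ennreal (b / Gamma a) * (\<integral>\<^sup>+ t. ennreal (?g (0 + b * t)) \<partial>lborel)"
    by (rule nn_integral_cmult) measurable
  also have "ennreal (b / Gamma a) = ennreal (1 / Gamma a) * ennreal \<bar>b\<bar>"
    using assms by (simp add: ennreal_mult[symmetric] Gamma_real_pos less_imp_le)
  also have "\<dots> * (\<integral>\<^sup>+ t. ennreal (?g (0 + b * t)) \<partial>lborel) =
      ennreal (1 / Gamma a) * (ennreal \<bar>b\<bar> * (\<integral>\<^sup>+ t. ennreal (?g (0 + b * t)) \<partial>lborel))"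
    by (rule mult.assoc)
  also have "ennreal \<bar>b\<bar> * (\<integral>\<^sup>+ t. ennreal (?g (0 + b * t)) \<partial>lborel) = (\<integral>\<^sup>+ t. ennreal (?g t) \<partial>lborel)"
    using assms by (intro nn_integral_real_affine[symmetric]) auto
  also have "\<dots> = ennreal (Gamma a)"
    using assms by (simp add: Gamma_conv_nn_integral_real)
  also have "ennreal (1 / Gamma a) * ennreal (Gamma a) = 1"
    using Gamma_real_pos[OF assms(1)] by (simp add: ennreal_mult[symmetric] less_imp_le)
  finally show "emeasure (gamma_law a b) (space (gamma_law a b)) = 1" .
qed

definition mh_kernel :: "('a::topological_space \<Rightarrow> 'a measure) \<Rightarrow> ('a \<Rightarrow> 'a \<Rightarrow> real) \<Rightarrow> 'a \<Rightarrow> 'a measure" where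
  "mh_kernel Q a x = measure_of UNIV (sets borel)
     (\<lambda>A. (\<integral>\<^sup>+ y. ennreal (a x y) * indicator A y \<partial>Q x)
        + indicator A x * (1 - (\<integral>\<^sup>+ z. ennreal (a x z) \<partial>Q x)))"

lemma sets_mh_kernel [simp]: "sets (mh_kernel Q a x) = sets borel"
  unfolding mh_kernel_def using sets.sigma_sets_eq[of borel] by (simp add: sets_measure_of)

lemma emeasure_mh_kernel:
  assumes Q: "sets (Q x) = sets borel" and a: "a x \<in> borel_measurable borel" and A: "A \<in> sets borel"
  shows "emeasure (mh_kernel Q a x) A =
    (\<integral>\<^sup>+ y. ennreal (a x y) * indicator A y \<partial>Q x)
      + indicator A x * (1 - (\<integral>\<^sup>+ z. ennreal (a x z) \<partial>Q x))"
    (is "_ = ?m A")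
proof -
  have [measurable]: "a x \<in> borel_measurable (Q x)"
    using a by (simp add: measurable_cong_sets[OF Q refl])
  let ?c = "1 - (\<integral>\<^sup>+ z. ennreal (a x z) \<partial>Q x)"
  have m: "?m B = emeasure (density (Q x) (\<lambda>y. ennreal (a x y))) B
      + emeasure (scale_measure ?c (return borel x)) B" if "B \<in> sets borel" for B
    using that Q by (simp add: emeasure_density mult.commute)
  show ?thesis unfolding mh_kernel_def
  proof (rule emeasure_measure_of_sigma)
    show "sigma_algebra UNIV (sets (borel :: 'a measure))"
      using sets.sigma_algebra_axioms[of "borel :: 'a measure"] by simp
    show "positive (sets borel) ?m" by (simp add: positive_def)
    show "countably_additive (sets borel) ?m"
    proof (rule countably_additiveI)
      fix B :: "nat \<Rightarrow> 'a set"
      assume B: "range B \<subseteq> sets borel" "disjoint_family B" "(\<Union>i. B i) \<in> sets borel"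
      have Bi: "B i \<in> sets borel" for i using B(1) by auto
      have "(\<Sum>i. ?m (B i)) =
          (\<Sum>i. emeasure (density (Q x) (\<lambda>y. ennreal (a x y))) (B i))
          + (\<Sum>i. emeasure (scale_measure ?c (return borel x)) (B i))"
        by (simp only: m[OF Bi] suminf_add[OF summableI summableI])
      also have "\<dots> = ?m (\<Union>i. B i)"
        using B Q by (subst m[OF B(3)], subst (1 2) suminf_emeasure) auto
      finally show "(\<Sum>i. ?m (B i)) = ?m (\<Union>i. B i)" .
    qed
  qed (rule A)
qed

text \<open>For \<open>x = 0\<close> the Gamma law would have rate \<open>0\<close>; there the proposal stays at \<open>0\<close>.\<close>

definition mpcn_proposal :: "real \<Rightarrow> real ^ 'n \<Rightarrow> (real ^ 'n) measure" where
  "mpcn_proposal \<rho> x =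
     (if x = 0 then return borel 0
      else distr (gamma_law (CARD('n) / 2) ((norm x)\<^sup>2 / 2) \<Otimes>\<^sub>M std_normal_law) borel
             (\<lambda>(r, w). sqrt \<rho> *\<^sub>R x + (sqrt (1 - \<rho>) * r powr (- 1 / 2)) *\<^sub>R w))"

definition mpcn_acceptance :: "(real ^ 'n \<Rightarrow> real) \<Rightarrow> real ^ 'n \<Rightarrow> real ^ 'n \<Rightarrow> real" where
  "mpcn_acceptance \<pi> x y = min 1 ((\<pi> y * norm y ^ CARD('n)) / (\<pi> x * norm x ^ CARD('n)))"

definition mpcn_kernel :: "real \<Rightarrow> (real ^ 'n \<Rightarrow> real) \<Rightarrow> real ^ 'n \<Rightarrow> (real ^ 'n) measure" where
  "mpcn_kernel \<rho> \<pi> x =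
     (if x = 0 then return borel 0
      else mh_kernel (mpcn_proposal \<rho>) (mpcn_acceptance \<pi>) x)"

primrec kernel_power :: "'a measure \<Rightarrow> ('a \<Rightarrow> 'a measure) \<Rightarrow> nat \<Rightarrow> 'a \<Rightarrow> 'a measure" where
  "kernel_power M P 0 x = return M x"
| "kernel_power M P (Suc n) x = kernel_power M P n x \<bind> P"

text \<open>The \<open>V\<close>-norm of the signed measure \<open>M - N\<close>. The supremum runs over test functions for
  which both Bochner integrals exist. As all bounded measurable functions dominated by \<open>V\<close>
  are included, its value is the integral of \<open>V\<close> with respect to the total variation of
  \<open>M - N\<close>, for arbitrary finite \<open>M\<close> and \<open>N\<close> on the same space.\<close>

definition V_norm_diff :: "('a \<Rightarrow> ennreal) \<Rightarrow> 'a measure \<Rightarrow> 'a measure \<Rightarrow> ennreal" where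
  "V_norm_diff V M N =
     (SUP f \<in> {f :: 'a \<Rightarrow> real. integrable M f \<and> integrable N f \<and> (\<forall>x\<in>space M. ennreal \<bar>f x\<bar> \<le> V x)}.
        ennreal \<bar>(\<integral>x. f x \<partial>M) - (\<integral>x. f x \<partial>N)\<bar>)"

definition geometrically_ergodic :: "'a measure \<Rightarrow> ('a \<Rightarrow> 'a measure) \<Rightarrow> bool" where
  "geometrically_ergodic M P \<longleftrightarrow>
     P \<in> M \<rightarrow>\<^sub>M prob_algebra M \<and> M \<bind> P = M \<and>
     (\<exists>V \<in> borel_measurable M. \<exists>\<gamma> c :: real.
        (\<forall>x\<in>space M. 1 \<le> V x) \<and> (AE x in M. V x < \<infinity>) \<and> 0 < \<gamma> \<and> \<gamma> < 1 \<and> 0 \<le> c \<and>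
        (\<forall>x\<in>space M. \<forall>n\<ge>1.
           V_norm_diff V (kernel_power M P n x) M \<le> ennreal (c * \<gamma> ^ n) * V x))"

definition diag_unit :: "real ^ 'n" where
  "diag_unit = (\<chi> i. 1 / sqrt CARD('n))"

definition heavy_tailed :: "(real ^ 'n \<Rightarrow> real) \<Rightarrow> bool" where
  "heavy_tailed \<pi> \<longleftrightarrow>
     (\<forall>x. 0 < \<pi> x) \<and> continuous_on UNIV \<pi> \<and>
     (\<exists>\<alpha> > real CARD('n). \<forall>x. x \<noteq> 0 \<longrightarrow>
        (\<exists>U. open U \<and> x \<in> U \<and> 0 \<notin> U \<and>
           uniform_limit U (\<lambda>r y. \<pi> (r *\<^sub>R y) / \<pi> (r *\<^sub>R diag_unit)) (\<lambda>y. norm y powr (- \<alpha>)) at_top))"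

definition gradient :: "('a::real_inner \<Rightarrow> real) \<Rightarrow> 'a \<Rightarrow> 'a" where
  "gradient f x = (THE D. GDERIV f x :> D)"

text \<open>Since \<open>v /\<^sub>R norm v = 0\<close> for \<open>v = 0\<close>, points where the gradient vanishes contribute the
  value \<open>0\<close> in the curvature condition, so that the condition rules them out for large \<open>norm x\<close>.\<close>

definition light_tailed :: "(real ^ 'n \<Rightarrow> real) \<Rightarrow> bool" where
  "light_tailed \<pi> \<longleftrightarrow>
     (\<forall>x. 0 < \<pi> x) \<and> (\<forall>x. \<pi> differentiable (at x)) \<and>
     (\<forall>x s. x \<noteq> 0 \<longrightarrow> 1 < s \<longrightarrow>
        ((\<lambda>r. \<pi> (r *\<^sub>R s *\<^sub>R x) / \<pi> (r *\<^sub>R x)) \<longlongrightarrow> 0) at_top) \<and>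
     (\<forall>x s. x \<noteq> 0 \<longrightarrow> 0 < s \<longrightarrow> s < 1 \<longrightarrow>
        filterlim (\<lambda>r. \<pi> (r *\<^sub>R s *\<^sub>R x) / \<pi> (r *\<^sub>R x)) at_top at_top) \<and>
     Limsup at_infinity
       (\<lambda>x. ereal ((x /\<^sub>R norm x) \<bullet>
          (gradient (\<lambda>z. ln (\<pi> z)) x /\<^sub>R norm (gradient (\<lambda>z. ln (\<pi> z)) x)))) < 0"

end

theory Submission
  imports Defs
begin

text \<open>
  Write \<open>h x = \<pi> x * norm x ^ d\<close>. The proposal has density \<open>C * (norm x / S x y) ^ d\<close> with \<open>S\<close>
  symmetric, so the acceptance ratio is \<open>h y / h x\<close> and the rescaled proposal \<open>y / norm x\<close> has a law
  that depends only on the direction of \<open>x\<close>. For \<open>V = 1 / sqrt h\<close> the relative drift \<open>P V x / V x - 1\<close>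
  is the integral of the bounded function \<open>flux\<close> of the acceptance ratio, which makes dominated
  convergence available. As \<open>x \<rightarrow> 0\<close>, and in the heavy-tailed case also as \<open>x \<rightarrow> \<infinity>\<close>, the ratio tends
  to a power of \<open>norm z\<close>; the rescaled proposal is invariant under inversion in the unit sphere, and
  \<open>flux t + flux (1 / t) < 0\<close> for \<open>t \<noteq> 1\<close>, so the limiting drift is negative. In the light-tailed case the ratio
  concentrates at \<open>0\<close> and \<open>\<infinity>\<close>, and the curvature condition keeps the probability of the latter away
  from zero. Since \<open>h\<close> vanishes at \<open>0\<close> and at \<open>\<infinity>\<close>, the sublevel sets of \<open>V\<close> lie in annuli, on which
  the kernel is minorized, and Harris' theorem applies.
\<close>

section \<open>Harris' theorem in weighted norms\<close>

text \<open>The exponent 1/2 in \<open>V\<close> keeps the drift bounded: at ratio \<open>t\<close>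
  the accepted relative weight \<open>min 1 t / sqrt t\<close> stays in [0, 1] although
  \<open>V\<close> is unbounded, and for \<open>0 < t \<le> 1\<close> the sum
  \<open>flux t + flux (1 / t)\<close> is the negative square \<open>- (1 - sqrt t) ^ 2\<close>. The
  obstacle is the direction of \<open>x\<close>. The proposal law depends on \<open>sgn x\<close>,
  and in the light-tailed class the rate of decay may differ from one direction to another. A fixed
  \<open>envelope\<close>, comparable with the rescaled proposal densities of all directions,
  removes this dependence: limits are taken at each fixed \<open>z\<close>, along sequences whose
  directions may wander. The origin is absorbing, yet the geometric bound must hold from every
  state. It holds there because \<open>V\<close> is infinite, so Harris' theorem is proved for
  extended weights. Integrability of \<open>V\<close> under the target is not part of the drift
  condition and has to be derived from it and from invariance.\<close>

lemma integral_bind_integrable: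
  fixes f :: "'a \<Rightarrow> real"
  assumes P: "P \<in> N \<rightarrow>\<^sub>M subprob_algebra B" and N: "space N \<noteq> {}"
    and f: "integrable (N \<bind> P) f"
  shows "(\<integral>x. f x \<partial>(N \<bind> P)) = (\<integral>x. (\<integral>y. f y \<partial>P x) \<partial>N)"
    and "integrable N (\<lambda>x. \<integral>y. f y \<partial>P x)"
proof -
  have setsP: "sets (P x) = sets B" if "x \<in> space N" for x
    using measurable_space[OF P that] by (simp add: space_subprob_algebra)
  have setsB: "sets (N \<bind> P) = sets B"
    using setsP N by (rule sets_bind)
  have fB [measurable]: "f \<in> borel_measurable B"
    using borel_measurable_integrable[OF f] by (simp add: measurable_cong_sets[OF setsB refl])
  have fP: "f \<in> borel_measurable (P x)" if "x \<in> space N" for x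
    using fB by (simp add: measurable_cong_sets[OF setsP[OF that] refl])
  define p where "p = (\<lambda>x. \<integral>\<^sup>+y. ennreal (f y) \<partial>P x)"
  define n where "n = (\<lambda>x. \<integral>\<^sup>+y. ennreal (- f y) \<partial>P x)"
  have pm [measurable]: "p \<in> borel_measurable N"
    unfolding p_def by (rule measurable_compose[OF P nn_integral_measurable_subprob_algebra]) simp
  have nm [measurable]: "n \<in> borel_measurable N"
    unfolding n_def by (rule measurable_compose[OF P nn_integral_measurable_subprob_algebra]) simp
  have Ip: "(\<integral>\<^sup>+x. ennreal (f x) \<partial>(N \<bind> P)) = (\<integral>\<^sup>+x. p x \<partial>N)"
    unfolding p_def by (rule nn_integral_bind[OF _ P]) simp
  have In: "(\<integral>\<^sup>+x. ennreal (- f x) \<partial>(N \<bind> P)) = (\<integral>\<^sup>+x. n x \<partial>N)"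
    unfolding n_def by (rule nn_integral_bind[OF _ P]) simp
  have pfin: "(\<integral>\<^sup>+x. p x \<partial>N) \<noteq> \<infinity>" and nfin: "(\<integral>\<^sup>+x. n x \<partial>N) \<noteq> \<infinity>"
    using f by (auto simp: real_integrable_def Ip[symmetric] In[symmetric])
  \<comment> \<open>The inner integral of an unbounded \<open>f\<close> may fail to exist for some
    \<open>x\<close>. Finiteness of both parts under \<open>N \<bind> P\<close> confines such
    \<open>x\<close> to a null set, so the default values taken there do not matter.\<close>
  have AEp: "AE x in N. p x \<noteq> \<infinity>" and AEn: "AE x in N. n x \<noteq> \<infinity>"
    using nn_integral_PInf_AE[OF pm pfin] nn_integral_PInf_AE[OF nm nfin] by auto
  have eq: "AE x in N. (\<integral>y. f y \<partial>P x) = enn2real (p x) - enn2real (n x)"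
    using AEp AEn AE_space
  proof eventually_elim
    case (elim x)
    then have "integrable (P x) f"
      using fP by (auto simp: real_integrable_def p_def n_def)
    then show ?case by (simp add: real_lebesgue_integral_def p_def n_def)
  qed
  have enn: "integrable N (\<lambda>x. enn2real (g x)) \<and> (\<integral>x. enn2real (g x) \<partial>N) = enn2real (\<integral>\<^sup>+x. g x \<partial>N)"
    if [measurable]: "g \<in> borel_measurable N" and fin: "(\<integral>\<^sup>+x. g x \<partial>N) \<noteq> \<infinity>" for g
  proof -
    have "AE x in N. g x \<noteq> \<infinity>"
      using that by (intro nn_integral_PInf_AE) auto
    then have *: "(\<integral>\<^sup>+x. ennreal (enn2real (g x)) \<partial>N) = (\<integral>\<^sup>+x. g x \<partial>N)"
      by (intro nn_integral_cong_AE) (auto simp: less_top)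
    have "integrable N (\<lambda>x. enn2real (g x))"
      using fin by (intro integrableI_nonneg) (auto simp: * less_top)
    then show ?thesis
      using * by (simp add: integral_eq_nn_integral)
  qed
  note e = enn[OF pm pfin] enn[OF nm nfin]
  have int: "integrable N (\<lambda>x. enn2real (p x) - enn2real (n x))"
    using e by simp
  have m: "(\<lambda>x. \<integral>y. f y \<partial>P x) \<in> borel_measurable N"
    by (rule measurable_compose[OF P integral_measurable_subprob_algebra]) simp
  show "integrable N (\<lambda>x. \<integral>y. f y \<partial>P x)"
    using int eq m by (subst integrable_cong_AE[where g="\<lambda>x. enn2real (p x) - enn2real (n x)"]) auto
  have "(\<integral>x. (\<integral>y. f y \<partial>P x) \<partial>N) = (\<integral>x. enn2real (p x) - enn2real (n x) \<partial>N)"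
    using eq m by (intro integral_cong_AE) auto
  also have "\<dots> = (\<integral>x. f x \<partial>(N \<bind> P))"
    using f e by (simp add: real_lebesgue_integral_def Ip In)
  finally show "(\<integral>x. f x \<partial>(N \<bind> P)) = (\<integral>x. (\<integral>y. f y \<partial>P x) \<partial>N)" ..
qed

text \<open>Only an inequality, because \<open>ennreal\<close> cuts negative reals to 0. Harris'
  argument uses it at points where \<open>V\<close> may be infinite and one of the two summands
  negative.\<close>

lemma ennreal_add_subadditive: "ennreal (a + b) \<le> ennreal a + ennreal b"
proof -
  have "ennreal (a + b) \<le> ennreal (max 0 a + max 0 b)"
    by (intro ennreal_leI) auto
  also have "\<dots> = ennreal a + ennreal b"
    by (simp add: ennreal_plus ennreal_max_0 ennreal_max_0')
  finally show ?thesis .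
qed

text \<open>The small set is the sublevel set of \<open>V\<close> at \<open>R\<close>. The threshold
  \<open>2 * K / (1 - \<gamma>)\<close> makes \<open>\<gamma> + 2 * K / R < 1\<close>, so for two
  points of total weight at least \<open>R\<close> the two additive constants \<open>K\<close> are
  absorbed by the drift. Two points of smaller total weight both lie in the small set.\<close>

locale harris = prob_space M for M :: "'a measure" +
  fixes P :: "'a \<Rightarrow> 'a measure" and V :: "'a \<Rightarrow> ennreal" and \<gamma> K R \<alpha> :: real
    and \<nu> :: "'a measure"
  assumes kernel: "P \<in> M \<rightarrow>\<^sub>M prob_algebra M"
    and invariant: "M \<bind> P = M"
    and V_measurable [measurable]: "V \<in> borel_measurable M"
    and V_ge_1: "x \<in> space M \<Longrightarrow> 1 \<le> V x"
    and V_finite: "AE x in M. V x < \<infinity>"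
    and \<gamma>: "0 < \<gamma>" "\<gamma> < 1" and K: "0 < K" and R: "2 * K / (1 - \<gamma>) < R" and \<alpha>: "0 < \<alpha>"
    and drift: "x \<in> space M \<Longrightarrow> V x < \<infinity> \<Longrightarrow> (\<integral>\<^sup>+y. V y \<partial>P x) \<le> ennreal \<gamma> * V x + ennreal K"
    and \<nu>: "prob_space \<nu>" "sets \<nu> = sets M"
    and minorization: "x \<in> space M \<Longrightarrow> V x \<le> ennreal R \<Longrightarrow> u \<in> borel_measurable M \<Longrightarrow>
      ennreal \<alpha> * (\<integral>\<^sup>+y. u y \<partial>\<nu>) \<le> (\<integral>\<^sup>+y. u y \<partial>P x)"
begin

text \<open>Since \<open>enn2real\<close> sends infinity to 0, \<open>v\<close> represents
  \<open>V\<close> only on \<open>S\<close>, and bounds in terms of \<open>v\<close> are imposed on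
  test functions only there.\<close>

definition "v x = enn2real (V x)"
definition "S = {x \<in> space M. V x < \<infinity>}"

lemma v_measurable [measurable]: "v \<in> borel_measurable M"
  unfolding v_def by simp

lemma V_eq: "x \<in> S \<Longrightarrow> V x = ennreal (v x)"
  by (auto simp: v_def S_def less_top)

lemma v_ge_1: "x \<in> S \<Longrightarrow> 1 \<le> v x"
  using V_ge_1[of x] V_eq[of x] by (auto simp: S_def)

lemma v_nonneg: "0 \<le> v x"
  by (simp add: v_def)

lemma kernel_subprob: "P \<in> M \<rightarrow>\<^sub>M subprob_algebra M"
  using kernel by (rule measurable_prob_algebraD)

lemma prob_space_P: "x \<in> space M \<Longrightarrow> prob_space (P x)"
  and sets_P: "x \<in> space M \<Longrightarrow> sets (P x) = sets M"
  using measurable_space[OF kernel] by (auto simp: space_prob_algebra)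

text \<open>A law with finite \<open>V\<close>-moment is carried by \<open>S\<close>, so a bound on
  \<open>S\<close> is enough. Calls with \<open>f\<close> and all constants equal to 0 serve only to
  obtain the facts about \<open>S\<close> and \<open>v\<close>.\<close>

lemma integrable_weight:
  fixes f :: "'a \<Rightarrow> real"
  assumes N: "prob_space N" "sets N = sets M" and fin: "(\<integral>\<^sup>+y. V y \<partial>N) < \<infinity>"
    and f: "f \<in> borel_measurable M" "\<forall>x\<in>S. \<bar>f x - c\<bar> \<le> L * (1 + \<beta> * v x)"
  shows "AE x in N. x \<in> S" "integrable N v" "integrable N f"
    "(\<integral>\<^sup>+y. V y \<partial>N) = ennreal (\<integral>x. v x \<partial>N)"
proof -
  interpret N: prob_space N by fact
  have [measurable_cong]: "sets N = sets M" by fact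
  have sp: "space N = space M" using N(2) by (rule sets_eq_imp_space_eq)
  note [measurable] = f(1)
  have "AE x in N. V x \<noteq> \<infinity>"
    using fin by (intro nn_integral_PInf_AE) auto
  then show S: "AE x in N. x \<in> S"
    by (auto simp: S_def sp less_top)
  have eq: "(\<integral>\<^sup>+y. V y \<partial>N) = (\<integral>\<^sup>+y. ennreal (v y) \<partial>N)"
    using S by (intro nn_integral_cong_AE) (auto simp: V_eq)
  show iv: "integrable N v"
    using fin by (intro integrableI_nonneg) (auto simp: eq v_nonneg)
  show "(\<integral>\<^sup>+y. V y \<partial>N) = ennreal (\<integral>x. v x \<partial>N)"
    unfolding eq by (rule nn_integral_eq_integral[OF iv]) (simp add: v_nonneg)
  have "AE x in N. norm (f x) \<le> norm (\<bar>c\<bar> + L * (1 + \<beta> * v x))"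
    using S by eventually_elim (use f(2) in force)
  then show "integrable N f"
    by (rule Bochner_Integration.integrable_bound[rotated 2]) (use iv in auto)
qed

lemma P_drift:
  assumes x: "x \<in> S"
  shows "(\<integral>\<^sup>+y. V y \<partial>P x) < \<infinity>" "(\<integral>y. v y \<partial>P x) \<le> \<gamma> * v x + K"
proof -
  have xM: "x \<in> space M" "V x < \<infinity>" using x by (auto simp: S_def)
  have le: "(\<integral>\<^sup>+y. V y \<partial>P x) \<le> ennreal (\<gamma> * v x + K)"
    using drift[OF xM] x \<gamma> K v_nonneg[of x] by (simp add: V_eq ennreal_mult)
  then show fin: "(\<integral>\<^sup>+y. V y \<partial>P x) < \<infinity>"
    by (rule le_less_trans) simp
  show "(\<integral>y. v y \<partial>P x) \<le> \<gamma> * v x + K"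
    using le \<gamma> K v_nonneg[of x]
    by (subst (asm) integrable_weight(4)[OF prob_space_P[OF xM(1)] sets_P[OF xM(1)] fin, of "\<lambda>_. 0" 0 0 0])
       (auto simp: ennreal_plus[symmetric] simp del: ennreal_plus)
qed

text \<open>Integrating the drift condition directly could give infinity on both sides. The
  truncation \<open>min V n\<close> has a finite integral, preserved by \<open>P\<close>. Points
  with \<open>V \<le> n\<close> contribute through the drift, the others through the trivial bound
  \<open>n\<close>. The result is \<open>I \<le> \<gamma> * I + K\<close> for the part
  \<open>I\<close> below \<open>n\<close>, a bound that does not depend on \<open>n\<close>.\<close>

lemma V_integrable: "(\<integral>\<^sup>+y. V y \<partial>M) < \<infinity>"
proof -
  have cancel: "a \<le> b" if "a + c \<le> b + c" "c \<noteq> \<infinity>" for a b c :: ennreal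
    using that by (simp only: add.commute[of _ c] ennreal_add_left_cancel_le) simp
  have bound: "(\<integral>\<^sup>+y. V y * indicator {y \<in> space M. V y \<le> of_nat n} y \<partial>M) \<le> ennreal (K / (1 - \<gamma>))" for n :: nat
  proof -
    let ?N = "of_nat n :: ennreal"
    let ?A = "{y \<in> space M. V y \<le> ?N}" and ?B = "{y \<in> space M. ?N < V y}"
    let ?I = "\<integral>\<^sup>+y. V y * indicator ?A y \<partial>M"
    have split: "(\<integral>\<^sup>+y. min (V y) ?N \<partial>M) = ?I + ?N * emeasure M ?B"
    proof -
      have "(\<integral>\<^sup>+y. min (V y) ?N \<partial>M) = (\<integral>\<^sup>+y. V y * indicator ?A y + ?N * indicator ?B y \<partial>M)"
        by (intro nn_integral_cong) (auto simp: min_def)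
      then show ?thesis
        by (simp add: nn_integral_add nn_integral_cmult_indicator)
    qed
    have "?I + ?N * emeasure M ?B = (\<integral>\<^sup>+y. min (V y) ?N \<partial>(M \<bind> P))"
      by (simp add: split invariant)
    also have "\<dots> = (\<integral>\<^sup>+x. (\<integral>\<^sup>+y. min (V y) ?N \<partial>P x) \<partial>M)"
      by (rule nn_integral_bind[OF _ kernel_subprob]) simp
    also have "\<dots> \<le> (\<integral>\<^sup>+x. (ennreal \<gamma> * (V x * indicator ?A x) + ennreal K) + ?N * indicator ?B x \<partial>M)"
    proof (rule nn_integral_mono)
      fix x assume x: "x \<in> space M"
      interpret Px: prob_space "P x" by (rule prob_space_P[OF x])
      show "(\<integral>\<^sup>+y. min (V y) ?N \<partial>P x) \<le> (ennreal \<gamma> * (V x * indicator ?A x) + ennreal K) + ?N * indicator ?B x"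
      proof (cases "V x \<le> ?N")
        case True
        then have "V x < \<infinity>" using le_less_trans[OF True of_nat_less_top] by simp
        have "(\<integral>\<^sup>+y. min (V y) ?N \<partial>P x) \<le> (\<integral>\<^sup>+y. V y \<partial>P x)" by (rule nn_integral_mono) simp
        also have "\<dots> \<le> ennreal \<gamma> * V x + ennreal K" by (rule drift) fact+
        finally show ?thesis using True x by simp
      next
        case False
        have "(\<integral>\<^sup>+y. min (V y) ?N \<partial>P x) \<le> (\<integral>\<^sup>+y. ?N \<partial>P x)" by (rule nn_integral_mono) simp
        also have "\<dots> = ?N" by (simp add: Px.emeasure_space_1)
        finally show ?thesis using False x by (auto intro: add_increasing)
      qed
    qed
    also have "\<dots> = ennreal \<gamma> * ?I + ennreal K + ?N * emeasure M ?B"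
      by (simp add: nn_integral_add nn_integral_cmult emeasure_space_1 nn_integral_cmult_indicator)
    finally have "?I + ?N * emeasure M ?B \<le> ennreal \<gamma> * ?I + ennreal K + ?N * emeasure M ?B" .
    moreover have "?N * emeasure M ?B \<noteq> \<infinity>"
      by (simp add: ennreal_mult_eq_top_iff)
    txt \<open>The mass on \<open>?B\<close>, where invariance gives no information, cancels.\<close>
    ultimately have le: "?I \<le> ennreal \<gamma> * ?I + ennreal K"
      by (rule cancel)
    have "?I \<le> (\<integral>\<^sup>+y. ?N \<partial>M)"
      by (intro nn_integral_mono) (auto simp: indicator_def)
    also have "\<dots> < \<infinity>" by (simp add: emeasure_space_1 of_nat_less_top)
    finally obtain r where r: "?I = ennreal r" "0 \<le> r"
      by (cases ?I) auto
    have "r \<le> \<gamma> * r + K"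
    proof -
      have "ennreal r \<le> ennreal (\<gamma> * r + K)"
        using le r \<gamma> K by (simp add: ennreal_mult)
      then show ?thesis using r \<gamma> K by (subst (asm) ennreal_le_iff) auto
    qed
    then have "r \<le> K / (1 - \<gamma>)"
      using \<gamma> by (simp add: field_simps)
    then show ?thesis
      unfolding r by (rule ennreal_leI)
  qed
  let ?I = "\<lambda>n y. V y * indicator {y \<in> space M. V y \<le> of_nat n} y"
  \<comment> \<open>Finiteness of \<open>V\<close> almost everywhere enters here: where
    \<open>V\<close> is infinite, every truncated function \<open>?I n\<close> vanishes.\<close>
  have "(\<integral>\<^sup>+y. V y \<partial>M) = (\<integral>\<^sup>+y. (SUP n. ?I n y) \<partial>M)"
  proof (rule nn_integral_cong_AE)
    show "AE y in M. V y = (SUP n. ?I n y)"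
      using V_finite AE_space
    proof eventually_elim
      case (elim y)
      obtain n :: nat where n: "V y \<le> of_nat n"
        using elim ennreal_Ex_less_of_nat[of "V y"] by (auto intro: less_imp_le)
      show ?case
      proof (rule antisym)
        show "V y \<le> (SUP n. ?I n y)"
          using n elim by (intro SUP_upper2[of n]) auto
        show "(SUP n. ?I n y) \<le> V y"
          by (rule SUP_least) (auto simp: indicator_def)
      qed
    qed
  qed
  also have "\<dots> = (SUP n. \<integral>\<^sup>+y. ?I n y \<partial>M)"
  proof (rule nn_integral_monotone_convergence_SUP)
    show "incseq ?I"
    proof (rule incseq_SucI, rule le_funI)
      fix n y
      have "(of_nat n :: ennreal) \<le> of_nat (Suc n)" by (rule of_nat_mono) simp
      then show "?I n y \<le> ?I (Suc n) y"
        by (auto simp: indicator_def intro: order_trans)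
    qed
  qed simp
  also have "\<dots> \<le> ennreal (K / (1 - \<gamma>))"
    by (rule SUP_least) (rule bound)
  finally show ?thesis by (rule le_less_trans) simp
qed

text \<open>The constants of the weighted distance \<open>2 + \<beta> * v x + \<beta> * v y\<close>.
  The choice of \<open>\<beta>\<close> gives \<open>\<beta> * (2 * K) = \<alpha>\<close>, so the
  additive drift constants cost half of the gain \<open>2 * \<alpha>\<close> from the minorization.
  \<open>\<gamma>'\<close> is the drift rate for pairs of total weight at least \<open>R\<close>,
  and \<open>\<kappa>\<close> is the worst of the rates in the two regimes.\<close>

definition "\<beta> = \<alpha> / (2 * K)"
definition "\<gamma>' = \<gamma> + 2 * K / R"
definition "\<kappa> = max (max \<gamma> (1 - \<alpha> / 2)) ((2 + \<beta> * R * \<gamma>') / (2 + \<beta> * R))"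

lemma R_pos: "0 < R" and \<beta>_pos: "0 < \<beta>" and \<gamma>'_less_1: "\<gamma>' < 1"
proof -
  have "0 < 2 * K / (1 - \<gamma>)" using K \<gamma> by simp
  then show R0: "0 < R" using R by simp
  show "0 < \<beta>" using \<alpha> K by (simp add: \<beta>_def)
  show "\<gamma>' < 1" using R R0 \<gamma> by (simp add: \<gamma>'_def field_simps)
qed

lemma \<kappa>_bounds: "0 < \<kappa>" "\<kappa> < 1"
proof -
  show "0 < \<kappa>" using \<gamma> by (simp add: \<kappa>_def less_max_iff_disj)
  have "\<beta> * R * \<gamma>' < \<beta> * R * 1"
    using R_pos \<beta>_pos \<gamma>'_less_1 by (intro mult_strict_left_mono) auto
  then show "\<kappa> < 1"
    using \<gamma> \<alpha> R_pos \<beta>_pos by (simp add: \<kappa>_def field_simps add_pos_pos)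
qed

lemma contraction_arith:
  assumes T: "0 \<le> T"
  shows "T \<le> R \<Longrightarrow> 2 + \<beta> * (\<gamma> * T + 2 * K) - 2 * \<alpha> \<le> \<kappa> * (2 + \<beta> * T)"
    and "R \<le> T \<Longrightarrow> 2 + \<beta> * (\<gamma> * T + 2 * K) \<le> \<kappa> * (2 + \<beta> * T)"
proof -
  have bT: "0 \<le> \<beta> * T" using T \<beta>_pos by simp
  have \<beta>K: "\<beta> * (2 * K) = \<alpha>" using K by (simp add: \<beta>_def)
  have "(1 - \<alpha> / 2) * 2 + \<gamma> * (\<beta> * T) \<le> \<kappa> * 2 + \<kappa> * (\<beta> * T)"
    using bT by (intro add_mono mult_right_mono) (auto simp: \<kappa>_def)
  then show "2 + \<beta> * (\<gamma> * T + 2 * K) - 2 * \<alpha> \<le> \<kappa> * (2 + \<beta> * T)"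
    using \<beta>K by (simp add: algebra_simps)
  assume RT: "R \<le> T"
  have "2 * K \<le> 2 * K / R * T"
    using RT R_pos K by (simp add: field_simps)
  then have "\<beta> * (\<gamma> * T + 2 * K) \<le> \<beta> * (\<gamma>' * T)"
    using \<beta>_pos by (intro mult_left_mono) (auto simp: \<gamma>'_def algebra_simps)
  \<comment> \<open>The quotient of \<open>2 + \<beta> * \<gamma>' * T\<close> by
    \<open>2 + \<beta> * T\<close> decreases in \<open>T\<close>, because
    \<open>\<gamma>' < 1\<close>. Its value at \<open>T = R\<close> is therefore the worst case and
    appears in \<open>\<kappa>\<close>.\<close>
  moreover have "2 + \<beta> * (\<gamma>' * T) \<le> (2 + \<beta> * R * \<gamma>') / (2 + \<beta> * R) * (2 + \<beta> * T)"
  proof -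
    have "(2 + \<beta> * R * \<gamma>') * (2 + \<beta> * T) - (2 + \<beta> * (\<gamma>' * T)) * (2 + \<beta> * R)
      = 2 * \<beta> * (1 - \<gamma>') * (T - R)" by (simp add: algebra_simps)
    also have "\<dots> \<ge> 0" using \<beta>_pos \<gamma>'_less_1 RT by simp
    finally show ?thesis using \<beta>_pos R_pos
      by (simp add: pos_le_divide_eq add_pos_pos)
  qed
  moreover have "\<dots> \<le> \<kappa> * (2 + \<beta> * T)"
    using bT by (intro mult_right_mono) (auto simp: \<kappa>_def)
  ultimately show "2 + \<beta> * (\<gamma> * T + 2 * K) \<le> \<kappa> * (2 + \<beta> * T)"
    by linarith
qed

text \<open>If \<open>v x + v y\<close> is large, the drift condition alone contracts. Otherwise the minorization is
  applied to the nonnegative functions \<open>W - (f - c)\<close> under \<open>P x\<close> and \<open>W + (f - c)\<close> under \<open>P y\<close>,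
  whose sum \<open>2 * W\<close> is at least \<open>2 * L\<close>.\<close>

lemma contraction:
  fixes f :: "'a \<Rightarrow> real"
  assumes f [measurable]: "f \<in> borel_measurable M" and fb: "\<And>x. x \<in> S \<Longrightarrow> \<bar>f x - c\<bar> \<le> L * (1 + \<beta> * v x)"
    and L: "0 \<le> L" and xy: "x \<in> S" "y \<in> S"
  shows "(\<integral>z. f z \<partial>P x) - (\<integral>z. f z \<partial>P y) \<le> \<kappa> * L * (2 + \<beta> * v x + \<beta> * v y)"
proof -
  define W where "W z = L * (1 + \<beta> * v z)" for z
  have [measurable]: "W \<in> borel_measurable M" unfolding W_def by simp
  have WL: "L \<le> W z" for z
    using L v_nonneg[of z] \<beta>_pos by (simp add: W_def mult_left_le_one_le algebra_simps)
  have M: "x \<in> space M" "y \<in> space M" using xy by (auto simp: S_def)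
  interpret Px: prob_space "P x" by (rule prob_space_P[OF M(1)])
  interpret Py: prob_space "P y" by (rule prob_space_P[OF M(2)])
  have fb': "\<forall>x\<in>S. \<bar>f x - c\<bar> \<le> L * (1 + \<beta> * v x)" using fb by blast
  note Ix = integrable_weight[OF prob_space_P[OF M(1)] sets_P[OF M(1)] P_drift(1)[OF xy(1)] f fb']
  note Iy = integrable_weight[OF prob_space_P[OF M(2)] sets_P[OF M(2)] P_drift(1)[OF xy(2)] f fb']
  have IWx: "integrable (P x) W" "(\<integral>z. W z \<partial>P x) \<le> L * (1 + \<beta> * (\<gamma> * v x + K))"
    using Ix(2) P_drift(2)[OF xy(1)] L \<beta>_pos
    by (auto simp: W_def[abs_def] Px.prob_space intro!: mult_left_mono)
  have IWy: "integrable (P y) W" "(\<integral>z. W z \<partial>P y) \<le> L * (1 + \<beta> * (\<gamma> * v y + K))"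
    using Iy(2) P_drift(2)[OF xy(2)] L \<beta>_pos
    by (auto simp: W_def[abs_def] Py.prob_space intro!: mult_left_mono)
  have ifx: "(\<integral>z. W z - (f z - c) \<partial>P x) = (\<integral>z. W z \<partial>P x) - (\<integral>z. f z \<partial>P x) + c"
    using Ix(3) IWx(1) by (simp add: Px.prob_space)
  have ify: "(\<integral>z. W z + (f z - c) \<partial>P y) = (\<integral>z. W z \<partial>P y) + (\<integral>z. f z \<partial>P y) - c"
    using Iy(3) IWy(1) by (simp add: Py.prob_space)
  have nnx: "AE z in P x. 0 \<le> W z - (f z - c)"
    using Ix(1) by eventually_elim (use fb in \<open>force simp: W_def\<close>)
  have nny: "AE z in P y. 0 \<le> W z + (f z - c)"
    using Iy(1) by eventually_elim (use fb in \<open>force simp: W_def\<close>)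
  have eq: "L * (1 + \<beta> * (\<gamma> * v x + K)) + L * (1 + \<beta> * (\<gamma> * v y + K))
     = L * (2 + \<beta> * (\<gamma> * (v x + v y) + 2 * K))" by (simp add: algebra_simps)
  have T: "0 \<le> v x + v y" using v_nonneg[of x] v_nonneg[of y] by simp
  have dist: "2 + \<beta> * (v x + v y) = 2 + \<beta> * v x + \<beta> * v y" by (simp add: algebra_simps)
  show ?thesis
  proof (cases "R \<le> v x + v y")
    case True
    have "0 \<le> (\<integral>z. W z - (f z - c) \<partial>P x)" "0 \<le> (\<integral>z. W z + (f z - c) \<partial>P y)"
      using nnx nny by (auto intro: integral_nonneg_AE)
    then have "(\<integral>z. f z \<partial>P x) - (\<integral>z. f z \<partial>P y) \<le> L * (2 + \<beta> * (\<gamma> * (v x + v y) + 2 * K))"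
      using ifx ify IWx(2) IWy(2) eq by linarith
    also have "\<dots> \<le> L * (\<kappa> * (2 + \<beta> * (v x + v y)))"
      using contraction_arith(2)[OF T True] L by (rule mult_left_mono)
    finally show ?thesis unfolding dist by (simp add: ac_simps)
  next
    case False
    then have C: "V x \<le> ennreal R" "V y \<le> ennreal R"
      using xy v_nonneg[of x] v_nonneg[of y] R_pos by (auto simp: V_eq intro!: ennreal_leI)
    have [measurable_cong]: "sets \<nu> = sets M" by (rule \<nu>(2))
    interpret \<nu>: prob_space \<nu> by (rule \<nu>(1))
    let ?u = "\<lambda>z. ennreal (W z - (f z - c))" and ?w = "\<lambda>z. ennreal (W z + (f z - c))"
    have px: "(\<integral>\<^sup>+z. ?u z \<partial>P x) = ennreal (\<integral>z. W z - (f z - c) \<partial>P x)"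
      using nnx Ix(3) IWx(1) by (intro nn_integral_eq_integral) auto
    have py: "(\<integral>\<^sup>+z. ?w z \<partial>P y) = ennreal (\<integral>z. W z + (f z - c) \<partial>P y)"
      using nny Iy(3) IWy(1) by (intro nn_integral_eq_integral) auto
    have "ennreal (2 * L) = (\<integral>\<^sup>+z. ennreal (2 * L) \<partial>\<nu>)"
      by (simp add: \<nu>.emeasure_space_1)
    also have "\<dots> \<le> (\<integral>\<^sup>+z. ?u z + ?w z \<partial>\<nu>)"
    proof (rule nn_integral_mono)
      fix z
      have "ennreal (2 * L) \<le> ennreal ((W z - (f z - c)) + (W z + (f z - c)))"
        using WL[of z] by (intro ennreal_leI) simp
      also have "\<dots> \<le> ?u z + ?w z" by (rule ennreal_add_subadditive)
      finally show "ennreal (2 * L) \<le> ?u z + ?w z" .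
    qed
    also have "\<dots> = (\<integral>\<^sup>+z. ?u z \<partial>\<nu>) + (\<integral>\<^sup>+z. ?w z \<partial>\<nu>)"
      by (rule nn_integral_add) auto
    finally have "ennreal \<alpha> * ennreal (2 * L) \<le> ennreal \<alpha> * ((\<integral>\<^sup>+z. ?u z \<partial>\<nu>) + (\<integral>\<^sup>+z. ?w z \<partial>\<nu>))"
      by (rule mult_left_mono) simp
    also have "\<dots> \<le> (\<integral>\<^sup>+z. ?u z \<partial>P x) + (\<integral>\<^sup>+z. ?w z \<partial>P y)"
      unfolding distrib_left using C M by (intro add_mono minorization) auto
    also have "\<dots> = ennreal ((\<integral>z. W z - (f z - c) \<partial>P x) + (\<integral>z. W z + (f z - c) \<partial>P y))"
      unfolding px py using nnx nny by (intro ennreal_plus[symmetric] integral_nonneg_AE) auto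
    finally have "\<alpha> * (2 * L) \<le> (\<integral>z. W z - (f z - c) \<partial>P x) + (\<integral>z. W z + (f z - c) \<partial>P y)"
      using \<alpha> L integral_nonneg_AE[OF nnx] integral_nonneg_AE[OF nny]
      by (simp only: ennreal_mult[symmetric] ennreal_le_iff add_nonneg_nonneg less_imp_le mult_nonneg_nonneg zero_le_numeral)
    then have "(\<integral>z. f z \<partial>P x) - (\<integral>z. f z \<partial>P y) \<le> L * (2 + \<beta> * (\<gamma> * (v x + v y) + 2 * K) - 2 * \<alpha>)"
      using ifx ify IWx(2) IWy(2) eq by (simp add: algebra_simps)
    also have "\<dots> \<le> L * (\<kappa> * (2 + \<beta> * (v x + v y)))"
      using contraction_arith(1)[OF T] False L by (intro mult_left_mono) auto
    finally show ?thesis unfolding dist by (simp add: ac_simps)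
  qed
qed

text \<open>The intervals with centre \<open>g x\<close> and radius
  \<open>L * (1 + \<beta> * v x)\<close> meet pairwise, hence have a common point, the supremum of
  their left endpoints. This converts the conclusion of \<open>contraction\<close> back into the
  form of its hypothesis, so that it can be iterated.\<close>

lemma centering:
  fixes g :: "'a \<Rightarrow> real"
  assumes g: "\<And>x y. x \<in> S \<Longrightarrow> y \<in> S \<Longrightarrow> g x - g y \<le> L * (2 + \<beta> * v x + \<beta> * v y)"
  obtains c where "\<And>x. x \<in> S \<Longrightarrow> \<bar>g x - c\<bar> \<le> L * (1 + \<beta> * v x)"
proof (cases "S = {}")
  case True
  then show ?thesis using that by auto
next
  case False
  then obtain y0 where y0: "y0 \<in> S" by auto
  let ?A = "(\<lambda>x. g x - L * (1 + \<beta> * v x)) ` S"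
  have le: "g x - L * (1 + \<beta> * v x) \<le> g y + L * (1 + \<beta> * v y)" if "x \<in> S" "y \<in> S" for x y
    using g[OF that] by (simp add: algebra_simps)
  have bdd: "bdd_above ?A"
    using le[OF _ y0] by (intro bdd_aboveI2)
  show ?thesis
  proof (rule that)
    fix x assume x: "x \<in> S"
    have "g x - L * (1 + \<beta> * v x) \<le> Sup ?A"
      using x bdd by (intro cSUP_upper)
    moreover have "Sup ?A \<le> g x + L * (1 + \<beta> * v x)"
      using False x le by (intro cSUP_least) auto
    ultimately show "\<bar>g x - Sup ?A\<bar> \<le> L * (1 + \<beta> * v x)" by linarith
  qed
qed

section \<open>Iterates of the kernel and convergence to the invariant law\<close>

lemma kernel_power_props:
  assumes x: "x \<in> S"
  shows "prob_space (kernel_power M P n x) \<and> sets (kernel_power M P n x) = sets M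
    \<and> (\<integral>\<^sup>+y. V y \<partial>kernel_power M P n x) < \<infinity>"
proof (induction n)
  case 0
  then show ?case using x by (auto simp: prob_space_return nn_integral_return S_def)
next
  case (Suc n)
  let ?N = "kernel_power M P n x"
  have N: "prob_space ?N" "sets ?N = sets M" "(\<integral>\<^sup>+y. V y \<partial>?N) < \<infinity>" using Suc by auto
  interpret N: prob_space ?N by fact
  have [measurable_cong]: "sets ?N = sets M" by fact
  have sp: "space ?N = space M" using N(2) by (rule sets_eq_imp_space_eq)
  have PN: "P \<in> ?N \<rightarrow>\<^sub>M prob_algebra M" using kernel by (simp add: measurable_cong_sets[OF N(2) refl])
  have PN': "P \<in> ?N \<rightarrow>\<^sub>M subprob_algebra M" using PN by (rule measurable_prob_algebraD)
  have "(\<integral>\<^sup>+y. V y \<partial>(?N \<bind> P)) = (\<integral>\<^sup>+z. (\<integral>\<^sup>+y. V y \<partial>P z) \<partial>?N)"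
    by (rule nn_integral_bind[OF _ PN']) simp
  also have "\<dots> \<le> (\<integral>\<^sup>+z. ennreal \<gamma> * V z + ennreal K \<partial>?N)"
  proof (rule nn_integral_mono_AE)
    show "AE z in ?N. (\<integral>\<^sup>+y. V y \<partial>P z) \<le> ennreal \<gamma> * V z + ennreal K"
    proof -
      have "AE z in ?N. z \<in> S"
        by (rule integrable_weight(1)[OF N, of "\<lambda>_. 0" 0 0 0]) auto
      then show ?thesis
        by (rule AE_mp) (auto simp: S_def intro!: AE_I2 drift)
    qed
  qed
  also have "\<dots> = ennreal \<gamma> * (\<integral>\<^sup>+z. V z \<partial>?N) + ennreal K"
    by (simp add: nn_integral_add nn_integral_cmult N.emeasure_space_1)
  also have "\<dots> < \<infinity>" using N(3) by (simp add: ennreal_mult_less_top)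
  finally show ?case
    using N.prob_space_axioms PN PN' sp x sets_P
    by (auto intro!: prob_space_bind'[OF _ PN] sets_bind simp: space_prob_algebra N.not_empty)
qed

text \<open>The induction generalises \<open>f\<close>, because the last step of the chain is moved
  onto the test function: \<open>f\<close> becomes its image under \<open>P\<close>, with a new
  centre and with \<open>\<kappa> * L\<close> in place of \<open>L\<close>. Invariance leaves the
  integral under \<open>M\<close> unchanged.\<close>

lemma convergence:
  fixes f :: "'a \<Rightarrow> real"
  assumes "f \<in> borel_measurable M" "\<And>x. x \<in> S \<Longrightarrow> \<bar>f x - c\<bar> \<le> L * (1 + \<beta> * v x)" "0 \<le> L" and x: "x \<in> S"
  shows "\<bar>(\<integral>y. f y \<partial>kernel_power M P n x) - (\<integral>y. f y \<partial>M)\<bar> \<le> \<kappa> ^ n * L * (2 + \<beta> * v x + \<beta> * (\<integral>y. v y \<partial>M))"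
  using assms(1-3)
proof (induction n arbitrary: f c L)
  case (0 f c L)
  note [measurable] = 0(1)
  have "\<forall>x\<in>S. \<bar>f x - c\<bar> \<le> L * (1 + \<beta> * v x)" using 0(2) by blast
  note I = integrable_weight[OF prob_space_axioms refl V_integrable 0(1) this]
  have "\<bar>f x - (\<integral>y. f y \<partial>M)\<bar> = \<bar>\<integral>y. f x - f y \<partial>M\<bar>"
    using I by (simp add: prob_space)
  also have "\<dots> \<le> (\<integral>y. \<bar>f x - f y\<bar> \<partial>M)" by (rule integral_abs_bound)
  also have "\<dots> \<le> (\<integral>y. L * (2 + \<beta> * v x + \<beta> * v y) \<partial>M)"
  proof (rule integral_mono_AE)
    show "AE y in M. \<bar>f x - f y\<bar> \<le> L * (2 + \<beta> * v x + \<beta> * v y)"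
      using I(1)
    proof eventually_elim
      case (elim y)
      show ?case using 0(2)[OF elim] 0(2)[OF x] by (simp add: algebra_simps abs_le_iff)
    qed
  qed (use I in auto)
  also have "\<dots> = L * (2 + \<beta> * v x + \<beta> * (\<integral>y. v y \<partial>M))"
    using I by (simp add: prob_space)
  finally show ?case using x 0(1) by (simp add: integral_return S_def)
next
  case (Suc n f c L)
  let ?N = "kernel_power M P n x" and ?g = "\<lambda>x. \<integral>y. f y \<partial>P x"
  have N: "prob_space ?N" "sets ?N = sets M" "(\<integral>\<^sup>+y. V y \<partial>?N) < \<infinity>"
    and N': "prob_space (?N \<bind> P)" "sets (?N \<bind> P) = sets M" "(\<integral>\<^sup>+y. V y \<partial>(?N \<bind> P)) < \<infinity>"
    using kernel_power_props[OF x, of n] kernel_power_props[OF x, of "Suc n"] by auto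
  interpret N: prob_space ?N by fact
  have PN: "P \<in> ?N \<rightarrow>\<^sub>M subprob_algebra M" using kernel_subprob by (simp add: measurable_cong_sets[OF N(2) refl])
  have fb: "\<forall>x\<in>S. \<bar>f x - c\<bar> \<le> L * (1 + \<beta> * v x)" using Suc(3) by blast
  have g: "?g \<in> borel_measurable M"
    by (rule measurable_compose[OF kernel_subprob integral_measurable_subprob_algebra]) (fact Suc)
  obtain c' where c': "\<And>x. x \<in> S \<Longrightarrow> \<bar>?g x - c'\<bar> \<le> \<kappa> * L * (1 + \<beta> * v x)"
    using centering[of ?g "\<kappa> * L"] contraction[OF Suc(2,3,4)] by blast
  have "\<bar>(\<integral>y. ?g y \<partial>?N) - (\<integral>y. ?g y \<partial>M)\<bar> \<le> \<kappa> ^ n * (\<kappa> * L) * (2 + \<beta> * v x + \<beta> * (\<integral>y. v y \<partial>M))"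
    using Suc(4) \<kappa>_bounds(1) by (intro Suc.IH[OF g c']) auto
  moreover have "(\<integral>y. ?g y \<partial>?N) = (\<integral>y. f y \<partial>(?N \<bind> P))"
    by (rule integral_bind_integrable(1)[OF PN N.not_empty integrable_weight(3)[OF N' Suc(2) fb], symmetric])
  moreover have "(\<integral>y. ?g y \<partial>M) = (\<integral>y. f y \<partial>(M \<bind> P))"
    using integrable_weight(3)[OF prob_space_axioms refl V_integrable Suc(2) fb]
    by (intro integral_bind_integrable(1)[OF kernel_subprob not_empty, symmetric]) (simp add: invariant)
  ultimately show ?case by (simp add: invariant ac_simps)
qed

theorem geometric_ergodicity: "geometrically_ergodic M P"
proof -
  \<comment> \<open>A test function with \<open>\<bar>f\<bar> \<le> V\<close> satisfies the
    hypothesis of \<open>convergence\<close> with centre 0 and \<open>L = 1 / \<beta>\<close>. The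
    remaining terms are absorbed into a multiple of \<open>v x\<close> because
    \<open>v x \<ge> 1\<close>.\<close>
  define c where "c = (1 / \<beta>) * (2 + \<beta> + \<beta> * (\<integral>y. v y \<partial>M))"
  have E: "0 \<le> (\<integral>y. v y \<partial>M)" by (simp add: v_nonneg)
  have c0: "0 < c" using \<beta>_pos E by (simp add: c_def add_pos_nonneg)
  have bound: "V_norm_diff V (kernel_power M P n x) M \<le> ennreal (c * \<kappa> ^ n) * V x"
    if x: "x \<in> space M" for x n
  proof (cases "V x = \<infinity>")
    case True
    \<comment> \<open>Strict positivity matters, since 0 times infinity is 0 in
      \<open>ennreal\<close>.\<close>
    have "0 < c * \<kappa> ^ n" using c0 \<kappa>_bounds by simp
    then have "ennreal (c * \<kappa> ^ n) * V x = \<top>"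
      unfolding True infinity_ennreal_def ennreal_mult_eq_top_iff by (metis ennreal_eq_0_iff not_le)
    then show ?thesis by simp
  next
    case False
    then have xS: "x \<in> S" using x by (simp add: S_def less_top)
    show ?thesis unfolding V_norm_diff_def
    proof (rule SUP_least)
      fix f :: "'a \<Rightarrow> real"
      assume f: "f \<in> {f. integrable (kernel_power M P n x) f \<and> integrable M f \<and>
        (\<forall>x\<in>space (kernel_power M P n x). ennreal \<bar>f x\<bar> \<le> V x)}"
      have sp: "space (kernel_power M P n x) = space M"
        using kernel_power_props[OF xS, of n] by (intro sets_eq_imp_space_eq) simp
      have fb: "\<bar>f y - 0\<bar> \<le> 1 / \<beta> * (1 + \<beta> * v y)" if y: "y \<in> S" for y
      proof -
        have "ennreal \<bar>f y\<bar> \<le> ennreal (v y)" using f y sp by (auto simp: V_eq[symmetric] S_def)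
        then have "\<bar>f y\<bar> \<le> v y" using v_nonneg[of y] by simp
        then have "\<beta> * \<bar>f y\<bar> \<le> 1 + \<beta> * v y"
          using \<beta>_pos by (smt (verit) mult_left_mono)
        then show ?thesis using \<beta>_pos by (simp add: field_simps)
      qed
      have "f \<in> borel_measurable M" "0 \<le> 1 / \<beta>"
        using f \<beta>_pos by auto
      then have "\<bar>(\<integral>y. f y \<partial>kernel_power M P n x) - (\<integral>y. f y \<partial>M)\<bar>
          \<le> \<kappa> ^ n * (1 / \<beta>) * (2 + \<beta> * v x + \<beta> * (\<integral>y. v y \<partial>M))"
        using convergence[of f 0 "1 / \<beta>"] fb xS by blast
      also have "\<dots> \<le> \<kappa> ^ n * (1 / \<beta>) * ((2 + \<beta> + \<beta> * (\<integral>y. v y \<partial>M)) * v x)"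
      proof (rule mult_left_mono)
        have "2 + \<beta> * (\<integral>y. v y \<partial>M) \<le> (2 + \<beta> * (\<integral>y. v y \<partial>M)) * v x"
        proof (rule mult_right_mono[of 1 "v x", simplified mult_1, THEN order_trans, rotated 1])
          show "0 \<le> 2 + \<beta> * (\<integral>y. v y \<partial>M)" using E \<beta>_pos by (simp add: add_nonneg_nonneg)
        qed (use v_ge_1[OF xS] in \<open>simp_all add: mult.commute\<close>)
        then show "2 + \<beta> * v x + \<beta> * (\<integral>y. v y \<partial>M) \<le> (2 + \<beta> + \<beta> * (\<integral>y. v y \<partial>M)) * v x"
          by (simp add: algebra_simps)
        show "0 \<le> \<kappa> ^ n * (1 / \<beta>)"
          using \<kappa>_bounds(1) \<beta>_pos by (intro mult_nonneg_nonneg zero_le_power) auto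
      qed
      also have "\<dots> = c * \<kappa> ^ n * v x" by (simp add: c_def)
      finally show "ennreal \<bar>(\<integral>y. f y \<partial>kernel_power M P n x) - (\<integral>y. f y \<partial>M)\<bar> \<le> ennreal (c * \<kappa> ^ n) * V x"
        unfolding V_eq[OF xS] ennreal_mult''[symmetric, OF v_nonneg] by (rule ennreal_leI)
    qed
  qed
  show ?thesis
    unfolding geometrically_ergodic_def
    using kernel invariant V_measurable V_ge_1 V_finite \<kappa>_bounds less_imp_le[OF c0] bound
    by (intro conjI bexI[of _ V] exI[of _ \<kappa>] exI[of _ c]) auto
qed

end

section \<open>The proposal density\<close>

text \<open>Arises from completing the exponent: \<open>(norm x) ^ 2 + (norm (y - sqrt \<rho>
  *\<^sub>R x)) ^ 2 / (1 - \<rho>)\<close> equals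
  \<open>mpcn_form \<rho> x y / (1 - \<rho>)\<close>. The proposal built from it is a multivariate
  Student law whose degrees of freedom equal the dimension.\<close>

definition mpcn_form :: "real \<Rightarrow> 'a::real_inner \<Rightarrow> 'a \<Rightarrow> real" where
  "mpcn_form \<rho> x y = (norm x)\<^sup>2 + (norm y)\<^sup>2 - 2 * sqrt \<rho> * (x \<bullet> y)"

definition mpcn_const :: "real \<Rightarrow> nat \<Rightarrow> real" where
  "mpcn_const \<rho> d = Gamma (real d) / Gamma (real d / 2) * (sqrt (1 - \<rho>) / sqrt pi) ^ d"

definition mpcn_density :: "real \<Rightarrow> real ^ 'n \<Rightarrow> real ^ 'n \<Rightarrow> real" where
  "mpcn_density \<rho> x y = mpcn_const \<rho> CARD('n) * (norm x / mpcn_form \<rho> x y) ^ CARD('n)"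

lemma mpcn_form_commute: "mpcn_form \<rho> x y = mpcn_form \<rho> y x"
  by (simp add: mpcn_form_def inner_commute)

lemma mpcn_form_lower:
  assumes "0 \<le> \<rho>"
  shows "(1 - sqrt \<rho>) * ((norm x)\<^sup>2 + (norm y)\<^sup>2) \<le> mpcn_form \<rho> x y"
proof -
  have "2 * (x \<bullet> y) \<le> 2 * (norm x * norm y)" by (simp add: norm_cauchy_schwarz)
  also have "\<dots> \<le> (norm x)\<^sup>2 + (norm y)\<^sup>2" using sum_squares_bound[of "norm x" "norm y"] by simp
  finally have "sqrt \<rho> * (2 * (x \<bullet> y)) \<le> sqrt \<rho> * ((norm x)\<^sup>2 + (norm y)\<^sup>2)"
    using assms by (intro mult_left_mono) auto
  then show ?thesis by (simp add: mpcn_form_def algebra_simps)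
qed

lemma mpcn_form_upper:
  assumes "0 \<le> \<rho>" "\<rho> \<le> 1"
  shows "mpcn_form \<rho> x y \<le> (norm x + norm y)\<^sup>2"
proof -
  have "- (x \<bullet> y) \<le> norm x * norm y"
    using Cauchy_Schwarz_ineq2[of x y] by simp
  then have "sqrt \<rho> * (- (x \<bullet> y)) \<le> 1 * (norm x * norm y)"
    using assms by (intro order_trans[OF mult_left_mono mult_right_mono]) auto
  then show ?thesis by (simp add: mpcn_form_def power2_sum)
qed

lemma mpcn_form_pos:
  assumes "0 \<le> \<rho>" "\<rho> < 1" "x \<noteq> 0"
  shows "0 < mpcn_form \<rho> x y"
proof -
  have "0 < (1 - sqrt \<rho>) * ((norm x)\<^sup>2 + (norm y)\<^sup>2)"
    using assms by (intro mult_pos_pos) (auto simp: add_pos_nonneg)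
  then show ?thesis using mpcn_form_lower[OF assms(1), of x y] by linarith
qed

lemma mpcn_const_pos: "0 < d \<Longrightarrow> \<rho> < 1 \<Longrightarrow> 0 < mpcn_const \<rho> d"
  by (simp add: mpcn_const_def Gamma_real_pos)

lemma mpcn_density_nonneg: "0 \<le> \<rho> \<Longrightarrow> \<rho> < 1 \<Longrightarrow> 0 \<le> mpcn_density \<rho> x y"
  using mpcn_const_pos[of "CARD('a)" \<rho>] mpcn_form_pos[of \<rho> x y]
  by (cases "x = 0") (auto simp: mpcn_density_def)

lemma mpcn_density_measurable [measurable]:
  "(\<lambda>(x :: real ^ 'n, y). mpcn_density \<rho> x y) \<in> borel_measurable (borel \<Otimes>\<^sub>M borel)"
  unfolding mpcn_density_def mpcn_form_def by measurable

lemma nn_integral_lborel_affine: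
  fixes t :: "'a::euclidean_space"
  assumes [measurable]: "f \<in> borel_measurable borel" and c: "c \<noteq> 0"
  shows "(\<integral>\<^sup>+y. f y \<partial>lborel) = ennreal (\<bar>c\<bar> ^ DIM('a)) * (\<integral>\<^sup>+x. f (t + c *\<^sub>R x) \<partial>lborel)"
  by (subst lborel_affine[OF c, of t])
     (simp add: nn_integral_density nn_integral_distr nn_integral_cmult)

lemma prod_std_normal_density:
  "(\<Prod>i\<in>UNIV. std_normal_density ((w :: real ^ 'n) $ i)) = (1 / sqrt (2 * pi)) ^ CARD('n) * exp (- (norm w)\<^sup>2 / 2)"
proof -
  have "(\<Prod>i\<in>UNIV. std_normal_density (w $ i)) = (1 / sqrt (2 * pi)) ^ CARD('n) * exp (\<Sum>i\<in>UNIV. - (w $ i)\<^sup>2 / 2)"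
    by (simp add: std_normal_density_def prod.distrib prod_dividef exp_sum power_divide)
  also have "(\<Sum>i\<in>UNIV. - (w $ i)\<^sup>2 / 2) = - (norm w)\<^sup>2 / 2"
    by (simp add: norm_vec_def L2_set_def sum_nonneg sum_negf sum_divide_distrib)
  finally show ?thesis .
qed

text \<open>Normal-Gamma conjugacy. The left side is the joint density of \<open>r\<close> and
  \<open>y\<close>, with Jacobian \<open>(1 / c) ^ d\<close>. As a function of \<open>r\<close> it
  is proportional to a Gamma density of rate \<open>B\<close>, whose shape is \<open>d\<close>
  because the Jacobian contributes a second half of the dimension. The factor left over is the
  marginal density of \<open>y\<close>.\<close>

lemma mpcn_joint_density:
  fixes x y :: "real ^ 'n"
  assumes \<rho>: "0 < \<rho>" "\<rho> < 1" and x: "x \<noteq> 0" and r: "0 < r"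
  defines "d \<equiv> CARD('n)" and "b \<equiv> (norm x)\<^sup>2 / 2" and "c \<equiv> sqrt (1 - \<rho>) * r powr (- 1 / 2)"
    and "B \<equiv> mpcn_form \<rho> x y / (2 * (1 - \<rho>))"
  shows "(b powr (d / 2) / Gamma (d / 2) * r powr (d / 2 - 1) * exp (- b * r)) *
     ((1 / sqrt (2 * pi)) ^ d * exp (- (norm ((1 / c) *\<^sub>R (y - sqrt \<rho> *\<^sub>R x)))\<^sup>2 / 2) * (1 / c) ^ d)
     = mpcn_density \<rho> x y * (B powr d / Gamma d * r powr (real d - 1) * exp (- B * r))"
proof -
  have powr_half: "t powr (real d / 2) = sqrt t ^ d" if "0 < t" for t
    using that by (simp add: powr_half_sqrt[symmetric] powr_powr powr_realpow[symmetric])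
  have b: "0 < b" using x by (simp add: b_def)
  have S: "0 < mpcn_form \<rho> x y" using \<rho> x by (intro mpcn_form_pos) auto
  have B: "0 < B" using S \<rho> by (simp add: B_def)
  have c: "c = sqrt (1 - \<rho>) / sqrt r"
    using r by (simp add: c_def powr_minus_divide powr_half_sqrt)
  have c0: "0 < c" using \<rho> r by (simp add: c)
  have c2: "c\<^sup>2 = (1 - \<rho>) / r" using \<rho> r by (simp add: c power_divide)
  have G: "0 < Gamma (real d / 2)" "0 < Gamma (real d)"
    by (auto intro!: Gamma_real_pos simp: d_def)
  have exponent: "- b * r + - (norm ((1 / c) *\<^sub>R (y - sqrt \<rho> *\<^sub>R x)))\<^sup>2 / 2 = - B * r"
  proof -
    have "(norm ((1 / c) *\<^sub>R (y - sqrt \<rho> *\<^sub>R x)))\<^sup>2 = (norm (y - sqrt \<rho> *\<^sub>R x))\<^sup>2 / c\<^sup>2"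
      by (simp add: power_mult_distrib power_divide)
    also have "(norm (y - sqrt \<rho> *\<^sub>R x))\<^sup>2 = (norm y)\<^sup>2 + \<rho> * (norm x)\<^sup>2 - 2 * sqrt \<rho> * (x \<bullet> y)"
      using \<rho> by (simp add: power2_norm_eq_inner inner_diff_left inner_diff_right inner_commute algebra_simps)
    finally show ?thesis
      using \<rho> r unfolding c2 B_def b_def mpcn_form_def by (simp add: field_simps)
  qed
  have r1: "r powr (real d / 2 - 1) = sqrt r ^ d / r" "r powr (real d - 1) = r ^ d / r"
    using r by (simp_all add: powr_diff powr_half powr_realpow)
  have coeff: "sqrt b ^ d * sqrt r ^ d * (1 / sqrt (2 * pi)) ^ d * (1 / c) ^ d
     = (sqrt (1 - \<rho>) / sqrt pi) ^ d * (norm x / mpcn_form \<rho> x y) ^ d * B ^ d * r ^ d"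
  proof -
    have "sqrt b * sqrt r * (1 / sqrt (2 * pi)) * (1 / c) = sqrt (1 - \<rho>) / sqrt pi * (norm x / mpcn_form \<rho> x y) * B * r"
    proof -
      \<comment> \<open>With the square roots as variables the identity of the bases becomes one
        between rational functions.\<close>
      obtain p where p: "p = sqrt (1 - \<rho>)" "0 < p" "1 - \<rho> = p * p"
        using \<rho> by (intro that[of "sqrt (1 - \<rho>)"]) auto
      obtain s where s: "s = sqrt r" "0 < s" "r = s * s" using r by (intro that[of "sqrt r"]) auto
      obtain t where t: "t = sqrt 2" "0 < t" "(2::real) = t * t" by (intro that[of "sqrt 2"]) auto
      have "sqrt b = norm x / t" "sqrt (2 * pi) = t * sqrt pi"
        by (simp_all add: b_def t(1) real_sqrt_divide real_sqrt_mult)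
      moreover have "norm x / t * s * (1 / (t * sqrt pi)) * (1 / (p / s)) =
        p / sqrt pi * (norm x / mpcn_form \<rho> x y) * (mpcn_form \<rho> x y / (t * t * (p * p))) * (s * s)"
        using p(2) s(2) t(2) S by (simp add: field_simps)
      ultimately show ?thesis
        unfolding c B_def p(1)[symmetric] s(1)[symmetric] t(3)[symmetric] s(3)[symmetric] p(3)[symmetric]
        by (simp only:)
    qed
    then show ?thesis by (simp only: power_mult_distrib[symmetric])
  qed
  have "(b powr (d / 2) / Gamma (d / 2) * r powr (d / 2 - 1) * exp (- b * r)) *
     ((1 / sqrt (2 * pi)) ^ d * exp (- (norm ((1 / c) *\<^sub>R (y - sqrt \<rho> *\<^sub>R x)))\<^sup>2 / 2) * (1 / c) ^ d)
     = (sqrt b ^ d * sqrt r ^ d * (1 / sqrt (2 * pi)) ^ d * (1 / c) ^ d) / (Gamma (real d / 2) * r)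
       * exp (- b * r + - (norm ((1 / c) *\<^sub>R (y - sqrt \<rho> *\<^sub>R x)))\<^sup>2 / 2)"
    unfolding exp_add r1 powr_half[OF b] by (simp add: field_simps)
  also have "\<dots> = mpcn_density \<rho> x y * (B powr d / Gamma d * r powr (real d - 1) * exp (- B * r))"
    unfolding exponent coeff r1 powr_realpow[OF B] mpcn_density_def mpcn_const_def d_def[symmetric]
    using G by (simp add: field_simps)
  finally show ?thesis .
qed

text \<open>Once the order of integration is exchanged, the integral over \<open>r\<close> is the
  total mass of the conditional Gamma law, so only the marginal density remains.\<close>

lemma mpcn_proposal_eq_density:
  fixes x :: "real ^ 'n"
  assumes \<rho>: "0 < \<rho>" "\<rho> < 1" and x: "x \<noteq> 0"
  shows "mpcn_proposal \<rho> x = density lborel (\<lambda>y. ennreal (mpcn_density \<rho> x y))"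
proof (rule measure_eqI)
  let ?d = "CARD('n)" and ?b = "(norm x)\<^sup>2 / 2"
  let ?G = "gamma_law (?d / 2) ?b" and ?N = "std_normal_law :: (real ^ 'n) measure"
  define c where "c r = sqrt (1 - \<rho>) * r powr (- 1 / 2)" for r :: real
  define m where "m = sqrt \<rho> *\<^sub>R x"
  let ?T = "\<lambda>(r, w). m + c r *\<^sub>R w :: real ^ 'n"
  define g where "g t = (if 0 < t then ?b powr (?d / 2) / Gamma (?d / 2) * t powr (?d / 2 - 1) * exp (- ?b * t) else 0)" for t :: real
  define n where "n w = (1 / sqrt (2 * pi)) ^ ?d * exp (- (norm w)\<^sup>2 / 2)" for w :: "real ^ 'n"
  define B where "B y = mpcn_form \<rho> x y / (2 * (1 - \<rho>))" for y :: "real ^ 'n"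
  define k where "k y r = (if 0 < r then B y powr ?d / Gamma ?d * r powr (real ?d - 1) * exp (- B y * r) else 0)" for y r
  have n: "std_normal_law = density lborel (\<lambda>w. ennreal (n w))"
    by (simp add: std_normal_law_def prod_std_normal_density n_def)
  have G: "?G = density lborel (\<lambda>t. ennreal (g t))"
    by (simp add: gamma_law_def g_def)
  have [measurable]: "c \<in> borel_measurable borel" "g \<in> borel_measurable borel" "n \<in> borel_measurable borel"
    "B \<in> borel_measurable borel" "mpcn_density \<rho> x \<in> borel_measurable borel"
    unfolding c_def[abs_def] g_def[abs_def] n_def[abs_def] B_def[abs_def] mpcn_density_def[abs_def] mpcn_form_def
    by measurable
  have k [measurable]: "(\<lambda>(y, r). k y r) \<in> borel_measurable (borel \<Otimes>\<^sub>M borel)"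
    unfolding k_def by measurable
  have g0: "0 \<le> g t" for t
    by (auto simp: g_def intro!: mult_nonneg_nonneg divide_nonneg_nonneg Gamma_real_nonneg)
  have k0: "0 \<le> k y r" for y r
    by (auto simp: k_def intro!: mult_nonneg_nonneg divide_nonneg_nonneg Gamma_real_nonneg)
  have n0: "0 \<le> n w" for w by (simp add: n_def)
  have c0: "0 < c r" if "0 < r" for r using that \<rho> by (simp add: c_def)
  have setsGN [measurable_cong]: "sets ?G = sets borel" "sets ?N = sets borel"
    by (auto simp: G n)
  interpret N: prob_space ?N by (rule prob_space_std_normal_law)
  show "sets (mpcn_proposal \<rho> x) = sets (density lborel (\<lambda>y. ennreal (mpcn_density \<rho> x y)))"
    using x by (simp add: mpcn_proposal_def)
  fix A assume "A \<in> sets (mpcn_proposal \<rho> x)"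
  then have [measurable]: "A \<in> sets borel" using x by (simp add: mpcn_proposal_def)
  let ?f = "indicator A :: real ^ 'n \<Rightarrow> ennreal"
  have T [measurable]: "?T \<in> (?G \<Otimes>\<^sub>M ?N) \<rightarrow>\<^sub>M borel" by measurable
  have joint: "g r * (n ((1 / c r) *\<^sub>R (y - m)) * (1 / c r) ^ ?d) = mpcn_density \<rho> x y * k y r"
    if "0 < r" for r y
    using mpcn_joint_density[OF \<rho> x that, of y] that
    unfolding g_def n_def c_def m_def k_def B_def by simp
  have inner: "ennreal (g r) * (\<integral>\<^sup>+w. ennreal (n w) * ?f (?T (r, w)) \<partial>lborel)
      = (\<integral>\<^sup>+y. ennreal (mpcn_density \<rho> x y) * ?f y * ennreal (k y r) \<partial>lborel)" for r :: real
  proof (cases "0 < r")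
    case True
    note c = c0[OF True]
    let ?u = "\<lambda>y. ennreal (n ((1 / c r) *\<^sub>R (y - m))) * ?f y"
    have "(\<integral>\<^sup>+y. ?u y \<partial>lborel) = ennreal (c r ^ ?d) * (\<integral>\<^sup>+w. ennreal (n w) * ?f (?T (r, w)) \<partial>lborel)"
      using c by (subst nn_integral_lborel_affine[where c = "c r" and t = m]) auto
    moreover have "ennreal ((1 / c r) ^ ?d) * ennreal (c r ^ ?d) = 1"
      using c by (simp add: ennreal_mult[symmetric] power_mult_distrib[symmetric])
    ultimately have "(\<integral>\<^sup>+w. ennreal (n w) * ?f (?T (r, w)) \<partial>lborel) = ennreal ((1 / c r) ^ ?d) * (\<integral>\<^sup>+y. ?u y \<partial>lborel)"
      by (simp add: mult.assoc[symmetric])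
    then have "ennreal (g r) * (\<integral>\<^sup>+w. ennreal (n w) * ?f (?T (r, w)) \<partial>lborel)
        = ennreal (g r) * ennreal ((1 / c r) ^ ?d) * (\<integral>\<^sup>+y. ?u y \<partial>lborel)"
      by (simp add: mult.assoc)
    also have "\<dots> = (\<integral>\<^sup>+y. ennreal (g r) * ennreal ((1 / c r) ^ ?d) * ?u y \<partial>lborel)"
      by (rule nn_integral_cmult[symmetric]) simp
    also have "\<dots> = (\<integral>\<^sup>+y. ennreal (mpcn_density \<rho> x y) * ?f y * ennreal (k y r) \<partial>lborel)"
    proof (rule nn_integral_cong)
      fix y :: "real ^ 'n"
      have "ennreal (g r) * ennreal ((1 / c r) ^ ?d) * ennreal (n ((1 / c r) *\<^sub>R (y - m)))
         = ennreal (g r * (n ((1 / c r) *\<^sub>R (y - m)) * (1 / c r) ^ ?d))"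
        using c g0 n0 by (simp add: ennreal_mult[symmetric] ac_simps)
      also have "\<dots> = ennreal (mpcn_density \<rho> x y) * ennreal (k y r)"
        unfolding joint[OF True] using \<rho> k0 by (intro ennreal_mult) (auto simp: mpcn_density_nonneg)
      finally show "ennreal (g r) * ennreal ((1 / c r) ^ ?d) * ?u y
        = ennreal (mpcn_density \<rho> x y) * ?f y * ennreal (k y r)"
        by (simp only: mult.assoc[symmetric]) (simp only: ac_simps)
    qed
    finally show ?thesis .
  qed (simp add: g_def k_def)
  have "emeasure (mpcn_proposal \<rho> x) A = emeasure (distr (?G \<Otimes>\<^sub>M ?N) borel ?T) A"
    using x by (simp add: mpcn_proposal_def c_def m_def)
  also have "\<dots> = (\<integral>\<^sup>+y. ?f y \<partial>distr (?G \<Otimes>\<^sub>M ?N) borel ?T)"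
    by simp
  also have "\<dots> = (\<integral>\<^sup>+z. ?f (?T z) \<partial>(?G \<Otimes>\<^sub>M ?N))"
    by (rule nn_integral_distr) measurable
  also have "\<dots> = (\<integral>\<^sup>+r. (\<integral>\<^sup>+w. ?f (?T (r, w)) \<partial>?N) \<partial>?G)"
    by (rule N.nn_integral_fst[symmetric]) measurable
  also have "\<dots> = (\<integral>\<^sup>+r. ennreal (g r) * (\<integral>\<^sup>+w. ennreal (n w) * ?f (?T (r, w)) \<partial>lborel) \<partial>lborel)"
    unfolding G n by (subst nn_integral_density) (auto simp: nn_integral_density intro!: nn_integral_cong)
  also have "\<dots> = (\<integral>\<^sup>+r. (\<integral>\<^sup>+y. ennreal (mpcn_density \<rho> x y) * ?f y * ennreal (k y r) \<partial>lborel) \<partial>lborel)"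
    unfolding inner ..
  also have "\<dots> = (\<integral>\<^sup>+y. (\<integral>\<^sup>+r. ennreal (mpcn_density \<rho> x y) * ?f y * ennreal (k y r) \<partial>lborel) \<partial>lborel)"
    by (rule lborel_pair.Fubini') measurable
  also have "\<dots> = (\<integral>\<^sup>+y. ennreal (mpcn_density \<rho> x y) * ?f y \<partial>lborel)"
  proof (rule nn_integral_cong)
    fix y :: "real ^ 'n"
    have "0 < B y" using mpcn_form_pos[of \<rho> x y] \<rho> x by (simp add: B_def)
    then interpret G: prob_space "gamma_law ?d (B y)" by (intro prob_space_gamma_law) auto
    have "(\<integral>\<^sup>+r. ennreal (k y r) \<partial>lborel) = 1"
      using G.emeasure_space_1 by (simp add: gamma_law_def emeasure_density k_def)
    then show "(\<integral>\<^sup>+r. ennreal (mpcn_density \<rho> x y) * ?f y * ennreal (k y r) \<partial>lborel) = ennreal (mpcn_density \<rho> x y) * ?f y"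
      by (subst nn_integral_cmult) auto
  qed
  also have "\<dots> = emeasure (density lborel (\<lambda>y. ennreal (mpcn_density \<rho> x y))) A"
    by (simp add: emeasure_density)
  finally show "emeasure (mpcn_proposal \<rho> x) A = emeasure (density lborel (\<lambda>y. ennreal (mpcn_density \<rho> x y))) A" .
qed

section \<open>The Metropolis-Hastings kernel\<close>

lemma integral_lborel_scale:
  fixes f :: "'a::euclidean_space \<Rightarrow> real"
  assumes [measurable]: "f \<in> borel_measurable borel" and c: "c \<noteq> 0"
  shows "(\<integral>y. f y \<partial>lborel) = (\<integral>x. \<bar>c\<bar> ^ DIM('a) * f (c *\<^sub>R x) \<partial>lborel)"
  by (subst lborel_affine[OF c, of 0]) (simp add: integral_density integral_distr)

text \<open>\<open>mpcn_form\<close> is homogeneous of degree 2, so the density scales with degree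
  minus the dimension, exactly compensating the Jacobian of a dilation.\<close>

lemma mpcn_density_scale:
  fixes x y :: "real ^ 'n"
  assumes "0 < c"
  shows "c ^ CARD('n) * mpcn_density \<rho> (c *\<^sub>R x) (c *\<^sub>R y) = mpcn_density \<rho> x y"
proof -
  have "mpcn_form \<rho> (c *\<^sub>R x) (c *\<^sub>R y) = c * c * mpcn_form \<rho> x y"
    by (simp add: mpcn_form_def power2_eq_square algebra_simps)
  moreover have "c * (c * norm x / (c * c * mpcn_form \<rho> x y)) = norm x / mpcn_form \<rho> x y"
    using assms by (simp add: field_simps)
  ultimately show ?thesis
    using assms by (simp add: mpcn_density_def power_mult_distrib[symmetric] mult.left_commute[of "c ^ _"])
qed

text \<open>\<open>flux t\<close> is the contribution to the relative drift of \<open>1 / sqrt h\<close> from a proposal with ratio \<open>t\<close>: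
  it is accepted with probability \<open>min 1 t\<close> and then multiplies the weight by \<open>1 / sqrt t\<close>.\<close>

definition flux :: "real \<Rightarrow> real" where
  "flux t = min 1 t * (1 / sqrt t - 1)"

lemma flux_measurable [measurable]: "flux \<in> borel_measurable borel"
  unfolding flux_def[abs_def] by measurable

text \<open>At 0 the default value of \<open>1 / sqrt 0\<close> is harmless because the factor
  \<open>min 1 0\<close> vanishes; the value also agrees with the limit of
  \<open>sqrt t - t\<close>.\<close>

lemma flux_cases: "0 < t \<Longrightarrow> t \<le> 1 \<Longrightarrow> flux t = sqrt t - t" "1 \<le> t \<Longrightarrow> flux t = 1 / sqrt t - 1" "flux 0 = 0"
  by (auto simp: flux_def right_diff_distrib real_div_sqrt)

lemma flux_bounded: "0 \<le> t \<Longrightarrow> \<bar>flux t\<bar> \<le> 1"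
proof (cases "t \<le> 1")
  case True
  assume t: "0 \<le> t"
  show ?thesis
  proof (cases "t = 0")
    case False
    have "t \<le> sqrt t" "sqrt t \<le> 1" using t True by (auto simp: real_le_rsqrt power2_eq_square mult_left_le)
    moreover have "flux t = sqrt t - t" using False t True by (simp add: flux_cases)
    ultimately show ?thesis using t by linarith
  qed (simp add: flux_cases)
next
  case False
  then have "1 / sqrt t \<le> 1" "0 \<le> 1 / sqrt t" by auto
  then show ?thesis using False by (simp add: flux_cases)
qed

locale mpcn_target =
  fixes \<rho> :: real and \<pi> :: "real ^ 'n \<Rightarrow> real"
  assumes \<rho>: "0 < \<rho>" "\<rho> < 1"
    and \<pi>_pos: "\<And>x. 0 < \<pi> x" and \<pi>_cont: "continuous_on UNIV \<pi>"
    and prob_target: "prob_space (density lborel (\<lambda>x. ennreal (\<pi> x)))"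
begin

abbreviation target :: "(real ^ 'n) measure" where
  "target \<equiv> density lborel (\<lambda>x. ennreal (\<pi> x))"
abbreviation P :: "real ^ 'n \<Rightarrow> (real ^ 'n) measure" where
  "P \<equiv> mpcn_kernel \<rho> \<pi>"
abbreviation q :: "real ^ 'n \<Rightarrow> real ^ 'n \<Rightarrow> real" where
  "q \<equiv> mpcn_density \<rho>"
abbreviation a :: "real ^ 'n \<Rightarrow> real ^ 'n \<Rightarrow> real" where
  "a \<equiv> mpcn_acceptance \<pi>"

text \<open>The density of the target with respect to the reversing measure of the proposal, which
  has Lebesgue density \<open>1 / norm x ^ d\<close>. Hence the acceptance ratio involves
  \<open>h\<close> alone.\<close>

definition h :: "real ^ 'n \<Rightarrow> real" where
  "h x = \<pi> x * norm x ^ CARD('n)"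

lemma a_eq: "a x y = min 1 (h y / h x)"
  by (simp add: mpcn_acceptance_def h_def)

lemma h_nonneg: "0 \<le> h x" and h_pos: "x \<noteq> 0 \<Longrightarrow> 0 < h x" and h_0 [simp]: "h 0 = 0"
  using \<pi>_pos[of x] by (auto simp: h_def)

lemma q_nonneg: "0 \<le> q x y"
  using \<rho> by (simp add: mpcn_density_nonneg)

lemma a_bounds: "0 \<le> a x y" "a x y \<le> 1"
  by (auto simp: a_eq h_nonneg)

lemma \<pi>_measurable [measurable]: "\<pi> \<in> borel_measurable borel"
  using \<pi>_cont by (rule borel_measurable_continuous_onI)

lemma h_cont: "continuous_on A h"
  unfolding h_def[abs_def] by (intro continuous_intros continuous_on_subset[OF \<pi>_cont]) auto

lemma h_measurable [measurable]: "h \<in> borel_measurable borel"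
  using h_cont by (rule borel_measurable_continuous_onI)

lemma a_measurable [measurable]: "(\<lambda>(x, y). a x y) \<in> borel_measurable (borel \<Otimes>\<^sub>M borel)"
  unfolding a_eq by measurable

text \<open>No integral is computed: the proposal is the image of a product of two probability laws,
  so its density has mass 1.\<close>

lemma nn_integral_q: "x \<noteq> 0 \<Longrightarrow> (\<integral>\<^sup>+y. ennreal (q x y) \<partial>lborel) = 1"
proof -
  assume x: "x \<noteq> 0"
  interpret G: prob_space "gamma_law (CARD('n) / 2) ((norm x)\<^sup>2 / 2)"
    using x by (intro prob_space_gamma_law) auto
  interpret N: prob_space "std_normal_law :: (real ^ 'n) measure" by (rule prob_space_std_normal_law)
  interpret GN: pair_prob_space "gamma_law (CARD('n) / 2) ((norm x)\<^sup>2 / 2)" "std_normal_law :: (real ^ 'n) measure" ..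
  have [measurable_cong]: "sets (gamma_law (CARD('n) / 2) ((norm x)\<^sup>2 / 2)) = sets borel" "sets (std_normal_law :: (real ^ 'n) measure) = sets borel"
    by (auto simp: gamma_law_def std_normal_law_def)
  have "prob_space (mpcn_proposal \<rho> x)"
    unfolding mpcn_proposal_def using x by (simp, intro GN.prob_space_distr) measurable
  then interpret Q: prob_space "mpcn_proposal \<rho> x" .
  show ?thesis
    using Q.emeasure_space_1 by (simp add: mpcn_proposal_eq_density[OF \<rho> x] emeasure_density)
qed

lemma q_integrable: "x \<noteq> 0 \<Longrightarrow> integrable lborel (q x)" and integral_q: "x \<noteq> 0 \<Longrightarrow> (\<integral>y. q x y \<partial>lborel) = 1"
  using nn_integral_q[of x] by (auto intro!: integrableI_nonneg simp: q_nonneg integral_eq_nn_integral)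

lemma q_bounded_integrable:
  assumes "x \<noteq> 0" and [measurable]: "f \<in> borel_measurable borel" and "\<And>y. \<bar>f y\<bar> \<le> B"
  shows "integrable lborel (\<lambda>y. q x y * f y)"
proof (rule Bochner_Integration.integrable_bound)
  show "integrable lborel (\<lambda>y. B * q x y)" using q_integrable[OF assms(1)] by simp
  have "\<bar>q x y * f y\<bar> \<le> \<bar>B * q x y\<bar>" for y
    using assms(3)[of y] q_nonneg[of x y]
    by (metis abs_ge_self abs_mult abs_of_nonneg mult.commute mult_left_mono order_trans)
  then show "AE y in lborel. norm (q x y * f y) \<le> norm (B * q x y)" by simp
qed simp

lemma integral_q_unit:
  assumes x: "x \<noteq> 0" and f: "f \<in> borel_measurable borel" "\<And>y. 0 \<le> f y" "\<And>y. f y \<le> 1"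
  shows "0 \<le> (\<integral>y. q x y * f y \<partial>lborel)" "(\<integral>y. q x y * f y \<partial>lborel) \<le> 1"
proof -
  show "0 \<le> (\<integral>y. q x y * f y \<partial>lborel)"
    using f(2) q_nonneg by (intro Bochner_Integration.integral_nonneg mult_nonneg_nonneg)
  have "(\<integral>y. q x y * f y \<partial>lborel) \<le> (\<integral>y. q x y \<partial>lborel)"
    using f q_nonneg by (intro integral_mono q_integrable[OF x] q_bounded_integrable[OF x, of _ 1]) (auto simp: mult_left_le)
  then show "(\<integral>y. q x y * f y \<partial>lborel) \<le> 1"
    using integral_q[OF x] by simp
qed

section \<open>Accepted and rejected mass, integrals against the kernel, invariance\<close>

definition accept :: "real ^ 'n \<Rightarrow> ennreal" where
  "accept x = (\<integral>\<^sup>+y. ennreal (q x y * a x y) \<partial>lborel)"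

lemma accept_measurable [measurable]: "accept \<in> borel_measurable borel"
  unfolding accept_def[abs_def] by measurable

lemma accept_le_1: "accept x \<le> 1"
proof (cases "x = 0")
  case True
  then show ?thesis by (simp add: accept_def mpcn_density_def zero_power)
next
  case False
  have "accept x \<le> (\<integral>\<^sup>+y. ennreal (q x y) \<partial>lborel)"
    unfolding accept_def using a_bounds q_nonneg by (intro nn_integral_mono ennreal_leI) (auto simp: mult_left_le)
  then show ?thesis using nn_integral_q[OF False] by simp
qed

lemma sets_P [simp]: "sets (P x) = sets borel"
  by (simp add: mpcn_kernel_def)

lemma emeasure_P:
  assumes x: "x \<noteq> 0" and [measurable]: "A \<in> sets borel"
  shows "emeasure (P x) A = (\<integral>\<^sup>+y. ennreal (q x y * a x y) * indicator A y \<partial>lborel) + (1 - accept x) * indicator A x"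
proof -
  have *: "(\<integral>\<^sup>+y. ennreal (a x y) * f y \<partial>mpcn_proposal \<rho> x) = (\<integral>\<^sup>+y. ennreal (q x y * a x y) * f y \<partial>lborel)"
    if [measurable]: "f \<in> borel_measurable borel" for f
    unfolding mpcn_proposal_eq_density[OF \<rho> x]
    by (subst nn_integral_density) (auto simp: ennreal_mult q_nonneg a_bounds mult.assoc intro!: nn_integral_cong)
  have "emeasure (P x) A = (\<integral>\<^sup>+y. ennreal (a x y) * indicator A y \<partial>mpcn_proposal \<rho> x)
      + indicator A x * (1 - (\<integral>\<^sup>+y. ennreal (a x y) \<partial>mpcn_proposal \<rho> x))"
    unfolding mpcn_kernel_def using x
    by (simp, intro emeasure_mh_kernel) (auto simp: mpcn_proposal_eq_density[OF \<rho> x])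
  moreover have "(\<integral>\<^sup>+y. ennreal (a x y) \<partial>mpcn_proposal \<rho> x) = accept x"
    using *[of "\<lambda>_. 1"] by (simp add: accept_def)
  ultimately show ?thesis
    using *[of "indicator A"] by (simp only: mult.commute[of "indicator A x"]) simp
qed

lemma prob_space_P: "prob_space (P x)"
proof (cases "x = 0")
  case True
  then show ?thesis by (simp add: mpcn_kernel_def prob_space_return)
next
  case False
  have "space (P x) = UNIV" using sets_eq_imp_space_eq[OF sets_P[of x]] by simp
  then show ?thesis
    using emeasure_P[OF False, of UNIV] add_diff_inverse_ennreal[OF accept_le_1[of x]]
    by (intro prob_spaceI) (simp add: accept_def)
qed

lemma nn_integral_P:
  assumes x: "x \<noteq> 0" and f: "f \<in> borel_measurable borel"
  shows "(\<integral>\<^sup>+y. f y \<partial>P x) = (\<integral>\<^sup>+y. ennreal (q x y * a x y) * f y \<partial>lborel) + (1 - accept x) * f x"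
  using f
proof induct
  case (cong f g)
  then have "f = g" by auto
  with cong show ?case by simp
next
  case (set A)
  then show ?case by (simp add: emeasure_P[OF x])
next
  case (mult u c)
  note [measurable] = mult(2)
  have "(\<integral>\<^sup>+y. c * u y \<partial>P x) = c * (\<integral>\<^sup>+y. u y \<partial>P x)"
    by (rule nn_integral_cmult) (simp add: measurable_cong_sets[OF sets_P refl])
  moreover have "(\<integral>\<^sup>+y. ennreal (q x y * a x y) * (c * u y) \<partial>lborel) = c * (\<integral>\<^sup>+y. ennreal (q x y * a x y) * u y \<partial>lborel)"
    by (subst nn_integral_cmult[symmetric]) (auto simp: ac_simps)
  ultimately show ?case using mult by (simp add: distrib_left ac_simps)
next
  case (add u v)
  note [measurable] = add(1,4)
  have "(\<integral>\<^sup>+y. v y + u y \<partial>P x) = (\<integral>\<^sup>+y. v y \<partial>P x) + (\<integral>\<^sup>+y. u y \<partial>P x)"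
    by (rule nn_integral_add) (simp_all add: measurable_cong_sets[OF sets_P refl])
  moreover have "(\<integral>\<^sup>+y. ennreal (q x y * a x y) * (v y + u y) \<partial>lborel)
     = (\<integral>\<^sup>+y. ennreal (q x y * a x y) * v y \<partial>lborel) + (\<integral>\<^sup>+y. ennreal (q x y * a x y) * u y \<partial>lborel)"
    by (subst nn_integral_add[symmetric]) (auto simp: distrib_left)
  ultimately show ?case unfolding add(3,7) distrib_left by (simp only: ac_simps)
next
  case (seq U)
  note [measurable] = seq(1)
  have inc: "incseq U" by fact
  then have Ux: "incseq (\<lambda>i. U i y)" for y by (auto simp: incseq_def le_fun_def)
  have "(\<integral>\<^sup>+y. (SUP i. U i) y \<partial>P x) = (SUP i. \<integral>\<^sup>+y. U i y \<partial>P x)"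
    unfolding SUP_apply
    by (rule nn_integral_monotone_convergence_SUP[OF inc]) (simp add: measurable_cong_sets[OF sets_P refl])
  also have "\<dots> = (SUP i. (\<integral>\<^sup>+y. ennreal (q x y * a x y) * U i y \<partial>lborel) + (1 - accept x) * U i x)"
    using seq(3) by simp
  also have "\<dots> = (SUP i. \<integral>\<^sup>+y. ennreal (q x y * a x y) * U i y \<partial>lborel) + (SUP i. (1 - accept x) * U i x)"
    using Ux by (intro ennreal_SUP_add) (auto simp: incseq_def intro!: nn_integral_mono mult_left_mono)
  also have "(SUP i. \<integral>\<^sup>+y. ennreal (q x y * a x y) * U i y \<partial>lborel) = (\<integral>\<^sup>+y. (SUP i. ennreal (q x y * a x y) * U i y) \<partial>lborel)"
    using Ux by (intro nn_integral_monotone_convergence_SUP[symmetric]) (auto simp: incseq_def le_fun_def intro!: mult_left_mono)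
  finally show ?case by (simp only: SUP_apply SUP_mult_left_ennreal)
qed

lemma kernel_measurable: "P \<in> target \<rightarrow>\<^sub>M prob_algebra target"
proof (intro measurable_prob_algebraI measurable_subprob_algebra)
  fix A :: "(real ^ 'n) set" assume "A \<in> sets target"
  then have [measurable]: "A \<in> sets borel" by simp
  have "(\<lambda>x. emeasure (P x) A) = (\<lambda>x. if x = 0 then indicator A 0 else
      (\<integral>\<^sup>+y. ennreal (q x y * a x y) * indicator A y \<partial>lborel) + (1 - accept x) * indicator A x)"
    by (auto simp: emeasure_P fun_eq_iff, simp add: mpcn_kernel_def)
  also have "\<dots> \<in> borel_measurable borel"
    by measurable
  finally show "(\<lambda>x. emeasure (P x) A) \<in> borel_measurable target" by simp
qed (auto simp: prob_space_P prob_space_imp_subprob_space)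

text \<open>Away from the origin both sides are a symmetric factor times
  \<open>min (h x) (h y)\<close>. At the origin both vanish, one through the proposal density and
  the other through the acceptance probability, since \<open>h 0 = 0\<close>.\<close>

lemma detailed_balance: "\<pi> x * (q x y * a x y) = \<pi> y * (q y x * a y x)"
proof (cases "x = 0 \<or> y = 0")
  case True
  then show ?thesis by (auto simp: mpcn_density_def a_eq)
next
  case False
  have *: "\<pi> x * (q x y * a x y) = mpcn_const \<rho> CARD('n) / mpcn_form \<rho> x y ^ CARD('n) * min (h x) (h y)" if "x \<noteq> 0" for x y
  proof -
    have "h x * a x y = min (h x) (h y)"
      using h_pos[OF that] by (auto simp: a_eq min_def field_simps)
    then show ?thesis
      by (simp add: mpcn_density_def power_divide h_def field_simps)
  qed
  show ?thesis
    using False by (simp add: * mpcn_form_commute[of \<rho> y x] min.commute)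
qed

text \<open>Detailed balance turns the mass accepted into \<open>A\<close> into
  \<open>accept\<close> integrated over \<open>A\<close>, and the rejected mass supplies the
  complement. The exceptional kernel at the origin concerns a null set.\<close>

lemma invariance: "target \<bind> P = target"
proof (rule measure_eqI)
  have PM: "P \<in> target \<rightarrow>\<^sub>M subprob_algebra target"
    using kernel_measurable by (rule measurable_prob_algebraD)
  show "sets (target \<bind> P) = sets target" by (intro sets_bind) auto
  fix A assume "A \<in> sets (target \<bind> P)"
  also have "sets (target \<bind> P) = sets target" by (intro sets_bind) auto
  finally have A [measurable]: "A \<in> sets borel" by simp
  have "emeasure (target \<bind> P) A = (\<integral>\<^sup>+x. emeasure (P x) A \<partial>target)"
    by (rule emeasure_bind[OF _ PM]) auto
  also have "\<dots> = (\<integral>\<^sup>+x. ennreal (\<pi> x) * emeasure (P x) A \<partial>lborel)"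
    using measurable_emeasure_kernel[OF PM] A by (intro nn_integral_density) auto
  also have "\<dots> = (\<integral>\<^sup>+x. (\<integral>\<^sup>+y. ennreal (\<pi> x * (q x y * a x y)) * indicator A y \<partial>lborel) + ennreal (\<pi> x) * (1 - accept x) * indicator A x \<partial>lborel)"
  proof (rule nn_integral_cong_AE)
    have "AE x in lborel. x \<noteq> (0 :: real ^ 'n)" by (rule AE_lborel_singleton)
    then show "AE x in lborel. ennreal (\<pi> x) * emeasure (P x) A =
      (\<integral>\<^sup>+y. ennreal (\<pi> x * (q x y * a x y)) * indicator A y \<partial>lborel) + ennreal (\<pi> x) * (1 - accept x) * indicator A x"
    proof eventually_elim
      case (elim x)
      have "ennreal (\<pi> x) * (\<integral>\<^sup>+y. ennreal (q x y * a x y) * indicator A y \<partial>lborel) = (\<integral>\<^sup>+y. ennreal (\<pi> x * (q x y * a x y)) * indicator A y \<partial>lborel)"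
        using \<pi>_pos[of x] by (subst nn_integral_cmult[symmetric])
          (auto simp: ennreal_mult q_nonneg a_bounds less_imp_le mult.assoc intro!: nn_integral_cong)
      then show ?case by (simp add: emeasure_P[OF elim] distrib_left mult.assoc)
    qed
  qed
  also have "\<dots> = (\<integral>\<^sup>+x. (\<integral>\<^sup>+y. ennreal (\<pi> x * (q x y * a x y)) * indicator A y \<partial>lborel) \<partial>lborel)
      + (\<integral>\<^sup>+x. ennreal (\<pi> x) * (1 - accept x) * indicator A x \<partial>lborel)"
    by (intro nn_integral_add) auto
  also have "(\<integral>\<^sup>+x. (\<integral>\<^sup>+y. ennreal (\<pi> x * (q x y * a x y)) * indicator A y \<partial>lborel) \<partial>lborel)
     = (\<integral>\<^sup>+y. (\<integral>\<^sup>+x. ennreal (\<pi> x * (q x y * a x y)) * indicator A y \<partial>lborel) \<partial>lborel)"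
    by (rule lborel_pair.Fubini'[symmetric]) measurable
  also have "\<dots> = (\<integral>\<^sup>+y. ennreal (\<pi> y) * accept y * indicator A y \<partial>lborel)"
  proof (rule nn_integral_cong)
    fix y
    have "(\<integral>\<^sup>+x. ennreal (\<pi> x * (q x y * a x y)) * indicator A y \<partial>lborel)
      = (\<integral>\<^sup>+x. (ennreal (\<pi> y) * indicator A y) * ennreal (q y x * a y x) \<partial>lborel)"
      using \<pi>_pos[of y] unfolding detailed_balance[of _ y]
      by (intro nn_integral_cong) (simp add: ennreal_mult q_nonneg a_bounds less_imp_le ac_simps)
    then show "(\<integral>\<^sup>+x. ennreal (\<pi> x * (q x y * a x y)) * indicator A y \<partial>lborel) = ennreal (\<pi> y) * accept y * indicator A y"
      unfolding accept_def by (subst (asm) nn_integral_cmult) (auto simp: ac_simps)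
  qed
  also have "\<dots> + (\<integral>\<^sup>+x. ennreal (\<pi> x) * (1 - accept x) * indicator A x \<partial>lborel)
    = (\<integral>\<^sup>+x. ennreal (\<pi> x) * accept x * indicator A x + ennreal (\<pi> x) * (1 - accept x) * indicator A x \<partial>lborel)"
    by (intro nn_integral_add[symmetric]) auto
  also have "\<dots> = (\<integral>\<^sup>+x. ennreal (\<pi> x) * indicator A x \<partial>lborel)"
    by (intro nn_integral_cong)
      (simp add: distrib_left[symmetric] distrib_right[symmetric] add_diff_inverse_ennreal[OF accept_le_1])
  also have "\<dots> = emeasure target A" by (simp add: emeasure_density)
  finally show "emeasure (target \<bind> P) A = emeasure target A" .
qed

text \<open>The relative drift of \<open>1 / sqrt h\<close> at \<open>x\<close>, in coordinates rescaled by \<open>norm x\<close>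
  (\<open>sgn x\<close> is the direction of \<open>x\<close>).\<close>

definition D :: "real ^ 'n \<Rightarrow> real" where
  "D x = (\<integral>z. q (sgn x) z * flux (h (norm x *\<^sub>R z) / h x) \<partial>lborel)"

lemma D_eq:
  assumes x: "x \<noteq> 0"
  shows "D x = (\<integral>y. q x y * flux (h y / h x) \<partial>lborel)"
proof -
  have xs: "norm x *\<^sub>R sgn x = x" using x by (simp add: sgn_div_norm)
  have "(\<integral>y. q x y * flux (h y / h x) \<partial>lborel)
      = (\<integral>z. \<bar>norm x\<bar> ^ DIM(real ^ 'n) * (q x (norm x *\<^sub>R z) * flux (h (norm x *\<^sub>R z) / h x)) \<partial>lborel)"
    using x by (intro integral_lborel_scale) auto
  also have "\<dots> = D x"
    unfolding D_def using mpcn_density_scale[of "norm x" \<rho> "sgn x"] x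
    by (intro Bochner_Integration.integral_cong refl) (simp add: xs mult.assoc[symmetric])
  finally show ?thesis ..
qed

text \<open>\<open>D x\<close> is split into the mean accepted relative weight and the mean
  acceptance probability. Both lie in [0, 1], which gives the bounds on \<open>D\<close> and avoids
  subtracting infinite quantities. At the origin the weight here has the default value 0; changing
  that value does not alter the integral, as \<open>P x\<close> gives the origin no mass.\<close>

lemma nn_integral_P_weight:
  assumes x: "x \<noteq> 0"
  shows "-1 \<le> D x" "D x \<le> 1"
    "(\<integral>\<^sup>+y. ennreal (1 / sqrt (h y)) \<partial>P x) = ennreal (1 / sqrt (h x) * (1 + D x))"
proof -
  let ?t = "\<lambda>y. h y / h x"
  have hx: "0 < h x" by (rule h_pos[OF x])
  have t0: "0 \<le> ?t y" for y using hx h_nonneg[of y] by simp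
  have b1: "\<bar>min 1 (?t y)\<bar> \<le> 1" for y using t0[of y] by simp
  have b2: "0 \<le> min 1 (?t y) / sqrt (?t y)" "min 1 (?t y) / sqrt (?t y) \<le> 1" for y
  proof -
    show "0 \<le> min 1 (?t y) / sqrt (?t y)" using t0[of y] by simp
    show "min 1 (?t y) / sqrt (?t y) \<le> 1"
    proof (cases "?t y \<le> 1")
      case True
      then have "?t y / sqrt (?t y) \<le> 1" using t0[of y] by (subst real_div_sqrt) auto
      then show ?thesis using True by simp
    next
      case False
      then show ?thesis by simp
    qed
  qed
  let ?I1 = "\<integral>y. q x y * (min 1 (?t y) / sqrt (?t y)) \<partial>lborel" and ?I2 = "\<integral>y. q x y * min 1 (?t y) \<partial>lborel"
  have i1: "integrable lborel (\<lambda>y. q x y * (min 1 (?t y) / sqrt (?t y)))"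
    using b2 by (intro q_bounded_integrable[OF x, of _ 1]) (simp_all del: abs_divide add: abs_of_nonneg[OF b2(1)])
  have i2: "integrable lborel (\<lambda>y. q x y * min 1 (?t y))"
    using b1 by (intro q_bounded_integrable[OF x, of _ 1]) auto
  have D: "D x = ?I1 - ?I2"
    unfolding D_eq[OF x] flux_def using i1 i2
    by (subst Bochner_Integration.integral_diff[symmetric]) (auto simp: algebra_simps)
  have I1: "0 \<le> ?I1" "?I1 \<le> 1"
    using b2 by (intro integral_q_unit[OF x]; simp)+
  have I2: "0 \<le> ?I2" "?I2 \<le> 1"
    using t0 by (intro integral_q_unit[OF x]; simp)+
  show "-1 \<le> D x" "D x \<le> 1" using D I1 I2 by auto
  have acc: "accept x = ennreal ?I2"
    unfolding accept_def a_eq using t0 q_nonneg by (intro nn_integral_eq_integral[OF i2]) auto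
  have "(\<integral>\<^sup>+y. ennreal (q x y * a x y) * ennreal (1 / sqrt (h y)) \<partial>lborel)
      = (\<integral>\<^sup>+y. ennreal (1 / sqrt (h x)) * ennreal (q x y * (min 1 (?t y) / sqrt (?t y))) \<partial>lborel)"
  proof (rule nn_integral_cong)
    fix y
    have "ennreal (q x y * a x y) * ennreal (1 / sqrt (h y)) = ennreal (q x y * a x y * (1 / sqrt (h y)))"
      using h_nonneg[of y] a_bounds q_nonneg by (intro ennreal_mult[symmetric]) auto
    also have "q x y * a x y * (1 / sqrt (h y)) = (1 / sqrt (h x)) * (q x y * (min 1 (?t y) / sqrt (?t y)))"
      using hx by (simp add: a_eq real_sqrt_divide)
    also have "ennreal \<dots> = ennreal (1 / sqrt (h x)) * ennreal (q x y * (min 1 (?t y) / sqrt (?t y)))"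
      using hx b2 q_nonneg by (intro ennreal_mult mult_nonneg_nonneg) auto
    finally show "ennreal (q x y * a x y) * ennreal (1 / sqrt (h y)) = ennreal (1 / sqrt (h x)) * ennreal (q x y * (min 1 (?t y) / sqrt (?t y)))" .
  qed
  also have "\<dots> = ennreal (1 / sqrt (h x)) * ennreal ?I1"
    using nn_integral_eq_integral[OF i1] mult_nonneg_nonneg[OF q_nonneg b2(1)] by (subst nn_integral_cmult) auto
  finally have "(\<integral>\<^sup>+y. ennreal (1 / sqrt (h y)) \<partial>P x) = ennreal (1 / sqrt (h x)) * ennreal ?I1 + (1 - ennreal ?I2) * ennreal (1 / sqrt (h x))"
    by (subst nn_integral_P[OF x]) (simp_all add: acc)
  also have "1 - ennreal ?I2 = ennreal (1 - ?I2)"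
    using I2 by (simp add: ennreal_minus[symmetric])
  also have "ennreal (1 / sqrt (h x)) * ennreal ?I1 + ennreal (1 - ?I2) * ennreal (1 / sqrt (h x)) = ennreal (1 / sqrt (h x) * (1 + D x))"
  proof -
    have "ennreal (v * I + (1 - J) * v) = ennreal v * ennreal I + ennreal (1 - J) * ennreal v"
      if "0 \<le> v" "0 \<le> I" "J \<le> 1" for v I J
      using that by (subst ennreal_plus) (auto simp: ennreal_mult)
    from this[of "1 / sqrt (h x)" ?I1 ?I2] show ?thesis
      using I1 I2 hx unfolding D by (simp add: algebra_simps)
  qed
  finally show "(\<integral>\<^sup>+y. ennreal (1 / sqrt (h y)) \<partial>P x) = ennreal (1 / sqrt (h x) * (1 + D x))" .
qed

end

section \<open>A drift criterion for geometric ergodicity\<close>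

context mpcn_target begin

lemma AE_P_nonzero: "x \<noteq> 0 \<Longrightarrow> AE y in P x. y \<noteq> 0"
proof (rule AE_I[where N="{0}"])
  assume x: "x \<noteq> 0"
  have "(\<integral>\<^sup>+y. ennreal (q x y * a x y) * indicator {0} y \<partial>lborel) = 0"
  proof (subst nn_integral_0_iff_AE)
    show "AE y in lborel. ennreal (q x y * a x y) * indicator {0} y = 0"
      using AE_lborel_singleton[of "0 :: real ^ 'n"] by eventually_elim simp
  qed simp
  then show "emeasure (P x) {0} = 0"
    using x by (simp add: emeasure_P)
qed auto

lemma h_bounded:
  assumes "(h \<longlongrightarrow> 0) at_infinity"
  obtains H where "0 < H" "\<And>x. h x \<le> H"
proof -
  have "eventually (\<lambda>x. h x < 1) at_infinity"
    using assms by (rule order_tendstoD) simp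
  then obtain B where B: "\<And>x. B \<le> norm x \<Longrightarrow> h x < 1"
    by (auto simp: eventually_at_infinity)
  have "bounded (h ` cball 0 B)"
    by (intro compact_imp_bounded compact_continuous_image h_cont compact_cball)
  then obtain H where H: "\<forall>y\<in>h ` cball 0 B. norm y \<le> H"
    unfolding bounded_iff by blast
  show ?thesis
  proof (rule that[of "max 1 H"])
    fix x
    show "h x \<le> max 1 H"
    proof (cases "B \<le> norm x")
      case False
      then have "h x \<in> h ` cball 0 B" by simp
      then have "norm (h x) \<le> H" using H by blast
      then show ?thesis by simp
    qed (use B[of x] in simp)
  qed simp
qed

text \<open>Dividing by a bound \<open>H\<close> of \<open>h\<close> normalises the weight to be at
  least 1. At the origin it is set to infinity, because the kernel stays there and cannot approach
  the target.\<close>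

theorem geometric_ergodicity_criterion:
  assumes h_lim: "(h \<longlongrightarrow> 0) at_infinity" and \<eta>: "0 < \<eta>"
    and D_inf: "eventually (\<lambda>x. D x \<le> - \<eta>) at_infinity"
    and D_0: "eventually (\<lambda>x. D x \<le> - \<eta>) (at 0)"
  shows "geometrically_ergodic target P"
proof -
  obtain H where H: "0 < H" "\<And>x. h x \<le> H" using h_bounded[OF h_lim] by blast
  define w where "w x = sqrt H / sqrt (h x)" for x
  define V where "V x = (if x = 0 then \<infinity> else ennreal (w x))" for x
  have w_nonneg: "0 \<le> w x" for x using H h_nonneg by (simp add: w_def)
  have w_ge_1: "1 \<le> w x" if "x \<noteq> 0" for x
    using h_pos[OF that] H by (simp add: w_def)
  have V_m [measurable]: "V \<in> borel_measurable borel"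
    unfolding V_def[abs_def] w_def by measurable
  have PV: "(\<integral>\<^sup>+y. V y \<partial>P x) = ennreal (w x * (1 + D x))" if x: "x \<noteq> 0" for x
  proof -
    have "(\<integral>\<^sup>+y. V y \<partial>P x) = (\<integral>\<^sup>+y. ennreal (sqrt H) * ennreal (1 / sqrt (h y)) \<partial>P x)"
    proof (rule nn_integral_cong_AE)
      show "AE y in P x. V y = ennreal (sqrt H) * ennreal (1 / sqrt (h y))"
        using AE_P_nonzero[OF x]
        by eventually_elim (use H h_nonneg in \<open>simp add: V_def w_def ennreal_mult[symmetric]\<close>)
    qed
    also have "\<dots> = ennreal (sqrt H) * ennreal (1 / sqrt (h x) * (1 + D x))"
      by (subst nn_integral_cmult)
        (simp_all add: nn_integral_P_weight(3)[OF x] measurable_cong_sets[OF sets_P refl])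
    also have "\<dots> = ennreal (w x * (1 + D x))"
      using H h_nonneg nn_integral_P_weight(1)[OF x] by (subst ennreal_mult[symmetric]) (auto simp: w_def)
    finally show ?thesis .
  qed
  obtain b where b: "\<And>x. b \<le> norm x \<Longrightarrow> D x \<le> - \<eta>"
    using D_inf by (auto simp: eventually_at_infinity)
  obtain \<delta> where \<delta>: "0 < \<delta>" "\<And>x. x \<noteq> 0 \<Longrightarrow> norm x < \<delta> \<Longrightarrow> D x \<le> - \<eta>"
    using D_0 by (auto simp: eventually_at)
  let ?C = "cball 0 b - ball (0 :: real ^ 'n) \<delta>"
  have "compact ?C" by (intro compact_diff) auto
  moreover have "continuous_on ?C w"
  proof -
    have "sqrt (h x) \<noteq> 0" if "x \<in> ?C" for x
      using that \<delta>(1) h_pos[of x] by (cases "x = 0") auto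
    then show ?thesis
      unfolding w_def[abs_def] by (intro continuous_intros h_cont) auto
  qed
  ultimately have "bounded (w ` ?C)"
    by (intro compact_imp_bounded compact_continuous_image)
  then obtain W where W: "\<And>x. x \<in> ?C \<Longrightarrow> \<bar>w x\<bar> \<le> W"
    unfolding bounded_iff real_norm_def by blast
  \<comment> \<open>The cap 1/2 keeps \<open>\<gamma>\<close> positive. On the annulus
    \<open>?C\<close> the bound \<open>D x \<le> 1\<close> gives at most \<open>2 * W\<close>, and
    the maximum with 1 makes \<open>K\<close> positive. \<open>R\<close> exceeds the threshold of
    Harris' theorem by 1.\<close>
  define \<gamma> where "\<gamma> = 1 - min \<eta> (1 / 2)"
  define K where "K = 2 * max W 1"
  define R where "R = 2 * K / (1 - \<gamma>) + 1"
  have \<gamma>: "0 < \<gamma>" "\<gamma> < 1" using \<eta> by (auto simp: \<gamma>_def min_def)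
  have K: "0 < K" by (simp add: K_def)
  have R: "0 < R" using \<gamma> K by (simp add: R_def add_pos_pos)
  have drift: "(\<integral>\<^sup>+y. V y \<partial>P x) \<le> ennreal \<gamma> * V x + ennreal K" if "V x < \<infinity>" for x
  proof -
    have x: "x \<noteq> 0" using that by (auto simp: V_def)
    have "w x * (1 + D x) \<le> \<gamma> * w x + K"
    proof (cases "x \<in> ?C")
      case True
      have "w x * (1 + D x) \<le> W * 2"
        using W[OF True] nn_integral_P_weight(1,2)[OF x] w_nonneg[of x] by (intro mult_mono) auto
      moreover have "0 \<le> \<gamma> * w x" using \<gamma> w_nonneg[of x] by simp
      ultimately show ?thesis unfolding K_def by linarith
    next
      case False
      then have "D x \<le> - \<eta>"
        using b[of x] \<delta>(2)[OF x] by auto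
      then have "w x * (1 + D x) \<le> w x * \<gamma>"
        using w_nonneg[of x] by (intro mult_left_mono) (auto simp: \<gamma>_def)
      then show ?thesis using K by (simp add: mult.commute)
    qed
    then show ?thesis
      using PV[OF x] x \<gamma> K w_nonneg[of x]
      by (simp add: V_def ennreal_mult[symmetric] ennreal_leI flip: ennreal_plus)
  qed
  \<comment> \<open>\<open>V x \<le> R\<close> amounts to \<open>h x \<ge> H / R ^ 2\<close>, which
    keeps \<open>x\<close> away from both the origin and infinity.\<close>
  define m where "m = H / R\<^sup>2"
  have m: "0 < m" using H R by (simp add: m_def)
  have level: "x \<noteq> 0 \<and> m \<le> h x" if "V x \<le> ennreal R" for x
  proof -
    have x: "x \<noteq> 0" using that by (auto simp: V_def top_unique)
    then have "w x \<le> R" using that R by (simp add: V_def)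
    then have "(w x)\<^sup>2 \<le> R\<^sup>2" using w_nonneg[of x] by (intro power_mono)
    then show ?thesis
      using h_pos[OF x] H R x by (simp add: w_def m_def power_divide field_simps)
  qed
  have "eventually (\<lambda>x. h x < m) at_infinity"
    using h_lim m by (rule order_tendstoD)
  then obtain b' where b': "\<And>x. b' \<le> norm x \<Longrightarrow> h x < m"
    by (auto simp: eventually_at_infinity)
  have "eventually (\<lambda>x. h x < m) (at 0)"
  proof (rule order_tendstoD(2)[OF _ m])
    have "(h \<longlongrightarrow> h 0) (at 0)" using h_cont[of UNIV] unfolding continuous_on_def by blast
    then show "(h \<longlongrightarrow> 0) (at 0)" by simp
  qed
  then obtain \<delta>' where \<delta>': "0 < \<delta>'" "\<And>x. x \<noteq> 0 \<Longrightarrow> norm x < \<delta>' \<Longrightarrow> h x < m"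
    by (auto simp: eventually_at)
  \<comment> \<open>Any unit vector will do. The ball of radius 1/2 around it avoids the origin, so
    \<open>h\<close> has a positive minimum on it; the minorizing law is uniform on this
    ball.\<close>
  define e :: "real ^ 'n" where "e = axis undefined 1"
  let ?E = "cball e (1 / 2)"
  have ne: "norm e = 1" by (simp add: e_def)
  have E: "1 / 2 \<le> norm y" "norm y \<le> 3 / 2" if "y \<in> ?E" for y
    using that ne norm_triangle_ineq2[of e y] norm_triangle_ineq2[of y e]
    by (auto simp: dist_norm norm_minus_commute)
  have "\<exists>y0\<in>?E. \<forall>y\<in>?E. h y0 \<le> h y"
    by (intro continuous_attains_inf h_cont) auto
  then obtain y0 where y0: "y0 \<in> ?E" "\<And>y. y \<in> ?E \<Longrightarrow> h y0 \<le> h y" by blast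
  have hy0: "0 < h y0" using E(1)[OF y0(1)] by (intro h_pos) auto
  \<comment> \<open>The worst case over the sublevel set: \<open>norm x\<close> is at least
    \<open>\<delta>'\<close> in the numerator of the density and at most
    \<open>\<bar>b'\<bar>\<close> in the denominator, \<open>norm y\<close> is at most 3/2, and the
    ratio \<open>h y / h x\<close> is at least \<open>h y0 / H\<close>.\<close>
  define \<epsilon> where "\<epsilon> = mpcn_const \<rho> CARD('n) * (\<delta>' / (\<bar>b'\<bar> + 3 / 2)\<^sup>2) ^ CARD('n) * min 1 (h y0 / H)"
  have \<epsilon>: "0 < \<epsilon>"
    using \<delta>' hy0 H \<rho> mpcn_const_pos[of "CARD('n)" \<rho>] by (simp add: \<epsilon>_def add_nonneg_pos)
  have lower: "\<epsilon> \<le> q x y * a x y" if "V x \<le> ennreal R" "y \<in> ?E" for x y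
  proof -
    have x: "x \<noteq> 0" "m \<le> h x" using level[OF that(1)] by auto
    have nx: "\<delta>' \<le> norm x" "norm x \<le> \<bar>b'\<bar>"
      using \<delta>'(2)[OF x(1)] b'[of x] x(2) by linarith+
    have form: "0 < mpcn_form \<rho> x y" "mpcn_form \<rho> x y \<le> (\<bar>b'\<bar> + 3 / 2)\<^sup>2"
    proof -
      show "0 < mpcn_form \<rho> x y" using \<rho> x by (intro mpcn_form_pos) auto
      have "mpcn_form \<rho> x y \<le> (norm x + norm y)\<^sup>2" using \<rho> by (intro mpcn_form_upper) auto
      also have "\<dots> \<le> (\<bar>b'\<bar> + 3 / 2)\<^sup>2" using nx E(2)[OF that(2)] by (intro power_mono) auto
      finally show "mpcn_form \<rho> x y \<le> (\<bar>b'\<bar> + 3 / 2)\<^sup>2" .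
    qed
    have "mpcn_const \<rho> CARD('n) * (\<delta>' / (\<bar>b'\<bar> + 3 / 2)\<^sup>2) ^ CARD('n) \<le> q x y"
      unfolding mpcn_density_def using form nx \<delta>'(1) \<rho> mpcn_const_pos[of "CARD('n)" \<rho>]
      by (intro mult_left_mono power_mono frac_le) auto
    moreover have "min 1 (h y0 / H) \<le> a x y"
      unfolding a_eq using y0(2)[OF that(2)] H h_pos[OF x(1)] hy0 by (intro min.mono frac_le) auto
    ultimately show ?thesis
      unfolding \<epsilon>_def using q_nonneg hy0 H by (intro mult_mono) auto
  qed
  have [measurable]: "?E \<in> sets borel" by (intro borel_closed closed_cball)
  have E_pos: "0 < measure lborel ?E"
    by (simp add: content_cball_pos)
  have E_fin: "emeasure lborel ?E = ennreal (measure lborel ?E)"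
    using emeasure_lborel_cball_finite[of e "1/2"] by (intro emeasure_eq_ennreal_measure) auto
  show ?thesis
  proof (rule harris.geometric_ergodicity[where V = V and \<gamma> = \<gamma> and K = K and R = R
        and \<alpha> = "\<epsilon> * measure lborel ?E" and \<nu> = "uniform_measure lborel ?E"], intro harris.intro harris_axioms.intro)
    show "prob_space target" by (rule prob_target)
    show "P \<in> target \<rightarrow>\<^sub>M prob_algebra target" by (rule kernel_measurable)
    show "target \<bind> P = target" by (rule invariance)
    show "V \<in> borel_measurable target" by simp
    show "1 \<le> V x" if "x \<in> space target" for x
      using w_ge_1[of x] by (simp add: V_def)
    have "AE x in lborel. x \<noteq> (0 :: real ^ 'n)" by (rule AE_lborel_singleton)
    then have "AE x in lborel. 0 < ennreal (\<pi> x) \<longrightarrow> V x < \<infinity>"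
      by eventually_elim (simp add: V_def)
    then show "AE x in target. V x < \<infinity>"
      by (subst AE_density) auto
    show "0 < \<gamma>" "\<gamma> < 1" "0 < K" by fact+
    show "2 * K / (1 - \<gamma>) < R" by (simp add: R_def)
    show "0 < \<epsilon> * measure lborel ?E" using \<epsilon> E_pos by simp
    show "(\<integral>\<^sup>+y. V y \<partial>P x) \<le> ennreal \<gamma> * V x + ennreal K" if "V x < \<infinity>" for x
      by (rule drift) fact
    show "prob_space (uniform_measure lborel ?E)"
      using E_pos E_fin by (intro prob_space_uniform_measure) auto
    show "sets (uniform_measure lborel ?E) = sets target" by simp
    fix x and u :: "real ^ 'n \<Rightarrow> ennreal" assume VR: "V x \<le> ennreal R" and "u \<in> borel_measurable target"
    then have [measurable]: "u \<in> borel_measurable borel" by simp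
    have x: "x \<noteq> 0" using level[OF VR] by simp
    have "ennreal (\<epsilon> * measure lborel ?E) * (\<integral>\<^sup>+y. u y \<partial>uniform_measure lborel ?E)
        = ennreal \<epsilon> * (ennreal (measure lborel ?E) * ((\<integral>\<^sup>+y. u y * indicator ?E y \<partial>lborel) / ennreal (measure lborel ?E)))"
      using \<epsilon> by (simp add: nn_integral_uniform_measure E_fin ennreal_mult mult.assoc)
    also have "\<dots> = ennreal \<epsilon> * (\<integral>\<^sup>+y. u y * indicator ?E y \<partial>lborel)"
    proof -
      have cancel: "ennreal c * (X / ennreal c) = X" if "0 < c" for c X
        using that ennreal_mult_divide_eq[of "ennreal c" X]
        by (simp add: ennreal_times_divide mult.commute[of "ennreal c"])
      show ?thesis unfolding cancel[OF E_pos] ..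
    qed
    also have "\<dots> = (\<integral>\<^sup>+y. ennreal \<epsilon> * (u y * indicator ?E y) \<partial>lborel)"
      by (rule nn_integral_cmult[symmetric]) measurable
    also have "\<dots> \<le> (\<integral>\<^sup>+y. ennreal (q x y * a x y) * u y \<partial>lborel)"
      using lower[OF VR] by (intro nn_integral_mono) (auto simp: indicator_def intro!: mult_right_mono ennreal_leI)
    also have "\<dots> \<le> (\<integral>\<^sup>+y. u y \<partial>P x)"
      by (simp add: nn_integral_P[OF x])
    finally show "ennreal (\<epsilon> * measure lborel ?E) * (\<integral>\<^sup>+y. u y \<partial>uniform_measure lborel ?E) \<le> (\<integral>\<^sup>+y. u y \<partial>P x)" .
  qed
qed

end

section \<open>Inversion in the unit sphere\<close>

text \<open>
  The change of variables theorem of HOL-Analysis needs a well-ordered index type, while the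
  dimension here is an arbitrary finite type. Hence the computation is carried out over a
  well-ordered copy of the index type and transported back.
\<close>

typedef 'a enumerated = "UNIV :: 'a set" by auto

instance enumerated :: (finite) finite
proof
  have "(UNIV :: 'a enumerated set) = range Abs_enumerated"
    by (metis Abs_enumerated_cases surj_def)
  then show "finite (UNIV :: 'a enumerated set)" by (metis finite finite_imageI)
qed

instantiation enumerated :: (finite) wellorder
begin

definition "x \<le> y \<longleftrightarrow> to_nat_on UNIV (Rep_enumerated x) \<le> to_nat_on UNIV (Rep_enumerated y)"
definition "x < y \<longleftrightarrow> to_nat_on UNIV (Rep_enumerated x) < to_nat_on UNIV (Rep_enumerated y)"

instance
proof
  fix x y z :: "'a enumerated"
  show "x < y \<longleftrightarrow> x \<le> y \<and> \<not> y \<le> x" "x \<le> x" "x \<le> y \<Longrightarrow> y \<le> z \<Longrightarrow> x \<le> z" "x \<le> y \<or> y \<le> x"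
    by (auto simp: less_eq_enumerated_def less_enumerated_def)
  show "x \<le> y \<Longrightarrow> y \<le> x \<Longrightarrow> x = y"
    by (simp add: less_eq_enumerated_def Rep_enumerated_inject[symmetric] countable_finite)
next
  fix Q :: "'a enumerated \<Rightarrow> bool" and x
  assume *: "\<And>x. (\<And>y. y < x \<Longrightarrow> Q y) \<Longrightarrow> Q x"
  show "Q x"
    by (induct x rule: measure_induct_rule[of "\<lambda>x. to_nat_on UNIV (Rep_enumerated x)"])
      (rule *, simp add: less_enumerated_def)
qed

end

definition reindex :: "real ^ 'n enumerated \<Rightarrow> real ^ 'n" where
  "reindex v = (\<chi> i. v $ Abs_enumerated i)"

lemma bij_Abs_enumerated: "bij Abs_enumerated"
  by (metis Abs_enumerated_inverse Rep_enumerated_inverse UNIV_I bij_iff)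

lemma reindex_inner: "reindex v \<bullet> reindex w = v \<bullet> w"
  unfolding inner_vec_def reindex_def
  using sum.reindex_bij_betw[OF bij_Abs_enumerated, of "\<lambda>j. v $ j \<bullet> w $ j"] by simp

lemma norm_reindex: "norm (reindex v) = norm v"
  by (simp add: norm_eq_sqrt_inner reindex_inner)

lemma reindex_scaleR: "reindex (c *\<^sub>R v) = c *\<^sub>R reindex v"
  by (simp add: reindex_def vec_eq_iff)

lemma reindex_measurable [measurable]: "reindex \<in> borel_measurable borel"
  unfolding reindex_def[abs_def]
  by (intro borel_measurable_continuous_onI continuous_intros)

lemma prod_Basis_vec: "(\<Prod>b\<in>Basis. (x :: real ^ 'n) \<bullet> b) = (\<Prod>i\<in>UNIV. x $ i)"
proof -
  have B: "(Basis :: (real ^ 'n) set) = range (\<lambda>i. axis i 1)" by (auto simp: Basis_vec_def)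
  show ?thesis
    unfolding B by (subst prod.reindex) (auto simp: inj_on_def axis_eq_axis cart_eq_inner_axis)
qed

lemma distr_reindex: "distr lborel borel reindex = (lborel :: (real ^ 'n) measure)"
proof (rule lborel_eqI[symmetric])
  fix l u :: "real ^ 'n"
  assume le: "\<And>b. b \<in> Basis \<Longrightarrow> l \<bullet> b \<le> u \<bullet> b"
  let ?r = "\<lambda>x :: real ^ 'n. \<chi> j. x $ Rep_enumerated j"
  have le': "l $ i \<le> u $ i" for i
    using le[of "axis i 1"] by (simp add: cart_eq_inner_axis axis_in_Basis_iff)
  have all: "(\<forall>j. Q (Rep_enumerated j) j) \<longleftrightarrow> (\<forall>i. Q i (Abs_enumerated i))" for Q :: "'n \<Rightarrow> 'n enumerated \<Rightarrow> bool"
    by (metis Abs_enumerated_inverse Rep_enumerated_inverse UNIV_I)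
  have "reindex -` box l u = box (?r l) (?r u)"
    using all[of "\<lambda>i j. l $ i < x $ j \<and> x $ j < u $ i" for x]
    by (intro set_eqI) (simp add: mem_box_cart reindex_def)
  moreover have "?r l \<bullet> b \<le> ?r u \<bullet> b" if "b \<in> Basis" for b
    using that le' by (auto simp: Basis_vec_def inner_axis)
  ultimately have "emeasure (distr lborel borel reindex) (box l u) = ennreal (\<Prod>b\<in>Basis. (?r u - ?r l) \<bullet> b)"
    by (simp add: emeasure_distr)
  also have "(\<Prod>b\<in>Basis. (?r u - ?r l) \<bullet> b) = (\<Prod>b\<in>Basis. (u - l) \<bullet> b)"
    unfolding prod_Basis_vec
    using prod.reindex_bij_betw[OF bij_Abs_enumerated, of "\<lambda>j. (?r u - ?r l) $ j"] by (simp add: Abs_enumerated_inverse)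
  finally show "emeasure (distr lborel borel reindex) (box l u) = ennreal (\<Prod>b\<in>Basis. (u - l) \<bullet> b)" .
qed simp

text \<open>Default division sends the origin to itself, so this is an involution of the whole
  space.\<close>

definition inversion :: "'a::real_inner \<Rightarrow> 'a" where
  "inversion z = (1 / (z \<bullet> z)) *\<^sub>R z"

lemma inversion_inversion: "inversion (inversion z) = z"
  by (cases "z = 0") (auto simp: inversion_def)

lemma norm_inversion: "norm (inversion z) = 1 / norm z"
  by (cases "z = 0") (auto simp: inversion_def power2_norm_eq_inner[symmetric] power2_eq_square)

lemma inversion_measurable [measurable]:
  "(inversion :: 'a::euclidean_space \<Rightarrow> 'a) \<in> borel_measurable borel"
  unfolding inversion_def[abs_def] by measurable

text \<open>The derivative of the inversion at \<open>z\<close> is this reflection divided by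
  \<open>z \<bullet> z\<close>, so the Jacobian is \<open>(1 / norm z) ^ (2 * d)\<close>.\<close>

lemma orthogonal_transformation_reflection:
  fixes z :: "'a::euclidean_space"
  shows "orthogonal_transformation (\<lambda>k. k - (2 * (z \<bullet> k) / (z \<bullet> z)) *\<^sub>R z)"
proof (cases "z = 0")
  case False
  then have "z \<bullet> z \<noteq> 0" by simp
  moreover have "linear (\<lambda>k. k - (2 * (z \<bullet> k) / (z \<bullet> z)) *\<^sub>R z)"
    by (intro linearI) (simp_all add: inner_simps add_divide_distrib scaleR_left_distrib algebra_simps)
  ultimately show ?thesis
    unfolding orthogonal_transformation_def by (auto simp: inner_simps inner_commute field_simps)
next
  case True
  then show ?thesis by (simp add: orthogonal_transformation_id[unfolded id_def])
qed

lemma has_derivative_inversion: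
  fixes z :: "'a::euclidean_space"
  assumes z: "z \<noteq> 0"
  shows "(inversion has_derivative (\<lambda>k. (1 / (z \<bullet> z)) *\<^sub>R (k - (2 * (z \<bullet> k) / (z \<bullet> z)) *\<^sub>R z))) (at z within S)"
proof -
  have zz: "z \<bullet> z \<noteq> 0" using z by simp
  show ?thesis
    unfolding inversion_def[abs_def]
    by (rule derivative_eq_intros refl zz | simp)+
      (use zz in \<open>auto simp: fun_eq_iff inner_commute field_simps scaleR_diff_right power2_eq_square\<close>)
qed

lemma integral_inversion_wellorder:
  fixes f :: "real ^ 'm::{finite,wellorder} \<Rightarrow> real"
  assumes f: "integrable lborel f"
  shows "(\<integral>z. (1 / norm z) ^ (2 * CARD('m)) * f (inversion z) \<partial>lborel) = (\<integral>z. f z \<partial>lborel)"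
proof -
  let ?S = "- {0 :: real ^ 'm::_}"
  let ?D = "\<lambda>z :: real ^ 'm::_. \<lambda>k. (1 / (z \<bullet> z)) *\<^sub>R (k - (2 * (z \<bullet> k) / (z \<bullet> z)) *\<^sub>R z)"
  have fm [measurable]: "f \<in> borel_measurable borel" using f by auto
  have im: "inversion ` ?S = ?S"
  proof
    show "inversion ` ?S \<subseteq> ?S" by (auto simp: inversion_def)
    then show "?S \<subseteq> inversion ` ?S" using inversion_inversion by (metis image_iff subsetI image_subset_iff)
  qed
  have det: "\<bar>det (matrix (?D z))\<bar> = (1 / norm z) ^ (2 * CARD('m))" if "z \<noteq> 0" for z
  proof -
    let ?R = "\<lambda>k. k - (2 * (z \<bullet> k) / (z \<bullet> z)) *\<^sub>R z"
    have lin: "linear ?R" using orthogonal_transformation_reflection[of z] by (simp add: orthogonal_transformation_def)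
    have "matrix (?D z) = matrix ((*\<^sub>R) (1 / (z \<bullet> z)) \<circ> ?R)" by (simp add: o_def)
    also have "\<dots> = matrix ((*\<^sub>R) (1 / (z \<bullet> z))) ** matrix ?R"
      by (intro matrix_compose lin) simp
    finally show ?thesis
      using orthogonal_transformation_det[OF orthogonal_transformation_reflection[of z]]
      by (simp add: det_mul abs_mult power_mult power_abs power2_norm_eq_inner[symmetric] power_one_over)
  qed
  \<comment> \<open>The substitution rule is applied to functions with values in
    \<open>real ^ 1\<close>. Its equivalence transfers absolute integrability together with the
    value of the integral.\<close>
  have cov: "(\<lambda>z. \<bar>det (matrix (?D z))\<bar> *\<^sub>R (vec (f (inversion z)) :: real ^ 1)) absolutely_integrable_on ?S \<and>
      integral ?S (\<lambda>z. \<bar>det (matrix (?D z))\<bar> *\<^sub>R (vec (f (inversion z)) :: real ^ 1)) = b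
      \<longleftrightarrow> (\<lambda>z. vec (f z) :: real ^ 1) absolutely_integrable_on (inversion ` ?S) \<and> integral (inversion ` ?S) (\<lambda>z. vec (f z)) = b" for b
  proof (rule has_absolute_integral_change_of_variables)
    show "inj_on inversion ?S" by (metis inj_onI inversion_inversion)
  qed (auto intro: has_derivative_inversion)
  have set: "set_integrable lebesgue ?S g \<and> integral ?S g = (\<integral>z. g z \<partial>lborel)" if g: "integrable lborel g" for g :: "real ^ 'm::_ \<Rightarrow> real"
  proof -
    have "integrable lebesgue g" using g by (simp add: integrable_completion)
    then have 1: "set_integrable lebesgue ?S g"
      unfolding set_integrable_def by (intro integrable_mult_indicator) auto
    have "integral ?S g = (LINT z:?S|lebesgue. g z)"
      using set_lebesgue_integral_eq_integral(2)[OF 1] by simp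
    also have "\<dots> = (\<integral>z. g z \<partial>lebesgue)"
      unfolding set_lebesgue_integral_def
    proof (rule integral_cong_AE)
      have "AE z in lborel. z \<noteq> (0 :: real ^ 'm::_)" by (rule AE_lborel_singleton)
      then show "AE z in lebesgue. indicator ?S z *\<^sub>R g z = g z"
        by (intro AE_completion) (auto elim!: eventually_mono)
    qed (use 1 \<open>integrable lebesgue g\<close> in \<open>auto simp: set_integrable_def\<close>)
    also have "\<dots> = (\<integral>z. g z \<partial>lborel)" using g by (simp add: integral_completion)
    finally show ?thesis using 1 by simp
  qed
  let ?g = "\<lambda>z. (1 / norm z) ^ (2 * CARD('m)) * f (inversion z)"
  have v: "c *\<^sub>R (vec t :: real ^ 1) = vec (c * t)" for c t by (simp add: vec_eq_iff)
  have "set_integrable lebesgue ?S f \<and> integral ?S f = (\<integral>z. f z \<partial>lborel)"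
    by (rule set[OF f])
  then have "(\<lambda>z. \<bar>det (matrix (?D z))\<bar> * f (inversion z)) absolutely_integrable_on ?S \<and>
      integral ?S (\<lambda>z. \<bar>det (matrix (?D z))\<bar> * f (inversion z)) = (\<integral>z. f z \<partial>lborel)"
    using cov[of "vec (\<integral>z. f z \<partial>lborel)"] unfolding im v absolutely_integrable_on_1_iff integral_on_1_eq by simp
  moreover have "(\<lambda>z. \<bar>det (matrix (?D z))\<bar> * f (inversion z)) absolutely_integrable_on ?S \<longleftrightarrow> ?g absolutely_integrable_on ?S"
    unfolding set_integrable_def by (intro Bochner_Integration.integrable_cong) (auto simp: det indicator_def)
  moreover have "integral ?S (\<lambda>z. \<bar>det (matrix (?D z))\<bar> * f (inversion z)) = integral ?S ?g"
    by (intro Henstock_Kurzweil_Integration.integral_cong) (auto simp: det)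
  ultimately have 1: "set_integrable lebesgue ?S ?g" "integral ?S ?g = (\<integral>z. f z \<partial>lborel)" by auto
  have "integrable lebesgue (\<lambda>z. indicator ?S z *\<^sub>R ?g z)" using 1(1) by (simp add: set_integrable_def)
  also have "(\<lambda>z. indicator ?S z *\<^sub>R ?g z) = ?g" by (auto simp: indicator_def fun_eq_iff)
  finally have "integrable lborel ?g" by (simp add: integrable_completion)
  from set[OF this] 1(2) show ?thesis by simp
qed

lemma integral_inversion:
  fixes f :: "real ^ 'n \<Rightarrow> real"
  assumes f: "integrable lborel f"
  shows "(\<integral>z. (1 / norm z) ^ (2 * CARD('n)) * f (inversion z) \<partial>lborel) = (\<integral>z. f z \<partial>lborel)"
proof -
  have fm [measurable]: "f \<in> borel_measurable borel" using f by auto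
  have card: "CARD('n enumerated) = CARD('n)"
    by (rule bij_betw_same_card[OF bij_Abs_enumerated, symmetric])
  have tr: "(\<integral>z. g z \<partial>lborel) = (\<integral>v. g (reindex v) \<partial>lborel)" if [measurable]: "g \<in> borel_measurable borel" for g :: "real ^ 'n \<Rightarrow> real"
    by (subst distr_reindex[symmetric]) (simp add: integral_distr)
  have "integrable (distr lborel borel reindex) f" using f by (simp only: distr_reindex)
  then have "integrable lborel (\<lambda>v. f (reindex v))"
    by (subst (asm) integrable_distr_eq) auto
  from integral_inversion_wellorder[OF this] show ?thesis
    by (subst (1 2) tr) (auto simp: card norm_reindex inversion_def reindex_inner reindex_scaleR)
qed

section \<open>The limiting drift\<close>

text \<open>For \<open>t \<le> 1\<close> the two terms are \<open>sqrt t - t\<close> and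
  \<open>sqrt t - 1\<close>, whose sum is minus a square; the case \<open>t > 1\<close> follows by
  exchanging \<open>t\<close> and \<open>1 / t\<close>.\<close>

lemma flux_symmetrized:
  assumes "0 < t"
  shows "flux t + flux (1 / t) = - (1 - sqrt (min t (1 / t)))\<^sup>2"
proof -
  have *: "flux t + flux (1 / t) = - (1 - sqrt t)\<^sup>2" if "0 < t" "t \<le> 1" for t
    using that flux_cases(1)[of t] flux_cases(2)[of "1 / t"]
    by (simp add: power2_diff real_sqrt_divide)
  show ?thesis
  proof (cases "t \<le> 1")
    case True
    then have "t \<le> 1 / t" using assms by (simp add: field_simps mult_le_one)
    then show ?thesis using *[OF assms True] by (simp add: min_def)
  next
    case False
    then have "1 / t \<le> 1" "1 / t \<le> t" by (auto simp: field_simps intro: order_trans[of _ t])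
    then have "min t (1 / t) = 1 / t" by (simp add: min_absorb2)
    then show ?thesis using *[of "1 / t"] assms \<open>1 / t \<le> 1\<close> by simp
  qed
qed

lemma flux_tendsto:
  assumes "(f \<longlongrightarrow> t) F" "0 < t"
  shows "((\<lambda>x. flux (f x)) \<longlongrightarrow> flux t) F"
  unfolding flux_def using assms by (auto intro!: tendsto_intros)

text \<open>For a unit vector \<open>u\<close>, inversion divides
  \<open>mpcn_form \<rho> u z\<close> by the square of \<open>norm z\<close>. The resulting power in
  the density cancels the Jacobian.\<close>

lemma mpcn_density_inversion:
  fixes u z :: "real ^ 'n"
  assumes "z \<noteq> 0" "norm u = 1"
  shows "(1 / norm z) ^ (2 * CARD('n)) * mpcn_density \<rho> u (inversion z) = mpcn_density \<rho> u z"
proof -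
  have "mpcn_form \<rho> u (inversion z) = mpcn_form \<rho> u z / (norm z)\<^sup>2"
    unfolding mpcn_form_def norm_inversion using assms
    by (simp add: inversion_def power2_norm_eq_inner[symmetric] field_simps)
  then have "(1 / norm z)\<^sup>2 * (norm u / mpcn_form \<rho> u (inversion z)) = norm u / mpcn_form \<rho> u z"
    using assms by (simp add: field_simps)
  then show ?thesis
    by (simp add: mpcn_density_def power_mult power_mult_distrib[symmetric] mult.left_commute[of "_ ^ _"])
qed

text \<open>Reduces a limit in which norm and direction vary together to sequences, where dominated
  convergence applies.\<close>

lemma eventually_at_infinity_sequentially:
  fixes P :: "'a::real_normed_vector \<Rightarrow> bool"
  assumes "\<And>X. (\<And>n. X n \<noteq> 0) \<Longrightarrow> filterlim (\<lambda>n. norm (X n)) at_top sequentially \<Longrightarrow> eventually (\<lambda>n. P (X n)) sequentially"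
  shows "eventually P at_infinity"
proof (rule ccontr)
  assume "\<not> eventually P at_infinity"
  then have "\<exists>x. real n + 1 \<le> norm x \<and> \<not> P x" for n
    unfolding eventually_at_infinity by blast
  then obtain X where X: "\<And>n. real n + 1 \<le> norm (X n)" "\<And>n. \<not> P (X n)"
    by metis
  have "X n \<noteq> 0" for n using X(1)[of n] by auto
  moreover have "filterlim (\<lambda>n. norm (X n)) at_top sequentially"
  proof (rule filterlim_at_top_mono[OF filterlim_real_sequentially])
    show "eventually (\<lambda>n. real n \<le> norm (X n)) sequentially"
      using X(1) by (intro always_eventually allI) (metis add_increasing2 order_trans le_add_same_cancel1 zero_le_one)
  qed
  ultimately have "eventually (\<lambda>n. P (X n)) sequentially" by (rule assms)
  then show False using X(2) by simp
qed

section \<open>Bounds uniform in the direction, and the sign of the limiting drift\<close>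

context mpcn_target begin

text \<open>Bounds every density \<open>q u\<close> with \<open>norm u = 1\<close> from below, and
  up to the factor \<open>env_const\<close> from above. It serves both as a dominating function
  independent of the direction and as a uniform lower bound on proposal mass.\<close>

definition envelope :: "real ^ 'n \<Rightarrow> real" where
  "envelope z = mpcn_const \<rho> CARD('n) * (1 / (1 + norm z)\<^sup>2) ^ CARD('n)"

lemma envelope_pos: "0 < envelope z"
proof -
  have "0 < (1 + norm z)\<^sup>2" using norm_ge_zero[of z] by (intro zero_less_power) linarith
  then show ?thesis
    unfolding envelope_def using \<rho> by (intro mult_pos_pos zero_less_power mpcn_const_pos) auto
qed

lemma envelope_measurable [measurable]: "envelope \<in> borel_measurable borel"
  unfolding envelope_def[abs_def] by measurable

lemma q_lower:
  assumes "norm u = 1"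
  shows "envelope z \<le> q u z"
proof -
  have "0 < mpcn_form \<rho> u z" using assms \<rho> by (intro mpcn_form_pos) auto
  moreover have "mpcn_form \<rho> u z \<le> (1 + norm z)\<^sup>2"
    using mpcn_form_upper[of \<rho> u z] assms \<rho> by simp
  ultimately show ?thesis
    unfolding envelope_def mpcn_density_def assms
    using mpcn_const_pos[of "CARD('n)" \<rho>] \<rho> by (intro mult_left_mono power_mono frac_le) auto
qed

text \<open>The base comes from \<open>(1 + norm z) ^ 2 \<le> 2 * (1 + (norm z) ^ 2)\<close> and the
  lower bound \<open>1 - sqrt \<rho>\<close> for the form.\<close>

definition env_const :: real where
  "env_const = (2 / (1 - sqrt \<rho>)) ^ CARD('n)"

lemma env_const_pos: "0 < env_const"
  using \<rho> by (simp add: env_const_def)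

lemma q_upper:
  assumes "norm u = 1"
  shows "q u z \<le> env_const * envelope z"
proof -
  have Fp: "0 < mpcn_form \<rho> u z" using assms \<rho> by (intro mpcn_form_pos) auto
  have s: "0 < 1 - sqrt \<rho>" using \<rho> by simp
  have N: "0 < (1 + norm z)\<^sup>2" using norm_ge_zero[of z] by (intro zero_less_power) linarith
  have "(1 + norm z)\<^sup>2 \<le> 2 * (1 + (norm z)\<^sup>2)"
    using sum_squares_bound[of 1 "norm z"] by (simp add: power2_sum)
  then have "(1 - sqrt \<rho>) * (1 + norm z)\<^sup>2 \<le> (1 - sqrt \<rho>) * (2 * (1 + (norm z)\<^sup>2))"
    using s by (intro mult_left_mono) auto
  moreover have "(1 - sqrt \<rho>) * (1 + (norm z)\<^sup>2) \<le> mpcn_form \<rho> u z"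
    using mpcn_form_lower[of \<rho> u z] assms \<rho> by simp
  ultimately have "(1 - sqrt \<rho>) * (1 + norm z)\<^sup>2 \<le> 2 * mpcn_form \<rho> u z"
    by linarith
  then have "(1 - sqrt \<rho>) / 2 * (1 + norm z)\<^sup>2 \<le> mpcn_form \<rho> u z" by simp
  then have "1 / mpcn_form \<rho> u z \<le> 1 / ((1 - sqrt \<rho>) / 2 * (1 + norm z)\<^sup>2)"
    using s N Fp by (intro divide_left_mono mult_pos_pos) auto
  also have "\<dots> = 2 / (1 - sqrt \<rho>) * (1 / (1 + norm z)\<^sup>2)" by simp
  finally have "(1 / mpcn_form \<rho> u z) ^ CARD('n) \<le> (2 / (1 - sqrt \<rho>) * (1 / (1 + norm z)\<^sup>2)) ^ CARD('n)"
    using Fp by (intro power_mono) (auto simp: less_imp_le)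
  then have "mpcn_const \<rho> CARD('n) * (1 / mpcn_form \<rho> u z) ^ CARD('n)
     \<le> mpcn_const \<rho> CARD('n) * ((2 / (1 - sqrt \<rho>)) ^ CARD('n) * (1 / (1 + norm z)\<^sup>2) ^ CARD('n))"
    unfolding power_mult_distrib using mpcn_const_pos[of "CARD('n)" \<rho>] \<rho> by (intro mult_left_mono) auto
  then show ?thesis
    by (simp add: mpcn_density_def assms envelope_def env_const_def ac_simps)
qed

lemma envelope_integrable: "integrable lborel envelope"
proof (rule Bochner_Integration.integrable_bound)
  have n: "norm (axis undefined 1 :: real ^ 'n) = 1" by simp
  show "integrable lborel (q (axis undefined 1))" using n by (intro q_integrable) (metis norm_zero zero_neq_one)
  show "AE z in lborel. norm (envelope z) \<le> norm (q (axis undefined 1) z)"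
    using q_lower[OF n] envelope_pos q_nonneg by (simp add: less_imp_le)
qed simp

text \<open>Averaging the integral with its image under inversion replaces the integrand, whose sign
  varies, by \<open>- g / 2\<close> with \<open>g \<ge> 0\<close>. The lower envelope then bounds
  the result away from 0 simultaneously for all directions.\<close>

lemma limit_drift_negative:
  assumes c: "c \<noteq> 0"
  obtains \<eta> where "0 < \<eta>" "\<And>u. norm u = 1 \<Longrightarrow> (\<integral>z. q u z * flux (norm z powr c) \<partial>lborel) \<le> - \<eta>"
proof -
  define g where "g z = (1 - sqrt (min (norm z powr c) (1 / norm z powr c)))\<^sup>2" for z :: "real ^ 'n"
  have [measurable]: "g \<in> borel_measurable borel" unfolding g_def[abs_def] by measurable
  have g01: "0 \<le> g z" "g z \<le> 1" for z
  proof -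
    let ?m = "min (norm z powr c) (1 / norm z powr c)"
    show "0 \<le> g z" by (simp add: g_def)
    have "0 \<le> ?m" "?m \<le> 1"
      by (auto simp: min_le_iff_disj divide_le_eq_1 not_le less_imp_le)
    then show "g z \<le> 1"
      unfolding g_def by (intro power_le_one) auto
  qed
  have ig: "integrable lborel (\<lambda>z. envelope z * g z)"
    using g01 envelope_pos by (intro Bochner_Integration.integrable_bound[OF envelope_integrable])
      (auto simp: abs_mult mult_left_le less_imp_le)
  define \<eta> where "\<eta> = (\<integral>z. envelope z * g z \<partial>lborel) / 2"
  have "0 \<le> (\<integral>z. envelope z * g z \<partial>lborel)"
    using g01 envelope_pos by (intro Bochner_Integration.integral_nonneg) (auto simp: less_imp_le)
  moreover have "(\<integral>z. envelope z * g z \<partial>lborel) \<noteq> 0"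
  proof
    assume "(\<integral>z. envelope z * g z \<partial>lborel) = 0"
    then have "AE z in lborel. envelope z * g z = 0"
      using g01 envelope_pos by (subst (asm) integral_nonneg_eq_0_iff_AE[OF ig]) (auto simp: less_imp_le)
    \<comment> \<open>On this ball \<open>norm z\<close> lies strictly between 1/4 and 3/4, so
      \<open>norm z powr c\<close> differs from 1 and \<open>g z\<close> is positive.\<close>
    then have "AE z in lborel. z \<notin> ball ((1/2) *\<^sub>R axis undefined 1 :: real ^ 'n) (1/4)"
    proof eventually_elim
      case (elim z)
      show ?case
      proof
        assume "z \<in> ball ((1/2) *\<^sub>R axis undefined 1) (1/4)"
        then have "norm z < 3/4" "1/4 < norm z"
          using norm_triangle_ineq2[of "(1/2) *\<^sub>R axis undefined 1 :: real ^ 'n" z] norm_triangle_ineq2[of z "(1/2) *\<^sub>R axis undefined 1 :: real ^ 'n"]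
          by (auto simp: dist_norm norm_minus_commute)
        then have "norm z powr c \<noteq> 1" "0 < norm z powr c"
          using c by (auto simp: powr_def)
        then have "g z \<noteq> 0"
          by (auto simp: g_def min_def split: if_splits)
        then show False using elim envelope_pos[of z] by simp
      qed
    qed
    then have "emeasure lborel (ball ((1/2) *\<^sub>R axis undefined 1 :: real ^ 'n) (1/4)) = 0"
      by (subst (asm) AE_iff_measurable[OF _ refl]) (auto simp: ball_def)
    then show False
      using content_ball_pos[of "1/4" "(1/2) *\<^sub>R axis undefined 1 :: real ^ 'n"] by (simp add: measure_def)
  qed
  ultimately have \<eta>: "0 < \<eta>" by (simp add: \<eta>_def)
  show ?thesis
  proof (rule that[OF \<eta>])
    fix u :: "real ^ 'n" assume u: "norm u = 1"
    then have u0: "u \<noteq> 0" by auto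
    have i1: "integrable lborel (\<lambda>z. q u z * flux (norm z powr c))"
      by (intro q_bounded_integrable[OF u0, of _ 1] flux_bounded) auto
    have i2: "integrable lborel (\<lambda>z. q u z * flux (1 / norm z powr c))"
      by (intro q_bounded_integrable[OF u0, of _ 1] flux_bounded) auto
    have ig': "integrable lborel (\<lambda>z. q u z * g z)"
      using g01 by (intro q_bounded_integrable[OF u0, of _ 1]) auto
    have nz: "AE z in lborel. z \<noteq> (0 :: real ^ 'n)" by (rule AE_lborel_singleton)
    have "(\<integral>z. q u z * flux (norm z powr c) \<partial>lborel)
      = (\<integral>z. (1 / norm z) ^ (2 * CARD('n)) * (q u (inversion z) * flux (norm (inversion z) powr c)) \<partial>lborel)"
      by (rule integral_inversion[OF i1, symmetric])
    also have "\<dots> = (\<integral>z. q u z * flux (1 / norm z powr c) \<partial>lborel)"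
    proof (rule integral_cong_AE)
      show "AE z in lborel. (1 / norm z) ^ (2 * CARD('n)) * (q u (inversion z) * flux (norm (inversion z) powr c))
        = q u z * flux (1 / norm z powr c)"
        using nz
      proof eventually_elim
        case (elim z)
        show ?case
          using mpcn_density_inversion[OF elim u, of \<rho>] by (simp add: norm_inversion powr_divide mult.assoc[symmetric])
      qed
    qed (unfold mpcn_density_def mpcn_form_def, measurable)
    finally have "2 * (\<integral>z. q u z * flux (norm z powr c) \<partial>lborel)
        = (\<integral>z. q u z * flux (norm z powr c) + q u z * flux (1 / norm z powr c) \<partial>lborel)"
      using i1 i2 by simp
    also have "\<dots> = (\<integral>z. - (q u z * g z) \<partial>lborel)"
    proof (rule integral_cong_AE)
      show "AE z in lborel. q u z * flux (norm z powr c) + q u z * flux (1 / norm z powr c) = - (q u z * g z)"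
        using nz
      proof eventually_elim
        case (elim z)
        have "flux (norm z powr c) + flux (1 / norm z powr c) = - g z"
          unfolding g_def using elim by (intro flux_symmetrized) simp
        then show ?case by (simp add: distrib_left[symmetric])
      qed
    qed (unfold mpcn_density_def mpcn_form_def, measurable)
    also have "\<dots> = - (\<integral>z. q u z * g z \<partial>lborel)" by simp
    also have "\<dots> \<le> - (\<integral>z. envelope z * g z \<partial>lborel)"
      using q_lower[OF u] g01 by (intro le_imp_neg_le integral_mono ig ig' mult_right_mono) auto
    finally show "(\<integral>z. q u z * flux (norm z powr c) \<partial>lborel) \<le> - \<eta>"
      by (simp add: \<eta>_def)
  qed
qed

lemma norm_sgn_1: "x \<noteq> 0 \<Longrightarrow> norm (sgn x) = 1" for x :: "real ^ 'n"
  by (simp add: norm_sgn)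

text \<open>The direction \<open>sgn (X n)\<close> need not converge. The error made by replacing
  the ratio with its limit is bounded by an integral against \<open>envelope\<close>, which is free
  of the direction, and the limiting drift is bounded for every direction at once.\<close>

lemma D_sequence_negative:
  fixes X :: "nat \<Rightarrow> real ^ 'n"
  assumes X: "\<And>n. X n \<noteq> 0" and c: "c \<noteq> 0"
    and lim: "\<And>z. z \<noteq> 0 \<Longrightarrow> (\<lambda>n. h (norm (X n) *\<^sub>R z) / h (X n)) \<longlonglongrightarrow> norm z powr c"
    and \<eta>: "0 < \<eta>" "\<And>u. norm u = 1 \<Longrightarrow> (\<integral>z. q u z * flux (norm z powr c) \<partial>lborel) \<le> - \<eta>"
  shows "eventually (\<lambda>n. D (X n) \<le> - (\<eta> / 2)) sequentially"
proof -
  let ?f = "\<lambda>n z. flux (h (norm (X n) *\<^sub>R z) / h (X n))" and ?l = "\<lambda>z. flux (norm z powr c)"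
  have f1: "\<bar>?f n z\<bar> \<le> 1" for n z by (intro flux_bounded) (simp add: h_nonneg)
  have l1: "\<bar>?l z\<bar> \<le> 1" for z by (intro flux_bounded) simp
  let ?s = "\<lambda>n z. env_const * envelope z * \<bar>?f n z - ?l z\<bar>"
  let ?w = "\<lambda>z. 2 * (env_const * envelope z)"
  have iw: "integrable lborel ?w" using envelope_integrable by simp
  have sw: "norm (?s n z) \<le> ?w z" for n z
  proof -
    have "\<bar>?f n z - ?l z\<bar> \<le> 2" using f1[of n z] l1[of z] by linarith
    then have "env_const * envelope z * \<bar>?f n z - ?l z\<bar> \<le> env_const * envelope z * 2"
      using envelope_pos[of z] env_const_pos by (intro mult_left_mono) auto
    then show ?thesis using envelope_pos[of z] env_const_pos by (simp add: abs_mult)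
  qed
  have iS: "integrable lborel (?s n)" for n
  proof (rule Bochner_Integration.integrable_bound[OF iw])
    show "AE z in lborel. norm (?s n z) \<le> norm (?w z)"
      using order_trans[OF sw abs_ge_self] by (intro always_eventually allI) (simp only: real_norm_def)
  qed simp
  have "(\<lambda>n. \<integral>z. ?s n z \<partial>lborel) \<longlonglongrightarrow> (\<integral>z. 0 \<partial>(lborel :: (real ^ 'n) measure))"
  proof (rule integral_dominated_convergence[OF _ _ iw])
    have "AE z in lborel. z \<noteq> (0 :: real ^ 'n)" by (rule AE_lborel_singleton)
    then show "AE z in lborel. (\<lambda>n. ?s n z) \<longlonglongrightarrow> 0"
    proof eventually_elim
      case (elim z)
      have "(\<lambda>n. ?f n z) \<longlonglongrightarrow> ?l z" using lim[OF elim] elim by (intro flux_tendsto) auto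
      then have "(\<lambda>n. env_const * envelope z * \<bar>?f n z - ?l z\<bar>) \<longlonglongrightarrow> env_const * envelope z * \<bar>?l z - ?l z\<bar>"
        by (intro tendsto_intros)
      then show ?case by simp
    qed
    show "AE z in lborel. norm (?s n z) \<le> ?w z" for n using sw by simp
  qed measurable
  then have "(\<lambda>n. \<integral>z. ?s n z \<partial>lborel) \<longlonglongrightarrow> 0" by simp
  then have "eventually (\<lambda>n. (\<integral>z. ?s n z \<partial>lborel) < \<eta> / 2) sequentially"
    using \<eta> by (intro order_tendstoD) auto
  then show ?thesis
  proof eventually_elim
    case (elim n)
    let ?u = "sgn (X n)"
    have u: "norm ?u = 1" using X by (rule norm_sgn_1)
    then have u0: "?u \<noteq> 0" by auto
    have i1: "integrable lborel (\<lambda>z. q ?u z * ?f n z)" using f1 by (intro q_bounded_integrable[OF u0, of _ 1]) auto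
    have i2: "integrable lborel (\<lambda>z. q ?u z * ?l z)" using l1 by (intro q_bounded_integrable[OF u0, of _ 1]) auto
    have D: "D (X n) = (\<integral>z. q ?u z * ?l z \<partial>lborel) + (\<integral>z. q ?u z * ?f n z - q ?u z * ?l z \<partial>lborel)"
      using i1 i2 by (simp add: D_def)
    have diff: "(\<integral>z. q ?u z * ?f n z - q ?u z * ?l z \<partial>lborel) \<le> (\<integral>z. ?s n z \<partial>lborel)"
    proof (rule integral_mono)
      fix z
      have "q ?u z * (?f n z - ?l z) \<le> q ?u z * \<bar>?f n z - ?l z\<bar>"
        using q_nonneg by (intro mult_left_mono) auto
      also have "\<dots> \<le> ?s n z" using q_upper[OF u] by (intro mult_right_mono) auto
      finally show "q ?u z * ?f n z - q ?u z * ?l z \<le> ?s n z" by (simp add: right_diff_distrib)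
    qed (intro Bochner_Integration.integrable_diff i1 i2 iS)+
    have "- (\<eta> / 2) = - \<eta> + \<eta> / 2" by simp
    then show ?case
      unfolding D using add_mono[OF \<eta>(2)[OF u] order_trans[OF diff less_imp_le[OF elim]]] by (simp only:)
  qed
qed

text \<open>Near the origin \<open>\<pi>\<close> is almost constant, so the limiting exponent is the
  dimension. This half of the drift condition is common to both tail classes.\<close>

lemma D_at_0: obtains \<eta> where "0 < \<eta>" "eventually (\<lambda>x. D x \<le> - \<eta>) (at 0)"
proof -
  obtain \<eta> where \<eta>: "0 < \<eta>" "\<And>u. norm u = 1 \<Longrightarrow> (\<integral>z. q u z * flux (norm z powr real CARD('n)) \<partial>lborel) \<le> - \<eta>"
    using limit_drift_negative[of "real CARD('n)"] by auto
  have "eventually (\<lambda>x. D x \<le> - (\<eta> / 2)) (at 0)"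
  proof (rule sequentially_imp_eventually_at, clarify)
    fix X :: "nat \<Rightarrow> real ^ 'n"
    assume X: "\<forall>n. X n \<noteq> 0" and X0: "X \<longlonglongrightarrow> 0"
    have \<pi>c: "isCont \<pi> x" for x using \<pi>_cont by (simp add: continuous_on_eq_continuous_at)
    show "eventually (\<lambda>n. D (X n) \<le> - (\<eta> / 2)) sequentially"
    proof (rule D_sequence_negative[OF _ _ _ \<eta>])
      fix z :: "real ^ 'n" assume z: "z \<noteq> 0"
      have "(\<lambda>n. norm (X n) *\<^sub>R z) \<longlonglongrightarrow> 0"
        using tendsto_scaleR[OF tendsto_norm[OF X0] tendsto_const[of z]] by simp
      then have "(\<lambda>n. \<pi> (norm (X n) *\<^sub>R z) / \<pi> (X n) * norm z ^ CARD('n)) \<longlonglongrightarrow> \<pi> 0 / \<pi> 0 * norm z ^ CARD('n)"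
        using isCont_tendsto_compose[OF \<pi>c[of 0]] X0 \<pi>_pos[of 0] by (intro tendsto_intros) auto
      then show "(\<lambda>n. h (norm (X n) *\<^sub>R z) / h (X n)) \<longlonglongrightarrow> norm z powr real CARD('n)"
        using X z \<pi>_pos[of 0] by (simp add: h_def power_mult_distrib powr_realpow)
    qed (use X in auto)
  qed
  then show ?thesis using \<eta> by (intro that[of "\<eta> / 2"]) auto
qed

text \<open>If \<open>\<pi>\<close> is at least \<open>\<pi> x / 2\<close> on a ball of radius proportional to \<open>norm x\<close>, then \<open>h x\<close> is
  bounded by a multiple of the mass of that ball, which escapes to infinity.\<close>

lemma h_tendsto_0:
  assumes \<kappa>: "0 < \<kappa>" "\<kappa> \<le> 1 / 4"
    and low: "\<And>x z. R \<le> norm x \<Longrightarrow> z \<in> ball ((1 / 2) *\<^sub>R sgn x) \<kappa> \<Longrightarrow> \<pi> x \<le> 2 * \<pi> (norm x *\<^sub>R z)"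
  shows "(h \<longlongrightarrow> 0) at_infinity"
proof (rule tendstoI)
  fix e :: real assume e: "0 < e"
  interpret T: prob_space target by (rule prob_target)
  \<comment> \<open>Chosen so that \<open>\<pi> x / 2\<close> times the volume of the ball around
    \<open>x / 2\<close> of radius \<open>\<kappa> * norm x\<close> equals
    \<open>c * h x\<close>.\<close>
  define c where "c = measure lborel (ball (0 :: real ^ 'n) 1) * \<kappa> ^ CARD('n) / 2"
  have c: "0 < c" using \<kappa> content_ball_pos[of 1 "0 :: real ^ 'n"] by (simp add: c_def)
  let ?A = "\<lambda>n. {y :: real ^ 'n. real n \<le> norm y}"
  have "(\<lambda>n. measure target (?A n)) \<longlonglongrightarrow> measure target (\<Inter>n. ?A n)"
    by (intro T.finite_Lim_measure_decseq) (auto simp: decseq_def)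
  also have "(\<Inter>n. ?A n) = {}"
  proof (rule equals0I)
    fix y assume y: "y \<in> (\<Inter>n. ?A n)"
    obtain n where n: "norm y < real n" using reals_Archimedean2 by blast
    have "real n \<le> norm y" using y by blast
    with n show False by simp
  qed
  finally have "(\<lambda>n. measure target (?A n)) \<longlonglongrightarrow> 0" by simp
  then have "eventually (\<lambda>n. measure target (?A n) < c * e) sequentially"
    using c e by (intro order_tendstoD) auto
  then obtain n where n: "measure target (?A n) < c * e"
    by (auto simp: eventually_sequentially)
  \<comment> \<open>The factor 4 places that ball in \<open>?A n\<close>: its points have norm at
    least \<open>norm x / 4\<close>, because \<open>\<kappa> \<le> 1 / 4\<close>.\<close>
  have "h x < e" if x: "max (max R 1) (4 * real n) \<le> norm x" for x
  proof -
    have x0: "0 < norm x" "R \<le> norm x" "4 * real n \<le> norm x" using x by auto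
    let ?B = "ball ((1 / 2) *\<^sub>R x) (\<kappa> * norm x)"
    have cB: "measure lborel ?B = norm x ^ CARD('n) * \<kappa> ^ CARD('n) * measure lborel (ball (0 :: real ^ 'n) 1)"
      using \<kappa> x0 by (simp add: content_ball power_mult_distrib)
    have B: "?B \<subseteq> ?A n"
    proof
      fix y assume "y \<in> ?B"
      then have "norm ((1 / 2) *\<^sub>R x - y) < \<kappa> * norm x" by (simp add: dist_norm)
      moreover have "\<kappa> * norm x \<le> 1 / 4 * norm x" using \<kappa> by (intro mult_right_mono) auto
      moreover have "norm ((1 / 2) *\<^sub>R x) - norm y \<le> norm ((1 / 2) *\<^sub>R x - y)" by (rule norm_triangle_ineq2)
      ultimately show "y \<in> ?A n" using x0(3) by simp
    qed
    have low': "\<pi> x / 2 \<le> \<pi> y" if "y \<in> ?B" for y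
    proof -
      have "(1 / 2) *\<^sub>R sgn x - y /\<^sub>R norm x = ((1 / 2) *\<^sub>R x - y) /\<^sub>R norm x"
        by (simp add: sgn_div_norm scaleR_diff_right)
      then have "dist ((1 / 2) *\<^sub>R sgn x) (y /\<^sub>R norm x) = dist ((1 / 2) *\<^sub>R x) y / norm x"
        by (simp only: dist_norm norm_scaleR abs_inverse abs_norm_cancel divide_inverse_commute)
      also have "\<dots> < \<kappa>" using that x0 by (simp add: pos_divide_less_eq)
      finally have "\<pi> x \<le> 2 * \<pi> (norm x *\<^sub>R (y /\<^sub>R norm x))" using x0 by (intro low) auto
      then show ?thesis using x0 by simp
    qed
    have "ennreal (\<pi> x / 2 * measure lborel ?B) = ennreal (\<pi> x / 2) * ennreal (measure lborel ?B)"
      using \<pi>_pos[of x] by (intro ennreal_mult) auto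
    also have "\<dots> = (\<integral>\<^sup>+y. ennreal (\<pi> x / 2) * indicator ?B y \<partial>lborel)"
      using emeasure_lborel_ball_finite[of "(1 / 2) *\<^sub>R x" "\<kappa> * norm x"]
      by (simp add: nn_integral_cmult_indicator emeasure_eq_ennreal_measure)
    also have "\<dots> \<le> (\<integral>\<^sup>+y. ennreal (\<pi> y) * indicator (?A n) y \<partial>lborel)"
      using low' B by (intro nn_integral_mono) (auto simp: indicator_def intro!: ennreal_leI)
    also have "\<dots> = emeasure target (?A n)" by (simp add: emeasure_density)
    also have "\<dots> = ennreal (measure target (?A n))" by (rule T.emeasure_eq_measure)
    finally have "\<pi> x / 2 * measure lborel ?B \<le> measure target (?A n)"
      by (subst (asm) ennreal_le_iff) auto
    moreover have "\<pi> x / 2 * measure lborel ?B = c * h x"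
      unfolding cB by (simp add: c_def h_def)
    ultimately have "c * h x < c * e" using n by linarith
    then show ?thesis using c by simp
  qed
  then show "eventually (\<lambda>x. dist (h x) 0 < e) at_infinity"
    unfolding eventually_at_infinity using h_nonneg by (intro exI[of _ "max (max R 1) (4 * real n)"]) auto
qed

end

section \<open>Heavy tails\<close>

lemma uniform_limit_compact:
  fixes f :: "real \<Rightarrow> 'a::real_normed_vector \<Rightarrow> real"
  assumes loc: "\<And>x. x \<noteq> 0 \<Longrightarrow> \<exists>U. open U \<and> x \<in> U \<and> 0 \<notin> U \<and> uniform_limit U f l at_top"
    and C: "compact C" "0 \<notin> C"
  shows "uniform_limit C f l at_top"
proof (rule uniform_limitI)
  fix e :: real assume e: "0 < e"
  obtain U where U: "\<And>x. x \<in> C \<Longrightarrow> open (U x) \<and> x \<in> U x \<and> uniform_limit (U x) f l at_top"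
    using loc C(2) by metis
  obtain F where F: "F \<subseteq> C" "finite F" "C \<subseteq> (\<Union>x\<in>F. U x)"
    using compactE_image[OF C(1), of C U] U by (metis UN_iff subsetI)
  have "eventually (\<lambda>r. \<forall>x\<in>F. \<forall>y\<in>U x. dist (f r y) (l y) < e) at_top"
    using F U e by (intro eventually_ball_finite ballI uniform_limitD) auto
  then show "eventually (\<lambda>r. \<forall>y\<in>C. dist (f r y) (l y) < e) at_top"
    by eventually_elim (use F(3) in blast)
qed

lemma norm_bounds_half_ball:
  fixes u z :: "'a::real_normed_vector"
  assumes "norm u = 1" "z \<in> ball ((1 / 2) *\<^sub>R u) \<kappa>" "\<kappa> \<le> 1 / 4"
  shows "1 / 4 \<le> norm z" "norm z \<le> 1"
proof -
  have "norm ((1 / 2) *\<^sub>R u) = 1 / 2" using assms(1) by simp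
  moreover have "norm ((1 / 2) *\<^sub>R u) - norm z \<le> norm ((1 / 2) *\<^sub>R u - z)" by (rule norm_triangle_ineq2)
  moreover have "norm z - norm ((1 / 2) *\<^sub>R u) \<le> norm ((1 / 2) *\<^sub>R u - z)"
    using norm_triangle_ineq2[of z "(1 / 2) *\<^sub>R u"] by (simp add: norm_minus_commute)
  moreover have "norm ((1 / 2) *\<^sub>R u - z) < \<kappa>" using assms(2) by (simp add: dist_norm)
  ultimately show "1 / 4 \<le> norm z" "norm z \<le> 1" using assms(3) by linarith+
qed

context mpcn_target begin

text \<open>Two applications of the hypothesis, at \<open>z\<close> and at \<open>sgn x\<close>,
  eliminate the reference direction \<open>diag_unit\<close>. The limiting exponent
  \<open>d - \<alpha>\<close> is nonzero, as the limiting drift lemma requires.\<close>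

theorem heavy_tailed_ergodic:
  assumes "heavy_tailed \<pi>"
  shows "geometrically_ergodic target P"
proof -
  let ?f = "\<lambda>r y. \<pi> (r *\<^sub>R y) / \<pi> (r *\<^sub>R diag_unit)"
  obtain \<alpha> where \<alpha>: "real CARD('n) < \<alpha>" and loc: "\<And>x. x \<noteq> 0 \<Longrightarrow>
      \<exists>U. open U \<and> x \<in> U \<and> 0 \<notin> U \<and> uniform_limit U ?f (\<lambda>y. norm y powr (- \<alpha>)) at_top"
    using assms unfolding heavy_tailed_def by blast
  let ?l = "\<lambda>y :: real ^ 'n. norm y powr (- \<alpha>)"
  have unif: "uniform_limit C ?f ?l at_top" if "compact C" "0 \<notin> C" for C
    using uniform_limit_compact[OF loc that] .
  have f_eq: "\<pi> (norm x *\<^sub>R z) / \<pi> x = ?f (norm x) z / ?f (norm x) (sgn x)" if "x \<noteq> 0" for x z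
    using that \<pi>_pos[of "norm x *\<^sub>R diag_unit"] by (simp add: sgn_div_norm)
  define c where "c = real CARD('n) - \<alpha>"
  have "c \<noteq> 0" using \<alpha> by (simp add: c_def)
  then obtain \<eta> where \<eta>: "0 < \<eta>" "\<And>u. norm u = 1 \<Longrightarrow> (\<integral>z. q u z * flux (norm z powr c) \<partial>lborel) \<le> - \<eta>"
    using limit_drift_negative by blast
  have D_inf: "eventually (\<lambda>x. D x \<le> - (\<eta> / 2)) at_infinity"
  proof (rule eventually_at_infinity_sequentially)
    fix X :: "nat \<Rightarrow> real ^ 'n"
    assume X: "\<And>n. X n \<noteq> 0" and lim: "filterlim (\<lambda>n. norm (X n)) at_top sequentially"
    show "eventually (\<lambda>n. D (X n) \<le> - (\<eta> / 2)) sequentially"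
    proof (rule D_sequence_negative[OF X \<open>c \<noteq> 0\<close> _ \<eta>])
      fix z :: "real ^ 'n" assume z: "z \<noteq> 0"
      have "((\<lambda>r. ?f r z) \<longlongrightarrow> ?l z) at_top"
        using tendsto_uniform_limitI[OF unif[of "{z}"], of z] z by simp
      then have 1: "(\<lambda>n. ?f (norm (X n)) z) \<longlonglongrightarrow> ?l z"
        by (rule filterlim_compose[OF _ lim])
      \<comment> \<open>Since \<open>sgn (X n)\<close> moves with \<open>n\<close>, a pointwise
        limit is not enough; uniformity on the unit sphere is used.\<close>
      have 2: "(\<lambda>n. ?f (norm (X n)) (sgn (X n))) \<longlonglongrightarrow> 1"
      proof (rule tendstoI)
        fix e :: real assume "0 < e"
        then have "eventually (\<lambda>r. \<forall>y\<in>sphere 0 1. dist (?f r y) (?l y) < e) at_top"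
          by (intro uniform_limitD unif) auto
        then have "eventually (\<lambda>n. \<forall>y\<in>sphere 0 1. dist (?f (norm (X n)) y) (?l y) < e) sequentially"
          using lim by (rule eventually_compose_filterlim)
        then show "eventually (\<lambda>n. dist (?f (norm (X n)) (sgn (X n))) 1 < e) sequentially"
        proof eventually_elim
          case (elim n)
          have n: "norm (sgn (X n)) = 1" using X by (rule norm_sgn_1)
          then have "sgn (X n) \<in> sphere 0 1" by simp
          with elim have "dist (?f (norm (X n)) (sgn (X n))) (?l (sgn (X n))) < e" by blast
          then show ?case by (simp only: n) simp
        qed
      qed
      have "(\<lambda>n. ?f (norm (X n)) z / ?f (norm (X n)) (sgn (X n)) * norm z ^ CARD('n)) \<longlonglongrightarrow> ?l z / 1 * norm z ^ CARD('n)"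
        by (intro tendsto_intros 1 2) simp
      also have "?l z / 1 * norm z ^ CARD('n) = norm z powr c"
        using z by (simp add: c_def powr_diff powr_minus powr_realpow divide_inverse)
      also have "(\<lambda>n. ?f (norm (X n)) z / ?f (norm (X n)) (sgn (X n)) * norm z ^ CARD('n))
          = (\<lambda>n. h (norm (X n) *\<^sub>R z) / h (X n))"
        unfolding f_eq[OF X, symmetric] using X by (simp add: h_def power_mult_distrib)
      finally show "(\<lambda>n. h (norm (X n) *\<^sub>R z) / h (X n)) \<longlonglongrightarrow> norm z powr c" .
    qed
  qed
  \<comment> \<open>The annulus contains the unit sphere and the ball around
    \<open>sgn x / 2\<close>. On that ball the limit is at least 1, and on the sphere it is 1, so an
    error of 1/4 gives a ratio of at least (3/4) / (5/4) = 3/5, more than the 1/2 required.\<close>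
  let ?C = "cball 0 1 - ball (0 :: real ^ 'n) (1 / 4)"
  have "eventually (\<lambda>r. \<forall>y\<in>?C. dist (?f r y) (?l y) < 1 / 4) at_top"
    by (intro uniform_limitD unif compact_diff) auto
  then obtain R where R: "\<And>r y. R \<le> r \<Longrightarrow> y \<in> ?C \<Longrightarrow> dist (?f r y) (?l y) < 1 / 4"
    unfolding eventually_at_top_linorder by blast
  have "(h \<longlongrightarrow> 0) at_infinity"
  proof (rule h_tendsto_0[of "1 / 4" "max 1 R"])
    fix x z :: "real ^ 'n"
    assume x: "max 1 R \<le> norm x" and z: "z \<in> ball ((1 / 2) *\<^sub>R sgn x) (1 / 4)"
    have x0: "x \<noteq> 0" using x by auto
    have u: "norm (sgn x) = 1" using x0 by (rule norm_sgn_1)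
    have nz: "1 / 4 \<le> norm z" "norm z \<le> 1" using norm_bounds_half_ball[OF u z] by auto
    have "1 powr (- \<alpha>) \<le> norm z powr (- \<alpha>)"
      using nz \<alpha> by (intro powr_mono2') auto
    then have "1 \<le> ?l z" by simp
    moreover have "z \<in> ?C" "sgn x \<in> ?C" "R \<le> norm x" using x nz u by auto
    then have "dist (?f (norm x) z) (?l z) < 1 / 4" "dist (?f (norm x) (sgn x)) (?l (sgn x)) < 1 / 4"
      using R by blast+
    moreover have "?l (sgn x) = 1" by (simp only: u) simp
    ultimately have b: "3 / 4 \<le> ?f (norm x) z" "?f (norm x) (sgn x) \<le> 5 / 4"
      unfolding dist_real_def by linarith+
    have pos: "0 < ?f (norm x) (sgn x)" using \<pi>_pos by simp
    have "3 / 4 / (5 / 4) \<le> ?f (norm x) z / ?f (norm x) (sgn x)"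
      by (rule frac_le[OF order_trans[OF _ b(1)] b(1) pos b(2)]) simp
    then have "3 / 5 \<le> \<pi> (norm x *\<^sub>R z) / \<pi> x" by (simp only: f_eq[OF x0]) simp
    then have "3 / 5 * \<pi> x \<le> \<pi> (norm x *\<^sub>R z)"
      using \<pi>_pos[of x] by (simp add: pos_le_divide_eq)
    then show "\<pi> x \<le> 2 * \<pi> (norm x *\<^sub>R z)" using \<pi>_pos[of x] by linarith
  qed auto
  moreover obtain \<eta>0 where "0 < \<eta>0" "eventually (\<lambda>x. D x \<le> - \<eta>0) (at 0)" by (rule D_at_0)
  moreover have "eventually (\<lambda>x. D x \<le> - min \<eta>0 (\<eta> / 2)) at_infinity"
    using D_inf by eventually_elim simp
  moreover have "eventually (\<lambda>x. D x \<le> - min \<eta>0 (\<eta> / 2)) (at 0)"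
    using calculation(3) by eventually_elim simp
  ultimately show ?thesis
    using \<eta>(1) by (intro geometric_ergodicity_criterion[of "min \<eta>0 (\<eta> / 2)"]) auto
qed

end

section \<open>Light tails\<close>

lemma GDERIV_gradient:
  fixes f :: "'a::euclidean_space \<Rightarrow> real"
  assumes "f differentiable (at x)"
  shows "GDERIV f x :> gradient f x"
proof -
  obtain f' where f': "(f has_derivative f') (at x)"
    using assms by (auto simp: differentiable_def)
  then have lin: "linear f'" by (rule has_derivative_linear)
  \<comment> \<open>The Riesz vector of the derivative. Together with uniqueness it gives meaning to
    the definite description in \<open>gradient\<close>.\<close>
  define G where "G = (\<Sum>b\<in>Basis. f' b *\<^sub>R b)"
  have "f' k = k \<bullet> G" for k
  proof -
    have "f' k = f' (\<Sum>b\<in>Basis. (k \<bullet> b) *\<^sub>R b)" by (simp add: euclidean_representation)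
    also have "\<dots> = (\<Sum>b\<in>Basis. (k \<bullet> b) * f' b)"
      by (simp add: linear_sum[OF lin] linear_scale[OF lin])
    also have "\<dots> = k \<bullet> G" by (simp add: G_def inner_sum_right ac_simps)
    finally show ?thesis .
  qed
  then have "f' = (\<lambda>k. k \<bullet> G)" by auto
  then have G: "GDERIV f x :> G" using f' by (simp add: gderiv_def)
  moreover have "G' = G" if "GDERIV f x :> G'" for G'
  proof -
    have "(\<lambda>k. k \<bullet> G') = (\<lambda>k. k \<bullet> G)"
      using G that unfolding gderiv_def by (rule has_derivative_unique[rotated])
    then have "(G' - G) \<bullet> G' = (G' - G) \<bullet> G" by metis
    then have "(G' - G) \<bullet> (G' - G) = 0" by (simp add: inner_diff_right)
    then show ?thesis by simp
  qed
  ultimately show ?thesis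
    unfolding gradient_def by (rule theI)
qed

lemma one_plus_norm_power2_pos: "0 < (1 + norm z)\<^sup>2"
  using norm_ge_zero[of z] by (intro zero_less_power) linarith

text \<open>The point is \<open>(1 - t) *\<^sub>R z + t *\<^sub>R u\<close> with
  \<open>z = (1 / 2) *\<^sub>R u + k\<close>: a segment from near \<open>u / 2\<close> to
  \<open>u\<close> that stays away from the origin.\<close>

lemma segment_norm_lower:
  fixes u k :: "'a::real_normed_vector"
  assumes u: "norm u = 1" and k: "norm k < \<kappa>" and \<kappa>: "\<kappa> \<le> 1 / 4" and t: "0 \<le> t" "t \<le> 1"
  shows "1 / 4 \<le> norm (((1 + t) / 2) *\<^sub>R u + (1 - t) *\<^sub>R k)"
proof -
  have "norm (((1 + t) / 2) *\<^sub>R u) - norm (- ((1 - t) *\<^sub>R k)) \<le> norm (((1 + t) / 2) *\<^sub>R u - (- ((1 - t) *\<^sub>R k)))"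
    by (rule norm_triangle_ineq2)
  then have 1: "(1 + t) / 2 - (1 - t) * norm k \<le> norm (((1 + t) / 2) *\<^sub>R u + (1 - t) *\<^sub>R k)"
    using u t by simp
  have "(1 - t) * norm k \<le> 1 * \<kappa>"
    using k t by (intro mult_mono) auto
  then have "(1 + t) / 2 - 1 * \<kappa> \<le> (1 + t) / 2 - (1 - t) * norm k" by (rule diff_left_mono)
  moreover have "1 / 4 \<le> (1 + t) / 2 - 1 * \<kappa>" using t \<kappa> by (simp add: add_divide_distrib)
  ultimately show ?thesis using 1 by (meson order_trans)
qed

text \<open>Here \<open>(1 / 2) *\<^sub>R u - k\<close> is the velocity of the segment and
  \<open>g\<close> stands for the normalised gradient at \<open>p\<close>. Since
  \<open>norm p \<ge> 1 / 4\<close>, curvature gives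
  \<open>p \<bullet> g \<le> - \<epsilon> / 4\<close>. Removing the contribution of
  \<open>k\<close>, at most \<open>\<epsilon> / 16\<close>, leaves
  \<open>u \<bullet> g \<le> - 3 * \<epsilon> / 16\<close>, whose half still outweighs
  \<open>k \<bullet> g\<close>.\<close>

lemma segment_derivative_nonpos:
  fixes u k g :: "'a::euclidean_space"
  assumes u: "norm u = 1" and k: "norm k < \<kappa>" and \<kappa>: "0 < \<kappa>" "\<kappa> \<le> 1 / 4" "\<kappa> \<le> \<epsilon> / 16" and t: "0 \<le> t" "t \<le> 1"
    and g: "norm g \<le> 1" and p: "p = ((1 + t) / 2) *\<^sub>R u + (1 - t) *\<^sub>R k" and pg: "p \<bullet> g \<le> - \<epsilon> * norm p"
  shows "((1 / 2) *\<^sub>R u - k) \<bullet> g \<le> 0"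
proof -
  have kg: "\<bar>k \<bullet> g\<bar> \<le> \<kappa>"
  proof -
    have "\<bar>k \<bullet> g\<bar> \<le> norm k * norm g" by (rule Cauchy_Schwarz_ineq2)
    also have "\<dots> \<le> \<kappa> * 1" using k g \<kappa> by (intro mult_mono) auto
    finally show ?thesis by simp
  qed
  have np: "1 / 4 \<le> norm p" unfolding p by (rule segment_norm_lower[OF u k \<kappa>(2) t])
  have "(1 - t) * (k \<bullet> g) \<ge> - \<kappa>"
  proof -
    have "(1 - t) * \<bar>k \<bullet> g\<bar> \<le> 1 * \<kappa>" using kg t by (intro mult_mono) auto
    moreover have "- ((1 - t) * \<bar>k \<bullet> g\<bar>) \<le> (1 - t) * (k \<bullet> g)"
      using t mult_left_mono[of "- \<bar>k \<bullet> g\<bar>" "k \<bullet> g" "1 - t"] by simp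
    ultimately show ?thesis by linarith
  qed
  moreover have "p \<bullet> g = (1 + t) / 2 * (u \<bullet> g) + (1 - t) * (k \<bullet> g)"
    by (simp add: p inner_add_left)
  moreover have "\<epsilon> * (1 / 4) \<le> \<epsilon> * norm p"
    using np \<kappa> by (intro mult_left_mono) auto
  ultimately have *: "(1 + t) / 2 * (u \<bullet> g) \<le> - (3 * \<epsilon> / 16)"
    using pg \<kappa> by linarith
  have "u \<bullet> g \<le> - (3 * \<epsilon> / 16)"
  proof (cases "0 \<le> u \<bullet> g")
    case True
    then have "0 \<le> (1 + t) / 2 * (u \<bullet> g)" using t by (intro mult_nonneg_nonneg) auto
    then show ?thesis using * \<kappa> by linarith
  next
    case False
    then have "1 * (u \<bullet> g) \<le> (1 + t) / 2 * (u \<bullet> g)" using t by (intro mult_right_mono_neg) auto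
    then show ?thesis using * by linarith
  qed
  then show "((1 / 2) *\<^sub>R u - k) \<bullet> g \<le> 0"
    using kg \<kappa> by (simp add: inner_diff_left)
qed

context mpcn_target begin

text \<open>\<open>ln \<pi>\<close> is nonincreasing along the segment from
  \<open>norm x *\<^sub>R z\<close> to \<open>x\<close>. The curvature condition controls the
  gradient against the radial direction of each point passed; a small \<open>\<kappa>\<close> keeps
  the direction of travel close enough to it.\<close>

lemma light_tailed_monotone:
  assumes diff: "\<And>x. \<pi> differentiable (at x)"
    and curv: "Limsup at_infinity (\<lambda>x. ereal ((x /\<^sub>R norm x) \<bullet>
          (gradient (\<lambda>z. ln (\<pi> z)) x /\<^sub>R norm (gradient (\<lambda>z. ln (\<pi> z)) x)))) < 0"
  obtains \<kappa> R where "0 < \<kappa>" "\<kappa> \<le> 1 / 4"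
    "\<And>x z. R \<le> norm x \<Longrightarrow> z \<in> ball ((1 / 2) *\<^sub>R sgn x) \<kappa> \<Longrightarrow> \<pi> x \<le> \<pi> (norm x *\<^sub>R z)"
proof -
  let ?g = "gradient (\<lambda>z. ln (\<pi> z))"
  obtain c where c: "Limsup at_infinity (\<lambda>x. ereal ((x /\<^sub>R norm x) \<bullet> (?g x /\<^sub>R norm (?g x)))) < ereal c" "ereal c < 0"
    using ereal_dense2[OF curv] by blast
  define \<epsilon> where "\<epsilon> = - c"
  have \<epsilon>: "0 < \<epsilon>" using c(2) by (simp add: \<epsilon>_def)
  have "eventually (\<lambda>x. (x /\<^sub>R norm x) \<bullet> (?g x /\<^sub>R norm (?g x)) < c) at_infinity"
    using Limsup_lessD[OF c(1)] by simp
  then obtain R where R: "\<And>x. R \<le> norm x \<Longrightarrow> (x /\<^sub>R norm x) \<bullet> (?g x /\<^sub>R norm (?g x)) < c"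
    unfolding eventually_at_infinity by blast
  define \<kappa> where "\<kappa> = min (1 / 4) (\<epsilon> / 16)"
  have \<kappa>: "0 < \<kappa>" "\<kappa> \<le> 1 / 4" "\<kappa> \<le> \<epsilon> / 16" using \<epsilon> by (auto simp: \<kappa>_def)
  show ?thesis
  proof (rule that[OF \<kappa>(1,2)])
    fix x z :: "real ^ 'n"
    \<comment> \<open>The factor 4 ensures that all points of the segment, of norm at least
      \<open>norm x / 4\<close>, lie in the region where the curvature bound holds.\<close>
    assume x: "max 1 (4 * R) \<le> norm x" and z: "z \<in> ball ((1 / 2) *\<^sub>R sgn x) \<kappa>"
    define u where "u = sgn x"
    define k where "k = z - (1 / 2) *\<^sub>R u"
    let ?r = "norm x"
    have x0: "x \<noteq> 0" "0 < ?r" using x by auto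
    have u: "norm u = 1" unfolding u_def using x0(1) by (rule norm_sgn_1)
    have k: "norm k < \<kappa>" using z by (simp add: k_def u_def dist_norm norm_minus_commute)
    have xu: "x = ?r *\<^sub>R u" using x0 by (simp add: u_def sgn_div_norm)
    define w where "w = (1 / 2) *\<^sub>R u - k"
    let ?p = "\<lambda>t. ((1 + t) / 2) *\<^sub>R u + (1 - t) *\<^sub>R k"
    define F where "F t = ln (\<pi> (?r *\<^sub>R ?p t))" for t
    have "F 1 \<le> F 0"
    proof (rule DERIV_nonpos_imp_nonincreasing[of 0 1 F])
      fix t :: real assume t: "0 \<le> t" "t \<le> 1"
      let ?y = "?r *\<^sub>R ?p t"
      have dln: "(\<lambda>z. ln (\<pi> z)) differentiable (at ?y)"
      proof -
        obtain f' where "(\<pi> has_derivative f') (at ?y)"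
          using diff[of ?y] unfolding differentiable_def by blast
        from has_derivative_ln[OF \<pi>_pos this]
        show ?thesis unfolding differentiable_def by blast
      qed
      from GDERIV_gradient[OF this] have "((\<lambda>z. ln (\<pi> z)) has_derivative (\<lambda>k. k \<bullet> ?g ?y)) (at ?y)"
        by (simp add: gderiv_def)
      moreover have "((\<lambda>t. ?r *\<^sub>R ?p t) has_derivative (\<lambda>s. s *\<^sub>R (?r *\<^sub>R w))) (at t)"
      proof -
        have "(\<lambda>t. ?r *\<^sub>R ?p t) = (\<lambda>t. ?r *\<^sub>R ((1 / 2) *\<^sub>R u + k) + t *\<^sub>R (?r *\<^sub>R w))"
          by (rule ext) (simp add: w_def scaleR_left_distrib scaleR_right_distrib scaleR_left_diff_distrib
            scaleR_right_diff_distrib add_divide_distrib mult.commute)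
        moreover have "((\<lambda>t. ?r *\<^sub>R ((1 / 2) *\<^sub>R u + k) + t *\<^sub>R (?r *\<^sub>R w)) has_derivative (\<lambda>s. s *\<^sub>R (?r *\<^sub>R w))) (at t)"
          by (auto intro!: derivative_eq_intros)
        ultimately show ?thesis by simp
      qed
      ultimately have "(F has_derivative (\<lambda>s. (s *\<^sub>R (?r *\<^sub>R w)) \<bullet> ?g ?y)) (at t)"
        unfolding F_def[abs_def] by (rule has_derivative_compose[rotated])
      then have der: "(F has_real_derivative (?r *\<^sub>R w) \<bullet> ?g ?y) (at t)"
      proof -
        have "(\<lambda>s. (s *\<^sub>R (?r *\<^sub>R w)) \<bullet> ?g ?y) = (*) ((?r *\<^sub>R w) \<bullet> ?g ?y)"
          by (simp add: fun_eq_iff)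
        then show ?thesis
          using \<open>(F has_derivative _) (at t)\<close> by (simp only: has_field_derivative_def)
      qed
      have "(?r *\<^sub>R w) \<bullet> ?g ?y \<le> 0"
      proof -
        \<comment> \<open>If the gradient vanishes then \<open>g = 0\<close>, and the factorisation
          \<open>gy\<close> remains valid.\<close>
        define g where "g = ?g ?y /\<^sub>R norm (?g ?y)"
        have g: "norm g \<le> 1" by (cases "?g ?y = 0") (simp_all add: g_def)
        have gy: "?g ?y = norm (?g ?y) *\<^sub>R g" by (cases "?g ?y = 0") (simp_all add: g_def)
        have lo: "1 / 4 \<le> norm (?p t)" by (rule segment_norm_lower[OF u k \<kappa>(2) t])
        then have "?r * (1 / 4) \<le> ?r * norm (?p t)" using x0 by (intro mult_left_mono) auto
        then have "?r * (1 / 4) \<le> norm ?y" by (simp only: norm_scaleR abs_norm_cancel)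
        moreover have "4 * R \<le> ?r" using x by simp
        ultimately have "R \<le> norm ?y" by linarith
        then have "(?y /\<^sub>R norm ?y) \<bullet> g < - \<epsilon>"
          using R[of ?y] by (simp add: g_def \<epsilon>_def)
        moreover have "?y /\<^sub>R norm ?y = ?p t /\<^sub>R norm (?p t)"
          using x0 by simp
        ultimately have "(?p t /\<^sub>R norm (?p t)) \<bullet> g < - \<epsilon>"
          by (simp only:)
        moreover have "(v /\<^sub>R c) \<bullet> g = (v \<bullet> g) / c" for v c
          by (simp add: divide_inverse_commute)
        ultimately have "(?p t \<bullet> g) / norm (?p t) < - \<epsilon>"
          by (simp only:)
        moreover have "0 < norm (?p t)" using lo by linarith
        ultimately have pg: "?p t \<bullet> g \<le> - \<epsilon> * norm (?p t)"
          by (intro less_imp_le) (simp only: pos_divide_less_eq)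
        have "w \<bullet> g \<le> 0"
          unfolding w_def by (rule segment_derivative_nonpos[OF u k \<kappa> t g refl pg])
        then have "?r * (norm (?g ?y) * (w \<bullet> g)) \<le> 0"
          using x0 by (intro mult_nonneg_nonpos) auto
        moreover have "(?r *\<^sub>R w) \<bullet> ?g ?y = ?r * (norm (?g ?y) * (w \<bullet> g))"
          by (subst gy) simp
        ultimately show ?thesis by (simp only:)
      qed
      then show "\<exists>y. (F has_real_derivative y) (at t) \<and> y \<le> 0" using der by blast
    qed simp
    then have "ln (\<pi> x) \<le> ln (\<pi> (?r *\<^sub>R z))"
      using xu by (simp add: k_def F_def)
    then show "\<pi> x \<le> \<pi> (?r *\<^sub>R z)"
      using \<pi>_pos by simp
  qed
qed

section \<open>Mass of sets with disjoint dilates\<close>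

lemma envelope_scale:
  assumes "1 \<le> s" "s \<le> 2"
  shows "envelope z \<le> 2 ^ CARD('n) * (s ^ CARD('n) * envelope (s *\<^sub>R z))"
proof -
  have K: "0 \<le> mpcn_const \<rho> CARD('n)"
    using mpcn_const_pos[of "CARD('n)" \<rho>] \<rho> by simp
  have "1 + s * norm z \<le> s * (1 + norm z)" using assms by (simp add: algebra_simps)
  then have "(1 + s * norm z)\<^sup>2 \<le> (s * (1 + norm z))\<^sup>2"
    using assms by (intro power_mono) auto
  moreover have p: "0 < (1 + s * norm z)\<^sup>2"
    using assms one_plus_norm_power2_pos[of "s *\<^sub>R z"] by simp
  ultimately have "s / (s * (1 + norm z))\<^sup>2 \<le> s / (1 + s * norm z)\<^sup>2"
    using assms by (intro divide_left_mono[OF _ _ mult_pos_pos[OF less_le_trans[OF p] p]]) auto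
  moreover have "1 / (1 + norm z)\<^sup>2 \<le> 2 * (s / (s * (1 + norm z))\<^sup>2)"
    using assms one_plus_norm_power2_pos[of z]
    by (simp add: power_mult_distrib power2_eq_square[of s] divide_simps)
  ultimately have "1 / (1 + norm z)\<^sup>2 \<le> 2 * (s * (1 / (1 + s * norm z)\<^sup>2))" by simp
  then have "(1 / (1 + norm z)\<^sup>2) ^ CARD('n) \<le> (2 * (s * (1 / (1 + s * norm z)\<^sup>2))) ^ CARD('n)"
    by (intro power_mono) auto
  then have "mpcn_const \<rho> CARD('n) * (1 / (1 + norm z)\<^sup>2) ^ CARD('n)
      \<le> mpcn_const \<rho> CARD('n) * (2 * (s * (1 / (1 + s * norm z)\<^sup>2))) ^ CARD('n)"
    using K by (rule mult_left_mono)
  also have "(2 * (s * (1 / (1 + s * norm z)\<^sup>2))) ^ CARD('n) = 2 ^ CARD('n) * (s ^ CARD('n) * (1 / (1 + s * norm z)\<^sup>2) ^ CARD('n))"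
    by (simp only: power_mult_distrib)
  finally show ?thesis using assms by (simp add: envelope_def ac_simps)
qed

lemma envelope_indicator_integrable:
  assumes "A \<in> sets borel"
  shows "integrable lborel (\<lambda>z. envelope z * indicator A z)"
  using assms envelope_pos
  by (intro Bochner_Integration.integrable_bound[OF envelope_integrable]) (auto simp: indicator_def)

text \<open>\<open>y /\<^sub>R s k \<in> A\<close> says that \<open>y\<close> lies in the dilate of
  \<open>A\<close> by \<open>s k\<close>. By \<open>envelope_scale\<close> each dilate carries at
  least the mass of \<open>A\<close> divided by \<open>2 ^ d\<close>; the \<open>N\<close> dilates
  are disjoint and share the total mass of \<open>envelope\<close>.\<close>

lemma disjoint_dilations_mass:
  assumes A [measurable]: "A \<in> sets borel" and N: "0 < N"
    and s: "\<And>k. k < N \<Longrightarrow> 1 \<le> s k \<and> s k \<le> 2"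
    and disj: "\<And>i j y. i < j \<Longrightarrow> j < N \<Longrightarrow> y /\<^sub>R s i \<in> A \<Longrightarrow> y /\<^sub>R s j \<in> A \<Longrightarrow> False"
  shows "(\<integral>z. envelope z * indicator A z \<partial>lborel) \<le> 2 ^ CARD('n) * (\<integral>z. envelope z \<partial>lborel) / real N"
proof -
  let ?I = "\<integral>z. envelope z * indicator A z \<partial>lborel"
  let ?F = "\<lambda>k y. envelope y * indicator A (y /\<^sub>R s k)"
  have iF: "integrable lborel (?F k)" for k
    using envelope_pos by (intro Bochner_Integration.integrable_bound[OF envelope_integrable]) (auto simp: indicator_def)
  have one: "?I \<le> 2 ^ CARD('n) * (\<integral>y. ?F k y \<partial>lborel)" if k: "k < N" for k
  proof -
    have sk: "1 \<le> s k" "s k \<le> 2" using s[OF k] by auto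
    have ii: "integrable lborel (\<lambda>z. s k ^ CARD('n) * (envelope (s k *\<^sub>R z) * indicator A z))"
    proof (rule Bochner_Integration.integrable_bound)
      show "integrable lborel (\<lambda>z. 2 ^ CARD('n) * envelope z)" using envelope_integrable by simp
      have "s k ^ CARD('n) * envelope (s k *\<^sub>R z) \<le> 2 ^ CARD('n) * envelope z" for z
      proof (rule mult_mono)
        show "s k ^ CARD('n) \<le> 2 ^ CARD('n)" using sk by (intro power_mono) auto
        have "norm z \<le> norm (s k *\<^sub>R z)" using sk mult_right_mono[of 1 "s k" "norm z"] by simp
        then have "(1 + norm z)\<^sup>2 \<le> (1 + norm (s k *\<^sub>R z))\<^sup>2" by (intro power_mono) auto
        then show "envelope (s k *\<^sub>R z) \<le> envelope z"
          unfolding envelope_def using mpcn_const_pos[of "CARD('n)" \<rho>] \<rho> one_plus_norm_power2_pos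
          by (intro mult_left_mono power_mono divide_left_mono mult_pos_pos) (auto simp del: norm_scaleR)
      qed (use envelope_pos less_imp_le in auto)
      then show "AE z in lborel. norm (s k ^ CARD('n) * (envelope (s k *\<^sub>R z) * indicator A z)) \<le> norm (2 ^ CARD('n) * envelope z)"
        using envelope_pos sk by (intro always_eventually allI) (auto simp: indicator_def less_imp_le abs_mult)
    qed measurable
    have "?I \<le> (\<integral>z. 2 ^ CARD('n) * (s k ^ CARD('n) * (envelope (s k *\<^sub>R z) * indicator A z)) \<partial>lborel)"
    proof (rule integral_mono[OF envelope_indicator_integrable[OF A]])
      show "integrable lborel (\<lambda>z. 2 ^ CARD('n) * (s k ^ CARD('n) * (envelope (s k *\<^sub>R z) * indicator A z)))"
        using ii by simp
      show "envelope z * indicator A z \<le> 2 ^ CARD('n) * (s k ^ CARD('n) * (envelope (s k *\<^sub>R z) * indicator A z))" for z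
        using envelope_scale[OF sk, of z] by (simp add: indicator_def)
    qed
    also have "\<dots> = 2 ^ CARD('n) * (\<integral>z. s k ^ CARD('n) * (envelope (s k *\<^sub>R z) * indicator A z) \<partial>lborel)"
      by simp
    also have "(\<integral>z. s k ^ CARD('n) * (envelope (s k *\<^sub>R z) * indicator A z) \<partial>lborel) = (\<integral>y. ?F k y \<partial>lborel)"
      using sk by (subst integral_lborel_scale[of _ "s k"]) auto
    finally show ?thesis .
  qed
  have sum_le: "(\<Sum>k<N. indicator A (y /\<^sub>R s k)) \<le> (1::real)" for y
  proof (cases "\<exists>k<N. y /\<^sub>R s k \<in> A")
    case True
    then obtain k where k: "k < N" "y /\<^sub>R s k \<in> A" by blast
    have "indicator A (y /\<^sub>R s j) = (if j = k then 1 else 0 :: real)" if "j < N" for j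
      using disj[of j k y] disj[of k j y] k that by (cases "j < k"; cases "j = k") (auto simp: indicator_def)
    then have "(\<Sum>j<N. indicator A (y /\<^sub>R s j)) = (\<Sum>j<N. if j = k then 1 else 0 :: real)"
      by (intro sum.cong) auto
    then show ?thesis using k(1) by simp
  next
    case False
    then have "(\<Sum>k<N. indicator A (y /\<^sub>R s k)) = (0::real)" by (intro sum.neutral) auto
    then show ?thesis by simp
  qed
  have "real N * ?I = (\<Sum>k<N. ?I)" by simp
  also have "\<dots> \<le> (\<Sum>k<N. 2 ^ CARD('n) * (\<integral>y. ?F k y \<partial>lborel))"
    using one by (intro sum_mono) auto
  also have "\<dots> = 2 ^ CARD('n) * (\<integral>y. (\<Sum>k<N. ?F k y) \<partial>lborel)"
    by (subst Bochner_Integration.integral_sum) (rule iF, simp only: sum_distrib_left)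
  also have "\<dots> \<le> 2 ^ CARD('n) * (\<integral>y. envelope y \<partial>lborel)"
  proof (intro mult_left_mono integral_mono envelope_integrable)
    show "(\<Sum>k<N. ?F k y) \<le> envelope y" for y
      using mult_left_mono[OF sum_le[of y] less_imp_le[OF envelope_pos[of y]]]
      by (simp only: sum_distrib_left mult_1_right)
    show "integrable lborel (\<lambda>y. \<Sum>k<N. ?F k y)"
      by (intro Bochner_Integration.integrable_sum iF)
  qed simp
  finally have "?I * real N \<le> 2 ^ CARD('n) * (\<integral>y. envelope y \<partial>lborel)"
    by (simp only: mult.commute[of "real N"])
  moreover have "0 < real N" using N by simp
  ultimately show ?thesis by (simp only: pos_le_divide_eq)
qed

text \<open>Outside a set whose mass vanishes as \<open>norm (X n) \<rightarrow> \<infinity>\<close>, the dilates of the set \<open>A n\<close> by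
  \<open>2 powr (k / N)\<close>, \<open>k < N\<close>, are disjoint by rapid variation, so its mass is of order \<open>1 / N\<close>. This replaces
  polar coordinates, and no uniformity in the direction is needed.\<close>

lemma ratio_concentration:
  fixes X :: "nat \<Rightarrow> real ^ 'n"
  assumes decay: "\<And>z s. z \<noteq> 0 \<Longrightarrow> 1 < s \<Longrightarrow> ((\<lambda>r. \<pi> (r *\<^sub>R s *\<^sub>R z) / \<pi> (r *\<^sub>R z)) \<longlongrightarrow> 0) at_top"
    and X: "\<And>n. X n \<noteq> 0" "filterlim (\<lambda>n. norm (X n)) at_top sequentially"
    and \<delta>: "0 < \<delta>" and e: "0 < e"
  defines "A \<equiv> \<lambda>n. {z. \<delta> \<le> h (norm (X n) *\<^sub>R z) / h (X n) \<and> h (norm (X n) *\<^sub>R z) / h (X n) \<le> 1 / \<delta>}"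
  shows "eventually (\<lambda>n. (\<integral>z. envelope z * indicator (A n) z \<partial>lborel) < e) sequentially"
proof -
  define E where "E = 2 ^ CARD('n) * (\<integral>z. envelope z \<partial>lborel)"
  \<comment> \<open>\<open>N\<close> makes the mass of the set with disjoint dilates less than
    \<open>e / 2\<close>; the exceptional set \<open>bad\<close> receives the other half.\<close>
  obtain N where N: "E / (e / 2) < real N" "0 < N"
    using reals_Archimedean2[of "max 0 (E / (e / 2))"] by auto
  have EN: "E / real N < e / 2"
    using N e by (simp add: divide_less_eq mult.commute)
  \<comment> \<open>A geometric progression: the quotient of \<open>s j\<close> and
    \<open>s i\<close> is \<open>s (j - i)\<close>, so only finitely many dilation factors have to
    be tested.\<close>
  define s where "s k = 2 powr (real k / real N)" for k
  have s_bounds: "1 \<le> s k" "s k \<le> 2" if "k < N" for k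
  proof -
    show "1 \<le> s k" unfolding s_def by (intro ge_one_powr_ge_zero) auto
    have "s k \<le> 2 powr 1" unfolding s_def using that by (intro powr_mono) auto
    then show "s k \<le> 2" by simp
  qed
  \<comment> \<open>On \<open>A n\<close> the function \<open>h\<close> varies by a factor of at
    most \<open>1 / \<delta> ^ 2\<close>. Outside \<open>bad\<close> every tested dilation lowers
    \<open>h\<close> by more than that, so a point and its dilate cannot both lie in
    \<open>A n\<close>.\<close>
  define bad where "bad r = {z. z \<noteq> 0 \<and> (\<exists>k\<in>{1..<N}. \<delta>\<^sup>2 * h (r *\<^sub>R z) \<le> h (r *\<^sub>R s k *\<^sub>R z))}" for r
  have bad_m [measurable]: "bad r \<in> sets borel" for r
    unfolding bad_def by measurable
  have A_m [measurable]: "A n \<in> sets borel" for n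
    unfolding A_def by measurable
  have "(\<lambda>n. \<integral>z. envelope z * indicator (bad (norm (X n))) z \<partial>lborel) \<longlonglongrightarrow> (\<integral>z. 0 \<partial>(lborel :: (real ^ 'n) measure))"
  proof (rule integral_dominated_convergence[OF _ _ envelope_integrable])
    have "AE z in lborel. z \<noteq> (0 :: real ^ 'n)" by (rule AE_lborel_singleton)
    then show "AE z in lborel. (\<lambda>n. envelope z * indicator (bad (norm (X n))) z) \<longlonglongrightarrow> 0"
    proof eventually_elim
      case (elim z)
      have "eventually (\<lambda>r. \<forall>k\<in>{1..<N}. h (r *\<^sub>R s k *\<^sub>R z) < \<delta>\<^sup>2 * h (r *\<^sub>R z)) at_top"
      proof (intro eventually_ball_finite ballI)
        fix k assume k: "k \<in> {1..<N}"
        have s1: "1 < s k" unfolding s_def using k by (intro gr_one_powr) auto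
        have "((\<lambda>r. s k ^ CARD('n) * (\<pi> (r *\<^sub>R s k *\<^sub>R z) / \<pi> (r *\<^sub>R z))) \<longlongrightarrow> s k ^ CARD('n) * 0) at_top"
          by (intro tendsto_intros decay elim s1)
        then have "eventually (\<lambda>r. s k ^ CARD('n) * (\<pi> (r *\<^sub>R s k *\<^sub>R z) / \<pi> (r *\<^sub>R z)) < \<delta>\<^sup>2) at_top"
          using \<delta> by (intro order_tendstoD(2)[of _ 0]) auto
        then show "eventually (\<lambda>r. h (r *\<^sub>R s k *\<^sub>R z) < \<delta>\<^sup>2 * h (r *\<^sub>R z)) at_top"
          using eventually_gt_at_top[of 0]
        proof eventually_elim
          fix r :: real
          assume *: "s k ^ CARD('n) * (\<pi> (r *\<^sub>R s k *\<^sub>R z) / \<pi> (r *\<^sub>R z)) < \<delta>\<^sup>2" and r: "0 < r"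
          have hz: "0 < h (r *\<^sub>R z)" using elim r by (intro h_pos) auto
          have "h (r *\<^sub>R s k *\<^sub>R z) / h (r *\<^sub>R z) = s k ^ CARD('n) * (\<pi> (r *\<^sub>R s k *\<^sub>R z) / \<pi> (r *\<^sub>R z))"
            using elim r s1 by (simp add: h_def power_mult_distrib)
          with * have "h (r *\<^sub>R s k *\<^sub>R z) / h (r *\<^sub>R z) < \<delta>\<^sup>2" by simp
          then show "h (r *\<^sub>R s k *\<^sub>R z) < \<delta>\<^sup>2 * h (r *\<^sub>R z)"
            using hz by (simp only: pos_divide_less_eq)
        qed
      qed simp
      then have "eventually (\<lambda>n. \<forall>k\<in>{1..<N}. h (norm (X n) *\<^sub>R s k *\<^sub>R z) < \<delta>\<^sup>2 * h (norm (X n) *\<^sub>R z)) sequentially"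
        using X(2) by (rule eventually_compose_filterlim)
      then have "eventually (\<lambda>n. envelope z * indicator (bad (norm (X n))) z = 0) sequentially"
      proof eventually_elim
        fix n assume "\<forall>k\<in>{1..<N}. h (norm (X n) *\<^sub>R s k *\<^sub>R z) < \<delta>\<^sup>2 * h (norm (X n) *\<^sub>R z)"
        then have "z \<notin> bad (norm (X n))" unfolding bad_def by (auto simp: not_le[symmetric])
        then show "envelope z * indicator (bad (norm (X n))) z = 0" by simp
      qed
      then show ?case by (rule tendsto_eventually)
    qed
    show "AE z in lborel. norm (envelope z * indicator (bad (norm (X n))) z) \<le> envelope z" for n
      using envelope_pos by (intro always_eventually allI) (auto simp: indicator_def less_imp_le)
  qed measurable
  then have "eventually (\<lambda>n. (\<integral>z. envelope z * indicator (bad (norm (X n))) z \<partial>lborel) < e / 2) sequentially"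
    using e by (intro order_tendstoD(2)[of _ 0]) auto
  then show ?thesis
  proof eventually_elim
    fix n
    assume small: "(\<integral>z. envelope z * indicator (bad (norm (X n))) z \<partial>lborel) < e / 2"
    let ?r = "norm (X n)"
    let ?G = "A n - bad ?r"
    have hX: "0 < h (X n)" using X(1) by (rule h_pos)
    have G_m: "?G \<in> sets borel" by measurable
    have "(\<integral>z. envelope z * indicator ?G z \<partial>lborel) \<le> 2 ^ CARD('n) * (\<integral>z. envelope z \<partial>lborel) / real N"
    proof (rule disjoint_dilations_mass[OF G_m N(2), of s])
      show "1 \<le> s k \<and> s k \<le> 2" if "k < N" for k using s_bounds[OF that] by simp
      fix i j y
      assume ij: "i < j" "j < N" and zi: "y /\<^sub>R s i \<in> ?G" and zj: "y /\<^sub>R s j \<in> ?G"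
      let ?z = "y /\<^sub>R s j"
      have spos: "0 < s k" for k by (simp add: s_def)
      have "s j = s (j - i) * s i"
        using ij N by (simp add: s_def powr_add[symmetric] add_divide_distrib[symmetric] of_nat_diff)
      then have zz: "y /\<^sub>R s i = s (j - i) *\<^sub>R ?z"
        using spos[of i] spos[of "j - i"] by simp
      have A: "\<delta> \<le> h (?r *\<^sub>R (y /\<^sub>R s i)) / h (X n)" "\<delta> \<le> h (?r *\<^sub>R ?z) / h (X n)" "h (?r *\<^sub>R ?z) / h (X n) \<le> 1 / \<delta>"
        using zi zj by (simp_all only: A_def Diff_iff mem_Collect_eq)
      then have lo: "\<delta> * h (X n) \<le> h (?r *\<^sub>R (y /\<^sub>R s i))" and loj: "\<delta> * h (X n) \<le> h (?r *\<^sub>R ?z)"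
        and "h (?r *\<^sub>R ?z) \<le> 1 / \<delta> * h (X n)"
        using hX by (simp_all only: pos_le_divide_eq pos_divide_le_eq)
      then have up: "h (?r *\<^sub>R ?z) \<le> h (X n) / \<delta>" by simp
      have "0 < h (?r *\<^sub>R ?z)" using loj mult_pos_pos[OF \<delta> hX] by linarith
      then have "?z \<noteq> 0" by (metis h_0 less_irrefl scaleR_zero_right)
      moreover have "?z \<notin> bad ?r" using zj by simp
      moreover have "j - i \<in> {1..<N}" using ij by auto
      ultimately have "h (?r *\<^sub>R s (j - i) *\<^sub>R ?z) < \<delta>\<^sup>2 * h (?r *\<^sub>R ?z)"
        unfolding bad_def mem_Collect_eq by (meson not_le)
      also have "\<dots> \<le> \<delta>\<^sup>2 * (h (X n) / \<delta>)" using up by (intro mult_left_mono) auto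
      also have "\<dots> = \<delta> * h (X n)" using \<delta> by (simp add: power2_eq_square)
      also have "\<dots> \<le> h (?r *\<^sub>R s (j - i) *\<^sub>R ?z)" using lo unfolding zz .
      finally show False by simp
    qed
    also have "\<dots> < e / 2" using EN by (simp add: E_def)
    finally have G: "(\<integral>z. envelope z * indicator ?G z \<partial>lborel) < e / 2" .
    have "(\<integral>z. envelope z * indicator (A n) z \<partial>lborel)
        \<le> (\<integral>z. envelope z * indicator ?G z + envelope z * indicator (bad ?r) z \<partial>lborel)"
      using envelope_pos
      by (intro integral_mono Bochner_Integration.integrable_add envelope_indicator_integrable A_m bad_m G_m)
        (auto simp: indicator_def less_imp_le)
    also have "\<dots> = (\<integral>z. envelope z * indicator ?G z \<partial>lborel) + (\<integral>z. envelope z * indicator (bad ?r) z \<partial>lborel)"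
      by (intro Bochner_Integration.integral_add envelope_indicator_integrable bad_m G_m)
    also have "\<dots> < e" using G small by linarith
    finally show "(\<integral>z. envelope z * indicator (A n) z \<partial>lborel) < e" .
  qed
qed

text \<open>Small ratios contribute at most \<open>sqrt \<delta>\<close>. Ratios above
  \<open>1 / \<delta>\<close> are always accepted and almost annihilate the weight, a contribution
  of at most \<open>sqrt \<delta> - 1\<close>. The range between gets the crude bound 1 plus
  \<open>sqrt \<delta>\<close>, which suffices once its mass is small.\<close>

lemma flux_upper:
  assumes "0 \<le> t" "0 < \<delta>" "\<delta> < 1"
  shows "flux t \<le> sqrt \<delta> + (if \<delta> \<le> t \<and> t \<le> 1 / \<delta> then 1 else 0) - (if 1 / \<delta> < t then 1 else 0)"
proof -
  have d1: "1 < 1 / \<delta>" using assms by simp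
  have s0: "0 \<le> sqrt \<delta>" using assms by simp
  consider "t = 0" | "0 < t" "t < \<delta>" | "\<delta> \<le> t" "t \<le> 1 / \<delta>" | "1 / \<delta> < t"
    using assms by linarith
  then show ?thesis
  proof cases
    case 1
    then show ?thesis using assms s0 by (simp add: flux_cases)
  next
    case 2
    then have "flux t \<le> sqrt t" using assms by (simp add: flux_cases)
    also have "\<dots> \<le> sqrt \<delta>" using 2 by simp
    finally have "flux t \<le> sqrt \<delta>" .
    moreover have "\<not> 1 / \<delta> < t" using 2 d1 assms by linarith
    ultimately show ?thesis using 2 by simp
  next
    case 3
    then have "flux t \<le> 1" using flux_bounded[OF assms(1)] by simp
    then have "flux t \<le> sqrt \<delta> + 1" using s0 by linarith
    then show ?thesis using 3 by simp
  next
    case 4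
    then have "flux t = 1 / sqrt t - 1" using d1 by (intro flux_cases) simp
    moreover have "1 / sqrt t \<le> sqrt \<delta>"
    proof -
      have tp: "0 < t" using 4 d1 by linarith
      have "sqrt (1 / \<delta>) \<le> sqrt t" using 4 by (intro real_sqrt_le_mono) simp
      then have "1 / sqrt t \<le> 1 / sqrt (1 / \<delta>)" using assms tp by (intro divide_left_mono mult_pos_pos) auto
      then show ?thesis by (simp add: real_sqrt_divide)
    qed
    ultimately show ?thesis using 4 by simp
  qed
qed

text \<open>On a ball around \<open>sgn x / 2\<close> monotonicity keeps the ratio above
  \<open>\<delta>\<close>. Since ratios in the middle range have vanishing mass, most of the ball
  must have ratio above \<open>1 / \<delta>\<close>, and this is the source of the negative
  drift.\<close>

theorem light_tailed_ergodic:
  assumes "light_tailed \<pi>"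
  shows "geometrically_ergodic target P"
proof -
  have decay: "\<And>z s. z \<noteq> 0 \<Longrightarrow> 1 < s \<Longrightarrow> ((\<lambda>r. \<pi> (r *\<^sub>R s *\<^sub>R z) / \<pi> (r *\<^sub>R z)) \<longlongrightarrow> 0) at_top"
    using assms unfolding light_tailed_def by blast
  have diff: "\<And>x. \<pi> differentiable (at x)"
    and curv: "Limsup at_infinity (\<lambda>x. ereal ((x /\<^sub>R norm x) \<bullet>
          (gradient (\<lambda>z. ln (\<pi> z)) x /\<^sub>R norm (gradient (\<lambda>z. ln (\<pi> z)) x)))) < 0"
    using assms unfolding light_tailed_def by blast+
  obtain \<kappa> R where \<kappa>: "0 < \<kappa>" "\<kappa> \<le> 1 / 4" and mono: "\<And>x z. R \<le> norm x \<Longrightarrow>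
      z \<in> ball ((1 / 2) *\<^sub>R sgn x) \<kappa> \<Longrightarrow> \<pi> x \<le> \<pi> (norm x *\<^sub>R z)"
    using light_tailed_monotone[OF diff curv] by blast
  \<comment> \<open>\<open>k0\<close> is a lower bound of \<open>envelope\<close> on the unit ball,
    where \<open>(1 + norm z) ^ 2 \<le> 4\<close>. Hence \<open>b\<close> bounds the proposal mass
    of the ball around \<open>u / 2\<close> from below for every direction \<open>u\<close>.\<close>
  define k0 where "k0 = mpcn_const \<rho> CARD('n) * (1 / 4) ^ CARD('n)"
  define b where "b = k0 * measure lborel (ball (0 :: real ^ 'n) \<kappa>)"
  have k0: "0 < k0" using mpcn_const_pos[of "CARD('n)" \<rho>] \<rho> by (simp add: k0_def)
  have b: "0 < b" using k0 \<kappa> content_ball_pos[of \<kappa> "0 :: real ^ 'n"] by (simp add: b_def)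
  \<comment> \<open>The first bound serves the ball, on which \<open>norm z \<ge> 1 / 4\<close>; the
    second gives \<open>sqrt \<delta> \<le> b / 4\<close>. With mass at most \<open>b / 8\<close> in
    the middle range, the drift is at most \<open>b / 4 + 2 * (b / 8) - b = - b / 2\<close>.\<close>
  define \<delta> where "\<delta> = min ((1 / 4) ^ CARD('n)) ((b / 4)\<^sup>2)"
  have \<delta>: "0 < \<delta>" "\<delta> < 1" "\<delta> \<le> (1 / 4) ^ CARD('n)" "sqrt \<delta> \<le> b / 4"
  proof -
    show "0 < \<delta>" using b by (simp add: \<delta>_def)
    have "(1 / 4 :: real) ^ CARD('n) < 1" using power_strict_decreasing[of 0 "CARD('n)" "1 / 4 :: real"] by simp
    then show "\<delta> < 1" by (simp add: \<delta>_def min_less_iff_disj)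
    show "\<delta> \<le> (1 / 4) ^ CARD('n)" by (simp add: \<delta>_def)
    have "sqrt \<delta> \<le> sqrt ((b / 4)\<^sup>2)" unfolding \<delta>_def by (intro real_sqrt_le_mono) simp
    then show "sqrt \<delta> \<le> b / 4" using b by simp
  qed
  have D_inf: "eventually (\<lambda>x. D x \<le> - (b / 2)) at_infinity"
  proof (rule eventually_at_infinity_sequentially)
    fix X :: "nat \<Rightarrow> real ^ 'n"
    assume X: "\<And>n. X n \<noteq> 0" and lim: "filterlim (\<lambda>n. norm (X n)) at_top sequentially"
    let ?t = "\<lambda>n z. h (norm (X n) *\<^sub>R z) / h (X n)"
    let ?A = "\<lambda>n. {z. \<delta> \<le> ?t n z \<and> ?t n z \<le> 1 / \<delta>}"
    have "eventually (\<lambda>n. (\<integral>z. envelope z * indicator (?A n) z \<partial>lborel) < b / (8 * env_const)) sequentially"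
      using \<delta> b env_const_pos by (intro ratio_concentration decay X lim) auto
    moreover have "eventually (\<lambda>n. R \<le> norm (X n)) sequentially"
      using lim unfolding filterlim_at_top by blast
    ultimately show "eventually (\<lambda>n. D (X n) \<le> - (b / 2)) sequentially"
    proof eventually_elim
      fix n
      assume small: "(\<integral>z. envelope z * indicator (?A n) z \<partial>lborel) < b / (8 * env_const)" and R: "R \<le> norm (X n)"
      let ?u = "sgn (X n)"
      let ?B = "ball ((1 / 2) *\<^sub>R ?u) \<kappa>"
      have u: "norm ?u = 1" using X by (rule norm_sgn_1)
      then have u0: "?u \<noteq> 0" by auto
      have hX: "0 < h (X n)" using X by (rule h_pos)
      have [measurable]: "?A n \<in> sets borel" "?B \<in> sets borel" by measurable
      have tB: "\<delta> \<le> ?t n z" if "z \<in> ?B" for z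
      proof -
        have "1 / 4 \<le> norm z" using norm_bounds_half_ball[OF u that \<kappa>(2)] by simp
        then have "(1 / 4) ^ CARD('n) \<le> norm z ^ CARD('n)" by (intro power_mono) auto
        then have "\<delta> \<le> 1 * norm z ^ CARD('n)" using \<delta>(3) by linarith
        also have "\<dots> \<le> \<pi> (norm (X n) *\<^sub>R z) / \<pi> (X n) * norm z ^ CARD('n)"
          using mono[OF R that] \<pi>_pos[of "X n"] by (intro mult_right_mono) auto
        also have "\<dots> = ?t n z" using X by (simp add: h_def power_mult_distrib)
        finally show ?thesis .
      qed
      have t0: "0 \<le> ?t n z" for z by (simp add: h_nonneg)
      \<comment> \<open>By \<open>tB\<close> a point of \<open>?B\<close> lies in
        \<open>?A n\<close> or has ratio above \<open>1 / \<delta>\<close>. The coefficient 2 pays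
        once for the flux on \<open>?A n\<close> and once for the subtracted indicator on the
        overlap with \<open>?B\<close>.\<close>
      have pw: "flux (?t n z) \<le> sqrt \<delta> + 2 * indicator (?A n) z - indicator ?B z" for z
        using flux_upper[OF t0[of z] \<delta>(1,2)] tB[of z] by (auto simp: indicator_def split: if_splits)
      have iA: "integrable lborel (\<lambda>z. q ?u z * indicator (?A n) z)"
        by (intro q_bounded_integrable[OF u0, of _ 1]) auto
      have iB: "integrable lborel (\<lambda>z. q ?u z * indicator ?B z)"
        by (intro q_bounded_integrable[OF u0, of _ 1]) auto
      have "D (X n) \<le> (\<integral>z. sqrt \<delta> * q ?u z + 2 * (q ?u z * indicator (?A n) z) - q ?u z * indicator ?B z \<partial>lborel)"
        unfolding D_def
      proof (rule integral_mono)
        show "integrable lborel (\<lambda>z. q ?u z * flux (?t n z))"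
          by (intro q_bounded_integrable[OF u0, of _ 1] flux_bounded t0) auto
        show "integrable lborel (\<lambda>z. sqrt \<delta> * q ?u z + 2 * (q ?u z * indicator (?A n) z) - q ?u z * indicator ?B z)"
          using iA iB q_integrable[OF u0] by auto
        show "q ?u z * flux (?t n z) \<le> sqrt \<delta> * q ?u z + 2 * (q ?u z * indicator (?A n) z) - q ?u z * indicator ?B z" for z
          using mult_left_mono[OF pw[of z] q_nonneg[of ?u z]] by (simp add: algebra_simps)
      qed
      also have "\<dots> = sqrt \<delta> + 2 * (\<integral>z. q ?u z * indicator (?A n) z \<partial>lborel) - (\<integral>z. q ?u z * indicator ?B z \<partial>lborel)"
        using iA iB q_integrable[OF u0] integral_q[OF u0] by simp
      finally have D: "D (X n) \<le> sqrt \<delta> + 2 * (\<integral>z. q ?u z * indicator (?A n) z \<partial>lborel) - (\<integral>z. q ?u z * indicator ?B z \<partial>lborel)" .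
      have "(\<integral>z. q ?u z * indicator (?A n) z \<partial>lborel) \<le> (\<integral>z. env_const * (envelope z * indicator (?A n) z) \<partial>lborel)"
        using q_upper[OF u] by (intro integral_mono iA integrable_mult_right envelope_indicator_integrable) (auto simp: indicator_def)
      also have "\<dots> = env_const * (\<integral>z. envelope z * indicator (?A n) z \<partial>lborel)" by simp
      also have "\<dots> \<le> env_const * (b / (8 * env_const))"
        using small env_const_pos by (intro mult_left_mono) auto
      also have "\<dots> = b / 8" using env_const_pos by simp
      finally have A: "(\<integral>z. q ?u z * indicator (?A n) z \<partial>lborel) \<le> b / 8" .
      have "b = k0 * measure lborel ?B" using \<kappa> by (simp add: b_def content_ball)
      also have "\<dots> = (\<integral>z. k0 * indicator ?B z \<partial>lborel)" by simp
      also have "\<dots> \<le> (\<integral>z. q ?u z * indicator ?B z \<partial>lborel)"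
      proof (rule integral_mono[OF _ iB])
        show "integrable lborel (\<lambda>z. k0 * indicator ?B z)"
          using emeasure_lborel_ball_finite[of "(1 / 2) *\<^sub>R ?u" \<kappa>] by (intro integrable_mult_right) (simp add: integrable_indicator_iff)
        fix z
        show "k0 * indicator ?B z \<le> q ?u z * indicator ?B z"
        proof (cases "z \<in> ?B")
          case True
          have "norm z \<le> 1" using norm_bounds_half_ball[OF u True \<kappa>(2)] by simp
          then have "(1 + norm z)\<^sup>2 \<le> 2\<^sup>2" by (intro power_mono) auto
          then have "1 / 2\<^sup>2 \<le> 1 / (1 + norm z)\<^sup>2"
            using one_plus_norm_power2_pos[of z] by (intro divide_left_mono mult_pos_pos) auto
          then have "(1 / 4) ^ CARD('n) \<le> (1 / (1 + norm z)\<^sup>2) ^ CARD('n)" by (intro power_mono) auto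
          then have "k0 \<le> envelope z"
            unfolding k0_def envelope_def using mpcn_const_pos[of "CARD('n)" \<rho>] \<rho> by (intro mult_left_mono) auto
          then show ?thesis using q_lower[OF u, of z] True by simp
        qed simp
      qed
      finally have B: "b \<le> (\<integral>z. q ?u z * indicator ?B z \<partial>lborel)" .
      show "D (X n) \<le> - (b / 2)" using D A B \<delta>(4) by linarith
    qed
  qed
  have "(h \<longlongrightarrow> 0) at_infinity"
  proof (rule h_tendsto_0[OF \<kappa>, of R])
    fix x z :: "real ^ 'n" assume "R \<le> norm x" "z \<in> ball ((1 / 2) *\<^sub>R sgn x) \<kappa>"
    then show "\<pi> x \<le> 2 * \<pi> (norm x *\<^sub>R z)"
      using mono[of x z] \<pi>_pos[of "norm x *\<^sub>R z"] by linarith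
  qed
  moreover obtain \<eta>0 where "0 < \<eta>0" "eventually (\<lambda>x. D x \<le> - \<eta>0) (at 0)" by (rule D_at_0)
  moreover have "eventually (\<lambda>x. D x \<le> - min \<eta>0 (b / 2)) at_infinity"
    using D_inf by eventually_elim simp
  moreover have "eventually (\<lambda>x. D x \<le> - min \<eta>0 (b / 2)) (at 0)"
    using calculation(3) by eventually_elim simp
  ultimately show ?thesis
    using b by (intro geometric_ergodicity_criterion[of "min \<eta>0 (b / 2)"]) auto
qed

end

section \<open>Geometric ergodicity\<close>

theorem theorem1:
  fixes \<rho> :: real and \<pi> :: "real ^ 'n \<Rightarrow> real"
  assumes "CARD('n) \<ge> 2"
    and "0 < \<rho>" and "\<rho> < 1"
    and "prob_space (density lborel (\<lambda>x. ennreal (\<pi> x)))"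
  shows "(heavy_tailed \<pi> \<longrightarrow>
           geometrically_ergodic (density lborel (\<lambda>x. ennreal (\<pi> x))) (mpcn_kernel \<rho> \<pi>)) \<and>
         (light_tailed \<pi> \<longrightarrow>
           geometrically_ergodic (density lborel (\<lambda>x. ennreal (\<pi> x))) (mpcn_kernel \<rho> \<pi>))"
proof (intro conjI impI)
  assume heavy: "heavy_tailed \<pi>"
  have "\<And>x. 0 < \<pi> x" "continuous_on UNIV \<pi>"
    using heavy unfolding heavy_tailed_def by blast+
  then interpret mpcn_target \<rho> \<pi>
    using assms by (intro mpcn_target.intro) auto
  show "geometrically_ergodic target P"
    using heavy by (rule heavy_tailed_ergodic)
next
  assume light: "light_tailed \<pi>"
  have pos: "\<And>x. 0 < \<pi> x" and diff: "\<And>x. \<pi> differentiable (at x)"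
    using light unfolding light_tailed_def by blast+
  have "continuous_on UNIV \<pi>"
    using diff by (simp add: continuous_at_imp_continuous_on differentiable_imp_continuous_within)
  with pos interpret mpcn_target \<rho> \<pi>
    using assms by (intro mpcn_target.intro) auto
  show "geometrically_ergodic target P"
    using light by (rule light_tailed_ergodic)
qed

end
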